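(* Let $(E,g)$ be a real analytic Riemannian manifold, $p\in E$, let $U$ be a real analytic function near $p$ with non-zero germ at $p$, $U(p)=0$ and $d_pU=0$, and let $\mu$ be a real analytic one-form near $p$ verifying the weak magnetism hypothesis. Let $f$ be the restriction to the unit sphere of the first non-zero jet of $U$ at $p$. Suppose that $f$ is a Morse function and zero is a regular value of $f$. Then the point $p$ is totally unstable for the Lagrangian system $L(x,v)=\tfrac12 g_x(v,v)+\mu_x(v)-U(x)$.
   Context: **System.** Let $A$ be a neighbourhood of $p$ on which $U,\mu$ are defined. The Euler–Lagrange flow on $TA$ is given by $\dot x=v$, $\nabla_{\dot x}v=-\mathrm{grad}_g U(x)-\mathcal{R}_x(\iota_v d\mu(x))$, where $\nabla$ is the Levi-Civita connection and $\mathcal{R}_x:T_x^*E\to T_xE$ is Riesz duality. The energy $H(x,v)=\tfrac12 g_x(v,v)+U(x)$ is constant along orbits. **First non-zero jet and $f$.** Take a real analytic chart centered at $p$ with metric coefficients $g_{ij}(0)=\delta_{ij}$. The first non-zero jet $U_l$ of $U$ is its lowest-degree non-zero homogeneous Taylor term at the origin, a homogeneous polynomial on $\mathbb{R}^n$ of degree $l\ge2$; $f=U_l|_{S^{n-1}}$ with $S^{n-1}$ the Euclidean unit sphere (up to an orthogonal transformation, $f$ is independent of the chart). **Weak magnetism hypothesis.** $d-l/2\ge 1$, where $d$ is the degree of the first non-zero jet of $\mu$ at $p$ (smallest degree of a non-zero homogeneous Taylor term of its coefficients in the chart); if the germ of $\mu$ is zero the hypothesis is considered satisfied. **Total instability.**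 $p$ is totally unstable if there is a neighbourhood $B$ of $p$ such that for every $z\in TB$ with $H(z)<0$, the positive orbit of $z$ is not contained in $TB$. *)

theory Defs
  imports "HOL-Analysis.Analysis"
begin

section \<open>Real analytic functions and Taylor terms\<close>

definition monomial_val :: "('n::finite \<Rightarrow> nat) \<Rightarrow> real^'n \<Rightarrow> real" where
  "monomial_val \<alpha> h = (\<Prod>i\<in>UNIV. (h $ i) ^ \<alpha> i)"

definition has_power_series ::
  "(real^'n \<Rightarrow> real) \<Rightarrow> (('n::finite \<Rightarrow> nat) \<Rightarrow> real) \<Rightarrow> real^'n \<Rightarrow> bool" where
  "has_power_series F a y \<longleftrightarrow>
     (\<exists>r>0. \<forall>z\<in>ball y r. ((\<lambda>\<alpha>. a \<alpha> * monomial_val \<alpha> (z - y)) has_sum F z) UNIV)"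

definition real_analytic_on :: "(real^'n \<Rightarrow> real) \<Rightarrow> (real^'n::finite) set \<Rightarrow> bool" where
  "real_analytic_on F S \<longleftrightarrow> (\<forall>y\<in>S. \<exists>a. has_power_series F a y)"

text \<open>The coefficients of a convergent power series are determined by its sum, so the
  following description is proper whenever \<open>F\<close> is real analytic at \<open>y\<close>.\<close>

definition taylor_coeff :: "(real^'n \<Rightarrow> real) \<Rightarrow> real^'n \<Rightarrow> ('n::finite \<Rightarrow> nat) \<Rightarrow> real" where
  "taylor_coeff F y = (THE a. has_power_series F a y)"

definition taylor_term :: "(real^'n \<Rightarrow> real) \<Rightarrow> real^'n \<Rightarrow> nat \<Rightarrow> real^'n::finite \<Rightarrow> real" where
  "taylor_term F y k h =
     (\<Sum>\<alpha> | (\<Sum>i\<in>UNIV. \<alpha> i) = k. taylor_coeff F y \<alpha> * monomial_val \<alpha> h)"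


section \<open>Real analytic manifolds\<close>

text \<open>A chart is a pair of its domain and a map that matters only on this domain. The manifold
  is the whole type \<open>'a\<close>, whose sort will be Hausdorff and second countable.\<close>

type_synonym ('a, 'n) chart = "'a set \<times> ('a \<Rightarrow> real^'n)"

abbreviation chart_dom :: "('a, 'n::finite) chart \<Rightarrow> 'a set" where
  "chart_dom c \<equiv> fst c"

abbreviation chart_map :: "('a, 'n::finite) chart \<Rightarrow> 'a \<Rightarrow> real^'n" where
  "chart_map c \<equiv> snd c"

definition chart_inv :: "('a, 'n::finite) chart \<Rightarrow> real^'n \<Rightarrow> 'a" where
  "chart_inv c = inv_into (chart_dom c) (chart_map c)"

definition is_chart :: "('a::topological_space, 'n::finite) chart \<Rightarrow> bool" where
  "is_chart c \<longleftrightarrow> open (chart_dom c) \<and> open (chart_map c ` chart_dom c) \<and>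
     homeomorphism (chart_dom c) (chart_map c ` chart_dom c) (chart_map c) (chart_inv c)"

definition transition :: "('a, 'n::finite) chart \<Rightarrow> ('a, 'n) chart \<Rightarrow> real^'n \<Rightarrow> real^'n" where
  "transition c d = chart_map d \<circ> chart_inv c"

definition analytic_compatible :: "('a, 'n::finite) chart \<Rightarrow> ('a, 'n) chart \<Rightarrow> bool" where
  "analytic_compatible c d \<longleftrightarrow>
     (\<forall>i. real_analytic_on (\<lambda>y. transition c d y $ i) (chart_map c ` (chart_dom c \<inter> chart_dom d))) \<and>
     (\<forall>i. real_analytic_on (\<lambda>y. transition d c y $ i) (chart_map d ` (chart_dom c \<inter> chart_dom d)))"

text \<open>A maximal real analytic atlas.\<close>

definition real_analytic_manifold ::
  "('a::{t2_space, second_countable_topology}, 'n::finite) chart set \<Rightarrow> bool" where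
  "real_analytic_manifold \<A> \<longleftrightarrow>
     (\<Union>c\<in>\<A>. chart_dom c) = UNIV \<and>
     (\<forall>c\<in>\<A>. is_chart c) \<and>
     (\<forall>c\<in>\<A>. \<forall>d\<in>\<A>. analytic_compatible c d) \<and>
     (\<forall>c. is_chart c \<and> (\<forall>d\<in>\<A>. analytic_compatible c d) \<longrightarrow> c \<in> \<A>)"

definition charts_at :: "('a, 'n::finite) chart set \<Rightarrow> 'a \<Rightarrow> ('a, 'n) chart set" where
  "charts_at \<A> x = {c\<in>\<A>. x \<in> chart_dom c}"

text \<open>A tangent vector at \<open>x\<close> assigns to each chart around \<open>x\<close> a coordinate vector, compatibly
  with the changes of charts; it is normalised to vanish on all other arguments. The vector
  space operations are pointwise.\<close>

type_synonym ('a, 'n) tangent = "('a, 'n) chart \<Rightarrow> real^'n"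

definition tangent_space :: "('a, 'n::finite) chart set \<Rightarrow> 'a \<Rightarrow> ('a, 'n) tangent set" where
  "tangent_space \<A> x =
     {\<xi>. (\<forall>c\<in>charts_at \<A> x. \<forall>d\<in>charts_at \<A> x.
            \<xi> d = frechet_derivative (transition c d) (at (chart_map c x)) (\<xi> c)) \<and>
         (\<forall>c. c \<notin> charts_at \<A> x \<longrightarrow> \<xi> c = 0)}"

text \<open>The tangent vector at \<open>x\<close> that has the coordinates \<open>u\<close> in the chart \<open>c\<close>.\<close>

definition tangent_of ::
  "('a, 'n::finite) chart set \<Rightarrow> ('a, 'n) chart \<Rightarrow> 'a \<Rightarrow> real^'n \<Rightarrow> ('a, 'n) tangent" where
  "tangent_of \<A> c x u =
     (\<lambda>d. if d \<in> charts_at \<A> x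
          then frechet_derivative (transition c d) (at (chart_map c x)) u else 0)"

definition tangent_bundle ::
  "('a, 'n::finite) chart set \<Rightarrow> 'a set \<Rightarrow> ('a \<times> ('a, 'n) tangent) set" where
  "tangent_bundle \<A> S = (SIGMA x:S. tangent_space \<A> x)"

definition tangent_linear ::
  "('a, 'n::finite) chart set \<Rightarrow> 'a \<Rightarrow> (('a, 'n) tangent \<Rightarrow> real) \<Rightarrow> bool" where
  "tangent_linear \<A> x \<omega> \<longleftrightarrow>
     (\<forall>\<xi>\<in>tangent_space \<A> x. \<forall>\<eta>\<in>tangent_space \<A> x. \<forall>a b.
        \<omega> (\<lambda>c. a *\<^sub>R \<xi> c + b *\<^sub>R \<eta> c) = a * \<omega> \<xi> + b * \<omega> \<eta>)"


section \<open>Functions, one-forms and Riemannian metrics\<close>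

type_synonym ('a, 'n) one_form = "'a \<Rightarrow> ('a, 'n) tangent \<Rightarrow> real"
type_synonym ('a, 'n) metric = "'a \<Rightarrow> ('a, 'n) tangent \<Rightarrow> ('a, 'n) tangent \<Rightarrow> real"

text \<open>Coordinate expressions, as functions on the image of the chart.\<close>

definition fun_coord :: "('a \<Rightarrow> real) \<Rightarrow> ('a, 'n::finite) chart \<Rightarrow> real^'n \<Rightarrow> real" where
  "fun_coord U c y = U (chart_inv c y)"

definition form_coord ::
  "('a, 'n::finite) chart set \<Rightarrow> ('a, 'n) one_form \<Rightarrow> ('a, 'n) chart \<Rightarrow> 'n \<Rightarrow> real^'n \<Rightarrow> real" where
  "form_coord \<A> \<mu> c i y =
     (let x = chart_inv c y in \<mu> x (tangent_of \<A> c x (axis i 1)))"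

definition metric_coord ::
  "('a, 'n::finite) chart set \<Rightarrow> ('a, 'n) metric \<Rightarrow> ('a, 'n) chart \<Rightarrow> 'n \<Rightarrow> 'n \<Rightarrow> real^'n \<Rightarrow> real" where
  "metric_coord \<A> g c i j y =
     (let x = chart_inv c y in g x (tangent_of \<A> c x (axis i 1)) (tangent_of \<A> c x (axis j 1)))"

definition analytic_function_on ::
  "('a, 'n::finite) chart set \<Rightarrow> ('a \<Rightarrow> real) \<Rightarrow> 'a set \<Rightarrow> bool" where
  "analytic_function_on \<A> U A \<longleftrightarrow>
     (\<forall>c\<in>\<A>. real_analytic_on (fun_coord U c) (chart_map c ` (chart_dom c \<inter> A)))"

definition analytic_one_form_on ::
  "('a, 'n::finite) chart set \<Rightarrow> ('a, 'n) one_form \<Rightarrow> 'a set \<Rightarrow> bool" where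
  "analytic_one_form_on \<A> \<mu> A \<longleftrightarrow>
     (\<forall>x\<in>A. tangent_linear \<A> x (\<mu> x)) \<and>
     (\<forall>c\<in>\<A>. \<forall>i. real_analytic_on (form_coord \<A> \<mu> c i) (chart_map c ` (chart_dom c \<inter> A)))"

definition analytic_riemannian_metric ::
  "('a, 'n::finite) chart set \<Rightarrow> ('a, 'n) metric \<Rightarrow> bool" where
  "analytic_riemannian_metric \<A> g \<longleftrightarrow>
     (\<forall>x. \<forall>\<xi>\<in>tangent_space \<A> x.
        tangent_linear \<A> x (g x \<xi>) \<and>
        (\<forall>\<eta>\<in>tangent_space \<A> x. g x \<xi> \<eta> = g x \<eta> \<xi>) \<and>
        (\<xi> \<noteq> (\<lambda>_. 0) \<longrightarrow> g x \<xi> \<xi> > 0)) \<and>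
     (\<forall>c\<in>\<A>. \<forall>i j. real_analytic_on (metric_coord \<A> g c i j) (chart_map c ` chart_dom c))"

definition differential_zero_at :: "('a, 'n::finite) chart set \<Rightarrow> ('a \<Rightarrow> real) \<Rightarrow> 'a \<Rightarrow> bool" where
  "differential_zero_at \<A> U p \<longleftrightarrow>
     (\<forall>c\<in>charts_at \<A> p. (fun_coord U c has_derivative (\<lambda>_. 0)) (at (chart_map c p)))"


section \<open>The Euler--Lagrange flow\<close>

definition partial_deriv :: "'n \<Rightarrow> (real^'n::finite \<Rightarrow> real) \<Rightarrow> real^'n \<Rightarrow> real" where
  "partial_deriv i F y = frechet_derivative F (at y) (axis i 1)"

definition metric_matrix ::
  "('a, 'n::finite) chart set \<Rightarrow> ('a, 'n) metric \<Rightarrow> ('a, 'n) chart \<Rightarrow> real^'n \<Rightarrow> real^'n^'n" where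
  "metric_matrix \<A> g c y = (\<chi> i j. metric_coord \<A> g c i j y)"

definition riesz_coord ::
  "('a, 'n::finite) chart set \<Rightarrow> ('a, 'n) metric \<Rightarrow> ('a, 'n) chart \<Rightarrow> real^'n \<Rightarrow> real^'n \<Rightarrow> real^'n" where
  "riesz_coord \<A> g c y \<omega> = matrix_inv (metric_matrix \<A> g c y) *v \<omega>"

definition grad_coord ::
  "('a, 'n::finite) chart set \<Rightarrow> ('a, 'n) metric \<Rightarrow> ('a \<Rightarrow> real) \<Rightarrow> ('a, 'n) chart \<Rightarrow> real^'n \<Rightarrow> real^'n" where
  "grad_coord \<A> g U c y =
     riesz_coord \<A> g c y (\<chi> i. partial_deriv i (fun_coord U c) y)"

text \<open>The components of \<open>\<iota>\<^sub>v d\<mu> = d\<mu>(v, \<cdot>)\<close>.\<close>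

definition contract_d_coord ::
  "('a, 'n::finite) chart set \<Rightarrow> ('a, 'n) one_form \<Rightarrow> ('a, 'n) chart \<Rightarrow> real^'n \<Rightarrow> real^'n \<Rightarrow> real^'n" where
  "contract_d_coord \<A> \<mu> c y v =
     (\<chi> i. \<Sum>j\<in>UNIV. v $ j *
        (partial_deriv j (form_coord \<A> \<mu> c i) y - partial_deriv i (form_coord \<A> \<mu> c j) y))"

definition christoffel ::
  "('a, 'n::finite) chart set \<Rightarrow> ('a, 'n) metric \<Rightarrow> ('a, 'n) chart \<Rightarrow> 'n \<Rightarrow> 'n \<Rightarrow> 'n \<Rightarrow> real^'n \<Rightarrow> real" where
  "christoffel \<A> g c k i j y =
     (\<Sum>m\<in>UNIV. matrix_inv (metric_matrix \<A> g c y) $ k $ m *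
        (partial_deriv i (metric_coord \<A> g c j m) y
         + partial_deriv j (metric_coord \<A> g c i m) y
         - partial_deriv m (metric_coord \<A> g c i j) y)) / 2"

text \<open>The coordinates of the Levi-Civita derivative, along a curve with velocity \<open>u\<close>, of a vector
  field along the curve with value \<open>v\<close> and coordinatewise time derivative \<open>w\<close>.\<close>

definition covariant_deriv_coord ::
  "('a, 'n::finite) chart set \<Rightarrow> ('a, 'n) metric \<Rightarrow> ('a, 'n) chart \<Rightarrow> real^'n \<Rightarrow> real^'n \<Rightarrow> real^'n \<Rightarrow> real^'n \<Rightarrow> real^'n" where
  "covariant_deriv_coord \<A> g c y u v w =
     (\<chi> k. w $ k + (\<Sum>i\<in>UNIV. \<Sum>j\<in>UNIV. christoffel \<A> g c k i j y * u $ i * v $ j))"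

definition euler_lagrange_solution ::
  "('a::topological_space, 'n::finite) chart set \<Rightarrow> ('a, 'n) metric \<Rightarrow> ('a \<Rightarrow> real) \<Rightarrow>
   ('a, 'n) one_form \<Rightarrow> 'a set \<Rightarrow> real \<Rightarrow> (real \<Rightarrow> 'a \<times> ('a, 'n) tangent) \<Rightarrow> bool" where
  "euler_lagrange_solution \<A> g U \<mu> A T \<gamma> \<longleftrightarrow>
     (\<forall>t\<in>{0..T}. \<gamma> t \<in> tangent_bundle \<A> A) \<and>
     continuous_on {0..T} (\<lambda>t. fst (\<gamma> t)) \<and>
     (\<forall>t\<in>{0..T}. \<forall>c\<in>charts_at \<A> (fst (\<gamma> t)).
        let y = chart_map c (fst (\<gamma> t)); v = snd (\<gamma> t) c in
          ((\<lambda>s. chart_map c (fst (\<gamma> s))) has_vector_derivative v) (at t within {0..T}) \<and>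
          (\<exists>w. ((\<lambda>s. snd (\<gamma> s) c) has_vector_derivative w) (at t within {0..T}) \<and>
               covariant_deriv_coord \<A> g c y v v w =
                 - grad_coord \<A> g U c y - riesz_coord \<A> g c y (contract_d_coord \<A> \<mu> c y v)))"

text \<open>All states reached in non-negative time, so solutions need not exist for all times.\<close>

definition positive_orbit ::
  "('a::topological_space, 'n::finite) chart set \<Rightarrow> ('a, 'n) metric \<Rightarrow> ('a \<Rightarrow> real) \<Rightarrow>
   ('a, 'n) one_form \<Rightarrow> 'a set \<Rightarrow> 'a \<times> ('a, 'n) tangent \<Rightarrow> ('a \<times> ('a, 'n) tangent) set" where
  "positive_orbit \<A> g U \<mu> A z =
     {\<gamma> T | \<gamma> T. 0 \<le> T \<and> euler_lagrange_solution \<A> g U \<mu> A T \<gamma> \<and> \<gamma> 0 = z}"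

definition energy :: "('a, 'n::finite) metric \<Rightarrow> ('a \<Rightarrow> real) \<Rightarrow> 'a \<times> ('a, 'n) tangent \<Rightarrow> real" where
  "energy g U z = (case z of (x, v) \<Rightarrow> g x v v / 2 + U x)"

definition totally_unstable ::
  "('a::topological_space, 'n::finite) chart set \<Rightarrow> ('a, 'n) metric \<Rightarrow> ('a \<Rightarrow> real) \<Rightarrow>
   ('a, 'n) one_form \<Rightarrow> 'a set \<Rightarrow> 'a \<Rightarrow> bool" where
  "totally_unstable \<A> g U \<mu> A p \<longleftrightarrow>
     (\<exists>B. p \<in> interior B \<and> B \<subseteq> A \<and>
        (\<forall>z\<in>tangent_bundle \<A> B. energy g U z < 0 \<longrightarrow>
           \<not> positive_orbit \<A> g U \<mu> A z \<subseteq> tangent_bundle \<A> B))"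


section \<open>Jets at the point\<close>

definition normal_chart_at ::
  "('a, 'n::finite) chart set \<Rightarrow> ('a, 'n) metric \<Rightarrow> 'a \<Rightarrow> ('a, 'n) chart \<Rightarrow> bool" where
  "normal_chart_at \<A> g p c \<longleftrightarrow> c \<in> charts_at \<A> p \<and> chart_map c p = 0 \<and>
     (\<forall>i j. metric_coord \<A> g c i j 0 = (if i = j then 1 else 0))"

definition potential_degree :: "('a \<Rightarrow> real) \<Rightarrow> ('a, 'n::finite) chart \<Rightarrow> nat" where
  "potential_degree U c = (LEAST k. \<exists>h. taylor_term (fun_coord U c) 0 k h \<noteq> 0)"

definition potential_jet :: "('a \<Rightarrow> real) \<Rightarrow> ('a, 'n::finite) chart \<Rightarrow> real^'n \<Rightarrow> real" where
  "potential_jet U c = taylor_term (fun_coord U c) 0 (potential_degree U c)"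

definition magnetic_degree ::
  "('a, 'n::finite) chart set \<Rightarrow> ('a, 'n) one_form \<Rightarrow> ('a, 'n) chart \<Rightarrow> nat" where
  "magnetic_degree \<A> \<mu> c = (LEAST k. \<exists>i h. taylor_term (form_coord \<A> \<mu> c i) 0 k h \<noteq> 0)"

definition weak_magnetism ::
  "('a::topological_space, 'n::finite) chart set \<Rightarrow> ('a \<Rightarrow> real) \<Rightarrow> ('a, 'n) one_form \<Rightarrow> 'a \<Rightarrow>
   ('a, 'n) chart \<Rightarrow> bool" where
  "weak_magnetism \<A> U \<mu> p c \<longleftrightarrow>
     (\<forall>\<^sub>F x in nhds p. \<forall>v\<in>tangent_space \<A> x. \<mu> x v = 0) \<or>
     real (magnetic_degree \<A> \<mu> c) - real (potential_degree U c) / 2 \<ge> 1"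


section \<open>Morse functions on the unit sphere\<close>

text \<open>Only the values of the function on \<open>sphere 0 1\<close> enter. Around \<open>x\<close> the sphere is parametrised
  over its tangent space \<open>x\<^sup>\<bottom>\<close> by the inverse of the central projection, which sends \<open>0\<close> to \<open>x\<close> with
  the identity as its derivative there; differential and Hessian are taken in this chart. (The
  Hessian at a critical point is a tensor.) The definitions are meant for smooth functions on the
  sphere. If the sphere is 0-dimensional, then all its points are critical and non-degenerate.\<close>

definition sphere_tangent :: "real^'n::finite \<Rightarrow> (real^'n) set" where
  "sphere_tangent x = {u. x \<bullet> u = 0}"

definition sphere_param :: "real^'n::finite \<Rightarrow> real^'n \<Rightarrow> real^'n" where
  "sphere_param x u = (x + u) /\<^sub>R norm (x + u)"

definition sphere_critical :: "(real^'n::finite \<Rightarrow> real) \<Rightarrow> real^'n \<Rightarrow> bool" where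
  "sphere_critical f x \<longleftrightarrow> x \<in> sphere 0 1 \<and>
     ((\<lambda>u. f (sphere_param x u)) has_derivative (\<lambda>_. 0)) (at 0 within sphere_tangent x)"

definition sphere_hessian :: "(real^'n::finite \<Rightarrow> real) \<Rightarrow> real^'n \<Rightarrow> real^'n \<Rightarrow> real^'n \<Rightarrow> real" where
  "sphere_hessian f x u w =
     deriv (\<lambda>s. deriv (\<lambda>t. f (sphere_param x (s *\<^sub>R u + t *\<^sub>R w))) 0) 0"

definition sphere_morse :: "(real^'n::finite \<Rightarrow> real) \<Rightarrow> bool" where
  "sphere_morse f \<longleftrightarrow>
     (\<forall>x. sphere_critical f x \<longrightarrow>
        (\<forall>u\<in>sphere_tangent x. (\<forall>w\<in>sphere_tangent x. sphere_hessian f x u w = 0) \<longrightarrow> u = 0))"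

definition sphere_regular_value :: "(real^'n::finite \<Rightarrow> real) \<Rightarrow> real \<Rightarrow> bool" where
  "sphere_regular_value f a \<longleftrightarrow> (\<forall>x\<in>sphere 0 1. f x = a \<longrightarrow> \<not> sphere_critical f x)"

end

theory Submission
  imports Defs
begin

text \<open>In a chart with \<open>g(0) = id\<close> let \<open>Q\<close> be the leading form of \<open>U\<close>, of degree \<open>l = k + 2\<close>, and
  consider \<open>\<Lambda> = g(v, X)\<close> with \<open>X(x) = |x|\<^sup>k x - \<epsilon> \<nabla>U(x)\<close>. Along the flow
  \<open>\<Lambda>' = g(v, DX v) - dU(X) + \<dots>\<close>, where \<open>g(v, DX v) \<ge> |x|\<^sup>k |v|\<^sup>2 / 2\<close> up to higher order if \<open>\<epsilon>\<close>
  is small, while \<open>- dU(X) = \<epsilon> |\<nabla>Q|\<^sup>2 - l |x|\<^sup>k Q\<close> up to higher order. Negative energy forces \<open>U < 0\<close>,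
  hence \<open>Q\<close> is negative or almost zero relative to \<open>|x|\<^sup>l\<close>, and as zero is a regular value,
  \<open>- dU(X) \<ge> \<kappa> |x|\<^bsup>2k+2\<^esup>\<close> there. Weak magnetism makes the magnetic term negligible. Since energy
  \<open>h < 0\<close> keeps \<open>|x|\<close> away from zero, \<open>\<Lambda>\<close> grows at least linearly, but it is bounded near \<open>p\<close>.
  A solution staying near \<open>p\<close> would exist for all times, a contradiction.\<close>

section \<open>Multivariate power series\<close>

text \<open>The radial field alone contributes \<open>- l |x|^k Q\<close>, which degenerates on the
  zero cone of \<open>Q\<close>; negative energy does not keep an orbit away from that cone, since
  \<open>h\<close> may be arbitrarily close to zero. There the gradient part takes over. The weight
  \<open>|x|^k\<close> makes \<open>|x|^k x\<close> homogeneous of the same degree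
  \<open>k + 1\<close> as \<nabla>Q: gain and Hessian error of the gradient part then scale like the
  terms of the radial part, and a single \<epsilon> works at all scales. The second obstacle is
  existence. \<open>positive_orbit\<close> collects the end points of solutions, so a confined orbit
  does not by itself come with a solution on a long interval. Such a solution is built in one chart
  by Picard iteration, confined in position by the hypothesis on the orbit and in velocity by
  conservation of energy. \<open>euler_lagrange_solution\<close>, however, asks for the equation in
  every chart around each point; so the equation is rewritten as a covector that transforms
  tensorially. Power series enter through termwise differentiation and remainder bounds of
  prescribed order.\<close>

lemma monomial_val_bound:
  assumes "\<And>i. \<bar>h $ i\<bar> \<le> r"
  shows "\<bar>monomial_val \<alpha> h\<bar> \<le> r ^ sum \<alpha> UNIV"
  unfolding monomial_val_def abs_prod power_sum
  using assms by (intro prod_mono) (auto simp: power_abs intro!: power_mono)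

text \<open>For \<open>\<alpha> i = 0\<close> the truncated exponent \<open>\<alpha> i - 1\<close>
  is harmless, because the factor \<open>real (\<alpha> i)\<close> vanishes.\<close>

lemma monomial_val_has_derivative:
  "(monomial_val \<alpha> has_derivative
     (\<lambda>k. \<Sum>i\<in>UNIV. k $ i * (real (\<alpha> i) * monomial_val (\<alpha>(i := \<alpha> i - 1)) h))) (at h within S)"
proof -
  have eq: "(real (\<alpha> i) * (h $ i) ^ (\<alpha> i - 1)) * (\<Prod>j\<in>UNIV - {i}. (h $ j) ^ \<alpha> j)
      = real (\<alpha> i) * monomial_val (\<alpha>(i := \<alpha> i - 1)) h" for i
  proof -
    have "monomial_val (\<alpha>(i := \<alpha> i - 1)) h
        = (h $ i) ^ (\<alpha> i - 1) * (\<Prod>j\<in>UNIV - {i}. (h $ j) ^ \<alpha> j)"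
      unfolding monomial_val_def by (subst prod.remove[of _ i]) auto
    then show ?thesis by simp
  qed
  have d: "((\<lambda>h. (h $ i) ^ \<alpha> i) has_derivative
      (\<lambda>k. k $ i * (real (\<alpha> i) * (h $ i) ^ (\<alpha> i - 1)))) (at h within S)" for i
    by (rule derivative_eq_intros bounded_linear_imp_has_derivative bounded_linear_vec_nth refl)+
       (simp add: mult_ac)
  have "((\<lambda>h. \<Prod>i\<in>UNIV. (h $ i) ^ \<alpha> i) has_derivative
     (\<lambda>k. \<Sum>i\<in>UNIV. k $ i * (real (\<alpha> i) * monomial_val (\<alpha>(i := \<alpha> i - 1)) h))) (at h within S)"
    by (rule has_derivative_eq_rhs[OF has_derivative_prod[OF d]])
       (simp only: mult.assoc flip: eq)
  moreover have "monomial_val \<alpha> = (\<lambda>h. \<Prod>i\<in>UNIV. (h $ i) ^ \<alpha> i)"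
    by (simp add: monomial_val_def fun_eq_iff)
  ultimately show ?thesis by simp
qed

lemma monomial_val_at_0: "monomial_val \<alpha> 0 = (if \<alpha> = (\<lambda>_. 0) then 1 else 0)"
proof (cases "\<alpha> = (\<lambda>_. 0)")
  case False
  then obtain i where "\<alpha> i \<noteq> 0" by auto
  then show ?thesis using False by (auto simp: monomial_val_def intro!: prod_zero)
qed (simp add: monomial_val_def)

lemma finite_multiindices: "finite {\<alpha> :: 'n::finite \<Rightarrow> nat. sum \<alpha> UNIV = k}"
proof (rule finite_subset)
  show "{\<alpha> :: 'n \<Rightarrow> nat. sum \<alpha> UNIV = k} \<subseteq> PiE UNIV (\<lambda>_. {..k})"
    by (auto simp: PiE_def extensional_def intro: member_le_sum)
qed (auto intro: finite_PiE)

text \<open>The polydisc form of \<^const>\<open>has_power_series\<close>; it provides the majorant that termwise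
  operations need.\<close>

definition power_series_on_cube ::
  "(real^'n \<Rightarrow> real) \<Rightarrow> (('n::finite \<Rightarrow> nat) \<Rightarrow> real) \<Rightarrow> real^'n \<Rightarrow> real \<Rightarrow> bool" where
  "power_series_on_cube F a y \<rho> \<longleftrightarrow> 0 < \<rho> \<and>
     (\<lambda>\<alpha>. \<bar>a \<alpha>\<bar> * \<rho> ^ sum \<alpha> UNIV) summable_on UNIV \<and>
     (\<forall>h. (\<forall>i. \<bar>h $ i\<bar> \<le> \<rho>) \<longrightarrow> ((\<lambda>\<alpha>. a \<alpha> * monomial_val \<alpha> h) has_sum F (y + h)) UNIV)"

text \<open>Unordered summability of reals is absolute, so convergence at the corner with all
  coordinates \<rho> of a cube inside the ball already gives the majorant.\<close>

lemma has_power_series_imp_cube: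
  fixes F :: "real^'n::finite \<Rightarrow> real"
  assumes "has_power_series F a y"
  obtains \<rho> where "power_series_on_cube F a y \<rho>"
proof -
  from assms obtain r where r: "r > 0"
    and hs: "\<And>z. z \<in> ball y r \<Longrightarrow> ((\<lambda>\<alpha>. a \<alpha> * monomial_val \<alpha> (z - y)) has_sum F z) UNIV"
    unfolding has_power_series_def by blast
  \<comment> \<open>A vector of the closed cube has norm at most the sum of its coordinates, that is
    \<open>r / 2\<close>, so the cube fits into the open ball.\<close>
  define \<rho> where "\<rho> = r / (2 * real CARD('n))"
  have \<rho>: "\<rho> > 0" using r unfolding \<rho>_def by (intro divide_pos_pos mult_pos_pos) simp_all
  have ball: "y + h \<in> ball y r" if "\<forall>i. \<bar>h $ i\<bar> \<le> \<rho>" for h :: "real^'n"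
  proof -
    have "norm h \<le> (\<Sum>i\<in>UNIV. \<bar>h $ i\<bar>)" by (rule norm_le_l1_cart)
    also have "\<dots> \<le> (\<Sum>i\<in>(UNIV::'n set). \<rho>)" using that by (intro sum_mono) auto
    also have "\<dots> = r / 2" by (simp add: \<rho>_def)
    also have "\<dots> < r" using r by simp
    finally show ?thesis by (simp add: dist_norm)
  qed
  have sums: "((\<lambda>\<alpha>. a \<alpha> * monomial_val \<alpha> h) has_sum F (y + h)) UNIV"
    if "\<forall>i. \<bar>h $ i\<bar> \<le> \<rho>" for h
    using hs[OF ball[OF that]] by simp
  have "(\<lambda>\<alpha>. a \<alpha> * monomial_val \<alpha> (\<chi> i. \<rho>)) summable_on UNIV"
    using sums[of "\<chi> i. \<rho>"] \<rho> by (auto simp: summable_on_def)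
  then have "(\<lambda>\<alpha>. \<bar>a \<alpha> * monomial_val \<alpha> (\<chi> i. \<rho>)\<bar>) summable_on UNIV"
    by (rule summable_on_iff_abs_summable_on_real[THEN iffD1, unfolded real_norm_def])
  moreover have "\<bar>a \<alpha> * monomial_val \<alpha> (\<chi> i. \<rho>)\<bar> = \<bar>a \<alpha>\<bar> * \<rho> ^ sum \<alpha> UNIV" for \<alpha>
    using \<rho> by (simp add: abs_mult monomial_val_def power_sum abs_prod)
  ultimately show ?thesis using that[of \<rho>] \<rho> sums by (simp add: power_series_on_cube_def)
qed

text \<open>The coefficients of the formal \<open>i\<close>-th partial derivative of the series with
  coefficients \<open>a\<close>.\<close>

definition shift_coeff :: "'n \<Rightarrow> (('n::finite \<Rightarrow> nat) \<Rightarrow> real) \<Rightarrow> ('n \<Rightarrow> nat) \<Rightarrow> real" where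
  "shift_coeff i a \<alpha> = real (\<alpha> i + 1) * a (\<alpha>(i := \<alpha> i + 1))"

lemma sum_fun_upd_Suc: "sum (\<alpha>(i := \<alpha> i + 1)) UNIV = sum \<alpha> UNIV + (1::nat)"
  for \<alpha> :: "'n::finite \<Rightarrow> nat"
proof -
  have "sum (\<alpha>(i := \<alpha> i + 1)) UNIV = \<alpha> i + 1 + sum \<alpha> (UNIV - {i})"
    by (subst sum.remove[of _ i]) auto
  also have "\<dots> = sum \<alpha> UNIV + 1" by (subst (2) sum.remove[of _ i]) auto
  finally show ?thesis .
qed

lemma inj_shift: "inj (\<lambda>\<alpha>::'n \<Rightarrow> nat. \<alpha>(i := \<alpha> i + 1))"
proof (rule injI)
  fix x y :: "'n \<Rightarrow> nat" assume eq: "x(i := x i + 1) = y(i := y i + 1)"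
  show "x = y"
  proof
    fix j show "x j = y j" using fun_cong[OF eq, of j] by (cases "j = i") auto
  qed
qed

text \<open>Termwise differentiation leaves a sum indexed by the original exponents: those with
  \<open>\<alpha> i = 0\<close> contribute nothing, the others form the range of the injective
  shift. \<open>G\<close> is arbitrary because the identity serves both for the monomials and for
  their bounds on a cube.\<close>

lemma shift_coeff_has_sum_iff:
  fixes G :: "('n::finite \<Rightarrow> nat) \<Rightarrow> real"
  shows "((\<lambda>\<alpha>. a \<alpha> * (real (\<alpha> i) * G (\<alpha>(i := \<alpha> i - 1)))) has_sum s) UNIV \<longleftrightarrow>
   ((\<lambda>\<beta>. shift_coeff i a \<beta> * G \<beta>) has_sum s) UNIV"
proof -
  let ?sh = "\<lambda>\<alpha> :: 'n \<Rightarrow> nat. \<alpha>(i := \<alpha> i + 1)"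
  let ?f = "\<lambda>\<alpha>. a \<alpha> * (real (\<alpha> i) * G (\<alpha>(i := \<alpha> i - 1)))"
  have "(?f has_sum s) UNIV \<longleftrightarrow> (?f has_sum s) (range ?sh)"
  proof (rule has_sum_cong_neutral)
    fix \<alpha> :: "'n \<Rightarrow> nat" assume "\<alpha> \<in> UNIV - range ?sh"
    then have "\<alpha> \<noteq> ?sh (\<alpha>(i := \<alpha> i - 1))" by blast
    then have "\<alpha> i = 0" by (rule contrapos_np) (auto simp: fun_eq_iff)
    then show "?f \<alpha> = 0" by simp
  qed auto
  also have "\<dots> \<longleftrightarrow> (?f \<circ> ?sh has_sum s) UNIV" by (rule has_sum_reindex[OF inj_shift])
  also have "?f \<circ> ?sh = (\<lambda>\<beta>. shift_coeff i a \<beta> * G \<beta>)"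
    by (auto simp: shift_coeff_def fun_eq_iff)
  finally show ?thesis .
qed

lemma Suc_le_two_power: "real (n + 1) \<le> 2 * 2 ^ n"
  by (induction n) auto

text \<open>Halving the radius gains \<open>2 ^ n\<close> in total degree \<open>n\<close>, which
  pays for the factor \<open>\<alpha> i + 1 \<le> 2 * 2 ^ n\<close>.\<close>

lemma shift_coeff_summable:
  assumes \<rho>: "\<rho> > 0" and s: "(\<lambda>\<alpha>. \<bar>a \<alpha>\<bar> * \<rho> ^ sum \<alpha> UNIV) summable_on UNIV"
  shows "(\<lambda>\<alpha>. \<bar>shift_coeff i a \<alpha>\<bar> * (\<rho>/2) ^ sum \<alpha> UNIV) summable_on UNIV"
proof -
  let ?sh = "\<lambda>\<alpha>. \<alpha>(i := \<alpha> i + 1)"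
  have "(\<lambda>\<alpha>. \<bar>a \<alpha>\<bar> * \<rho> ^ sum \<alpha> UNIV) summable_on range ?sh"
    by (rule summable_on_subset_banach[OF s]) auto
  then have "(\<lambda>\<alpha>. \<bar>a (?sh \<alpha>)\<bar> * \<rho> ^ (sum \<alpha> UNIV + 1)) summable_on UNIV"
    by (subst (asm) summable_on_reindex[OF inj_shift]) (simp only: o_def sum_fun_upd_Suc)
  then have "(\<lambda>\<alpha>. (2/\<rho>) * (\<bar>a (?sh \<alpha>)\<bar> * \<rho> ^ (sum \<alpha> UNIV + 1))) summable_on UNIV"
    by (rule summable_on_cmult_right)
  then show ?thesis
  proof (rule summable_on_comparison_test)
    fix \<alpha> :: "'a \<Rightarrow> nat"
    let ?n = "sum \<alpha> UNIV"
    have "real (\<alpha> i + 1) \<le> real (?n + 1)" using member_le_sum[of i UNIV \<alpha>] by (simp del: of_nat_sum)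
    also have "\<dots> \<le> 2 * 2 ^ ?n" by (rule Suc_le_two_power)
    finally have le: "real (\<alpha> i + 1) \<le> 2 * 2 ^ ?n" .
    have "\<bar>shift_coeff i a \<alpha>\<bar> * (\<rho>/2) ^ ?n
        = real (\<alpha> i + 1) * (\<bar>a (?sh \<alpha>)\<bar> * (\<rho>/2) ^ ?n)"
      by (simp add: shift_coeff_def abs_mult)
    also have "\<dots> \<le> (2 * 2 ^ ?n) * (\<bar>a (?sh \<alpha>)\<bar> * (\<rho>/2) ^ ?n)"
      using le \<rho> by (intro mult_right_mono) auto
    also have "\<dots> = (2/\<rho>) * (\<bar>a (?sh \<alpha>)\<bar> * \<rho> ^ (?n + 1))"
      using \<rho> by (simp add: power_divide)
    finally show "\<bar>shift_coeff i a \<alpha>\<bar> * (\<rho>/2) ^ ?n \<le> (2/\<rho>) * (\<bar>a (?sh \<alpha>)\<bar> * \<rho> ^ (?n + 1))" .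
  qed (use \<rho> in auto)
qed

text \<open>Turns sums over multi-indices into sequences, the form in which
  \<open>has_derivative_series\<close> and the M-test apply.\<close>

lemma ex_enumeration: "\<exists>e :: nat \<Rightarrow> ('n::finite \<Rightarrow> nat). bij e"
proof -
  have "infinite (UNIV :: ('n \<Rightarrow> nat) set)"
  proof
    assume "finite (UNIV :: ('n \<Rightarrow> nat) set)"
    then have "finite (range (\<lambda>k::nat. (\<lambda>_::'n. k)))" by (rule finite_subset[rotated]) auto
    moreover have "inj (\<lambda>k::nat. (\<lambda>_::'n. k))" by (auto intro!: injI dest: fun_cong)
    ultimately show False using finite_imageD infinite_UNIV_nat by blast
  qed
  then show ?thesis using bij_betw_from_nat_into[of "UNIV :: ('n \<Rightarrow> nat) set"] by auto
qed

text \<open>On the closed half cube the differentiated series has a summable majorant, so the M-test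
  gives uniform convergence of the partial derivatives and \<open>has_derivative_series\<close>
  differentiates the sum within this convex set. In its interior this is the derivative in the full
  sense.\<close>

lemma cube_termwise_derivative:
  fixes F :: "real^'n::finite \<Rightarrow> real"
  assumes "power_series_on_cube F a y \<rho>"
  defines "D \<equiv> \<lambda>i h. infsum (\<lambda>\<alpha>. shift_coeff i a \<alpha> * monomial_val \<alpha> h) UNIV"
  shows "\<And>i h. (\<And>j. \<bar>h $ j\<bar> \<le> \<rho>/2) \<Longrightarrow>
           ((\<lambda>\<alpha>. shift_coeff i a \<alpha> * monomial_val \<alpha> h) has_sum D i h) UNIV"
    and "\<And>h. (\<And>j. \<bar>h $ j\<bar> < \<rho>/2) \<Longrightarrow>
           (F has_derivative (\<lambda>k. \<Sum>i\<in>UNIV. k $ i * D i h)) (at (y + h))"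
proof -
  have \<rho>: "\<rho> > 0" and sm: "(\<lambda>\<alpha>. \<bar>a \<alpha>\<bar> * \<rho> ^ sum \<alpha> UNIV) summable_on UNIV"
    and hs: "\<And>h. (\<And>i. \<bar>h $ i\<bar> \<le> \<rho>) \<Longrightarrow>
       ((\<lambda>\<alpha>. a \<alpha> * monomial_val \<alpha> h) has_sum F (y + h)) UNIV"
    using assms(1) by (auto simp: power_series_on_cube_def)
  note ssm = shift_coeff_summable[OF \<rho> sm]
  show Dsum: "((\<lambda>\<alpha>. shift_coeff i a \<alpha> * monomial_val \<alpha> h) has_sum D i h) UNIV"
    if "\<And>j. \<bar>h $ j\<bar> \<le> \<rho>/2" for i h
    unfolding D_def
  proof (rule has_sum_infsum, rule abs_summable_summable,
      rule summable_on_comparison_test[OF ssm[of i]])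
    fix \<alpha>
    show "norm (shift_coeff i a \<alpha> * monomial_val \<alpha> h)
        \<le> \<bar>shift_coeff i a \<alpha>\<bar> * (\<rho>/2) ^ sum \<alpha> UNIV"
      using monomial_val_bound[OF that, of \<alpha>] by (simp add: abs_mult mult_left_mono)
  qed simp
  obtain e :: "nat \<Rightarrow> ('n \<Rightarrow> nat)" where e: "bij e" using ex_enumeration by blast
  define S :: "(real^'n) set" where "S = {h. \<forall>j. \<bar>h $ j\<bar> \<le> \<rho>/2}"
  have S_box: "S = cbox (\<chi> i. - (\<rho>/2)) (\<chi> i. \<rho>/2)"
    proof -
    have "\<bar>t\<bar> \<le> \<rho>/2 \<longleftrightarrow> - (\<rho>/2) \<le> t \<and> t \<le> \<rho>/2" for t :: real by linarith
    then show ?thesis by (simp only: S_def set_eq_iff mem_box_cart mem_Collect_eq vec_lambda_beta simp_thms)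
  qed
  \<comment> \<open>\<open>c i n\<close> is the \<open>i\<close>-th partial derivative of the
    \<open>n\<close>-th term of the enumerated series, and \<open>M i n\<close> its bound on the
    half cube.\<close>
  define c where "c i n h = a (e n) * (real (e n i) * monomial_val ((e n)(i := e n i - 1)) h)"
    for i n h
  define M where "M i n = \<bar>a (e n)\<bar> * (real (e n i) * (\<rho>/2) ^ sum ((e n)(i := e n i - 1)) UNIV)"
    for i n
  have "summable (M i)" for i
  proof -
    have "((\<lambda>\<alpha>. \<bar>shift_coeff i a \<alpha>\<bar> * (\<rho>/2) ^ sum \<alpha> UNIV) has_sum
        infsum (\<lambda>\<alpha>. \<bar>shift_coeff i a \<alpha>\<bar> * (\<rho>/2) ^ sum \<alpha> UNIV) UNIV) UNIV"
      using ssm by (rule has_sum_infsum)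
    moreover have "\<bar>shift_coeff i a \<alpha>\<bar> = shift_coeff i (\<lambda>\<alpha>. \<bar>a \<alpha>\<bar>) \<alpha>" for \<alpha>
      by (simp add: shift_coeff_def abs_mult)
    ultimately have "(\<lambda>\<alpha>. \<bar>a \<alpha>\<bar> * (real (\<alpha> i) * (\<rho>/2) ^ sum (\<alpha>(i := \<alpha> i - 1)) UNIV)) summable_on UNIV"
      by (simp only: shift_coeff_has_sum_iff[symmetric, where G = "\<lambda>\<alpha>. (\<rho>/2) ^ sum \<alpha> UNIV"])
         (auto simp: summable_on_def)
    then have "(\<lambda>n. \<bar>a (e n)\<bar> * (real (e n i) * (\<rho>/2) ^ sum ((e n)(i := e n i - 1)) UNIV)) summable_on UNIV"
      using summable_on_reindex_bij_betw[OF e, where f = "\<lambda>\<alpha>. \<bar>a \<alpha>\<bar> * (real (\<alpha> i) * (\<rho>/2) ^ sum (\<alpha>(i := \<alpha> i - 1)) UNIV)"] by blast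
    then show ?thesis unfolding M_def by (rule summable_on_imp_summable)
  qed
  moreover have "norm (c i n h) \<le> M i n" if "h \<in> S" for i n h
    using monomial_val_bound[of h "\<rho>/2" "(e n)(i := e n i - 1)"] that
    by (simp add: c_def M_def abs_mult S_def mult_left_mono)
  ultimately have ul0: "uniform_limit S (\<lambda>n h. \<Sum>m<n. c i m h) (\<lambda>h. suminf (\<lambda>m. c i m h)) sequentially" for i
    by (intro Weierstrass_m_test) auto
  have csums: "(\<lambda>m. c i m h) sums D i h" if "h \<in> S" for i h
  proof -
    have "((\<lambda>\<alpha>. a \<alpha> * (real (\<alpha> i) * monomial_val (\<alpha>(i := \<alpha> i - 1)) h)) has_sum D i h) UNIV"
      using Dsum[of h i] that
        shift_coeff_has_sum_iff[of a i "\<lambda>\<alpha>. monomial_val \<alpha> h"]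
      by (simp add: S_def)
    then have "((\<lambda>m. c i m h) has_sum D i h) UNIV"
      unfolding c_def using has_sum_reindex_bij_betw[OF e, where f = "\<lambda>\<alpha>. a \<alpha> * (real (\<alpha> i) * monomial_val (\<alpha>(i := \<alpha> i - 1)) h)"]
      by blast
    then show ?thesis by (rule has_sum_imp_sums)
  qed
  have ul: "uniform_limit S (\<lambda>n h. \<Sum>m<n. c i m h) (D i) sequentially" for i
    by (rule uniform_limit_cong'[THEN iffD1, OF refl _ ul0]) (rule sums_unique[OF csums, symmetric])
  have "\<exists>g. \<forall>x\<in>S. (\<lambda>n. a (e n) * monomial_val (e n) x) sums (g x) \<and>
      (g has_derivative (\<lambda>k. \<Sum>i\<in>UNIV. k $ i * D i x)) (at x within S)"
  proof (rule has_derivative_series)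
    show "convex S" unfolding S_box by (rule convex_box)
    show "((\<lambda>x. a (e n) * monomial_val (e n) x) has_derivative
        (\<lambda>k. \<Sum>i\<in>UNIV. k $ i * c i n x)) (at x within S)" for n x
      by (rule has_derivative_eq_rhs[OF has_derivative_mult_right[OF monomial_val_has_derivative]])
         (simp add: c_def sum_distrib_left mult_ac)
    show "\<forall>\<^sub>F n in sequentially. \<forall>x\<in>S. \<forall>h.
       norm ((\<Sum>m<n. \<Sum>i\<in>UNIV. h $ i * c i m x) - (\<Sum>i\<in>UNIV. h $ i * D i x)) \<le> \<epsilon> * norm h"
      if "\<epsilon> > 0" for \<epsilon>
    proof -
      have "\<epsilon> / real CARD('n) > 0" using that by simp
      then have "\<forall>\<^sub>F n in sequentially. \<forall>x\<in>S. dist (\<Sum>m<n. c i m x) (D i x) < \<epsilon> / real CARD('n)" for i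
        using ul[of i] unfolding uniform_limit_iff by blast
      then have "\<forall>\<^sub>F n in sequentially. \<forall>i. \<forall>x\<in>S. dist (\<Sum>m<n. c i m x) (D i x) < \<epsilon> / real CARD('n)"
        by (intro eventually_all_finite) auto
      then show ?thesis
      proof eventually_elim
        case (elim n)
        show ?case
        proof (intro ballI allI)
          fix x and h :: "real^'n" assume x: "x \<in> S"
          have "(\<Sum>m<n. \<Sum>i\<in>UNIV. h $ i * c i m x) - (\<Sum>i\<in>UNIV. h $ i * D i x)
              = (\<Sum>i\<in>UNIV. h $ i * ((\<Sum>m<n. c i m x) - D i x))"
            by (subst sum.swap) (simp add: sum_distrib_left sum_subtractf right_diff_distrib)
          also have "norm \<dots> \<le> (\<Sum>i\<in>(UNIV::'n set). norm h * (\<epsilon> / real CARD('n)))"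
          proof (intro order_trans[OF norm_sum] sum_mono)
            fix i
            have "\<bar>(\<Sum>m<n. c i m x) - D i x\<bar> \<le> \<epsilon> / real CARD('n)"
              using elim x by (auto simp: dist_real_def less_imp_le)
            then show "norm (h $ i * ((\<Sum>m<n. c i m x) - D i x)) \<le> norm h * (\<epsilon> / real CARD('n))"
              unfolding real_norm_def abs_mult
              by (intro mult_mono component_le_norm_cart) auto
          qed
          also have "\<dots> = \<epsilon> * norm h" by simp
          finally show "norm ((\<Sum>m<n. \<Sum>i\<in>UNIV. h $ i * c i m x) - (\<Sum>i\<in>UNIV. h $ i * D i x)) \<le> \<epsilon> * norm h" .
        qed
      qed
    qed
    show "0 \<in> S" using \<rho> by (simp add: S_def)
    show "(\<lambda>n. a (e n) * monomial_val (e n) 0) sums F (y + 0)"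
      by (rule has_sum_imp_sums)
         (use hs[of 0] \<rho> has_sum_reindex_bij_betw[OF e, where f = "\<lambda>\<alpha>. a \<alpha> * monomial_val \<alpha> 0"] in auto)
  qed
  then obtain g where g: "\<And>x. x \<in> S \<Longrightarrow> (\<lambda>n. a (e n) * monomial_val (e n) x) sums (g x)"
    and gd: "\<And>x. x \<in> S \<Longrightarrow> (g has_derivative (\<lambda>k. \<Sum>i\<in>UNIV. k $ i * D i x)) (at x within S)"
    by blast
  have gF: "g x = F (y + x)" if "x \<in> S" for x
  proof -
    have "\<bar>x $ i\<bar> \<le> \<rho>" for i using that \<rho> unfolding S_def by (auto intro: order_trans[of _ "\<rho>/2"])
    from hs[OF this]
    have "(\<lambda>n. a (e n) * monomial_val (e n) x) sums F (y + x)"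
      by (intro has_sum_imp_sums)
         (use has_sum_reindex_bij_betw[OF e, where f = "\<lambda>\<alpha>. a \<alpha> * monomial_val \<alpha> x"] in auto)
    with g[OF that] show ?thesis by (rule sums_unique2)
  qed
  show "(F has_derivative (\<lambda>k. \<Sum>i\<in>UNIV. k $ i * D i h)) (at (y + h))"
    if h: "\<And>j. \<bar>h $ j\<bar> < \<rho>/2" for h
  proof -
    have hint: "h \<in> box (\<chi> i. - (\<rho>/2)) (\<chi> i. \<rho>/2)"
    proof -
      have "- (\<rho>/2) < h $ j \<and> h $ j < \<rho>/2" for j using h[of j] by linarith
      then show ?thesis by (simp add: mem_box_cart)
    qed
    have hS: "h \<in> S" using h by (auto simp: S_def less_imp_le)
    have "h \<in> interior S" using hint unfolding S_box by (simp add: interior_cbox)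
    from gd[OF hS, unfolded at_within_interior[OF this]]
    have "(g has_derivative (\<lambda>k. \<Sum>i\<in>UNIV. k $ i * D i h)) (at h)" .
    then have "((\<lambda>x. F (y + x)) has_derivative (\<lambda>k. \<Sum>i\<in>UNIV. k $ i * D i h)) (at h)"
      by (rule has_derivative_transform_within_open[OF _ open_box hint])
         (use gF box_subset_cbox S_box in blast)
    moreover have "((\<lambda>z. z - y) has_derivative (\<lambda>k. k)) (at (y + h))"
      by (auto intro!: derivative_eq_intros)
    ultimately show ?thesis
      using has_derivative_compose[of "\<lambda>z. z - y" "\<lambda>k. k" "y + h" UNIV "\<lambda>x. F (y + x)"] by simp
  qed
qed

section \<open>Partial derivatives of power series and uniqueness of coefficients\<close>

lemma partial_deriv_eq:
  assumes "(F has_derivative (\<lambda>k. \<Sum>i\<in>UNIV. k $ i * D i)) (at y)"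
  shows "partial_deriv i F y = D i"
proof -
  have "partial_deriv i F y = (\<Sum>j\<in>UNIV. axis i 1 $ j * D j)"
    unfolding partial_deriv_def frechet_derivative_at[OF assms, symmetric] ..
  also have "\<dots> = (\<Sum>j\<in>UNIV. if j = i then D j else 0)"
    by (intro sum.cong) (auto simp: axis_def)
  finally show ?thesis by simp
qed

lemma has_power_series_partial_deriv:
  assumes "has_power_series F a y"
  shows "has_power_series (partial_deriv i F) (shift_coeff i a) y"
proof -
  from assms obtain \<rho> where \<rho>: "power_series_on_cube F a y \<rho>" by (rule has_power_series_imp_cube)
  then have pos: "\<rho> > 0" and sm: "(\<lambda>\<alpha>. \<bar>a \<alpha>\<bar> * \<rho> ^ sum \<alpha> UNIV) summable_on UNIV"
    by (auto simp: power_series_on_cube_def)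
  note D = cube_termwise_derivative[OF \<rho>]
  show ?thesis
    unfolding has_power_series_def
  proof (intro exI[of _ "\<rho>/2"] conjI ballI)
    show "0 < \<rho>/2" using pos by simp
    fix z assume "z \<in> ball y (\<rho>/2)"
    then have le: "\<bar>(z - y) $ j\<bar> < \<rho>/2" for j
      using component_le_norm_cart[of "z - y" j] by (simp add: dist_norm norm_minus_commute)
    have "y + (z - y) = z" by simp
    note pd = partial_deriv_eq[OF D(2)[OF le, unfolded this], of i]
    show "((\<lambda>\<alpha>. shift_coeff i a \<alpha> * monomial_val \<alpha> (z - y)) has_sum partial_deriv i F z) UNIV"
      unfolding pd by (rule D(1)[OF less_imp_le[OF le]])
  qed
qed

lemma has_power_series_has_derivative:
  fixes F :: "real^'n::finite \<Rightarrow> real"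
  assumes "has_power_series F a y"
  shows "(F has_derivative (\<lambda>k. \<Sum>i\<in>UNIV. k $ i * partial_deriv i F y)) (at y)"
proof -
  from assms obtain \<rho> where \<rho>: "power_series_on_cube F a y \<rho>" by (rule has_power_series_imp_cube)
  then have pos: "\<rho> > 0" by (auto simp: power_series_on_cube_def)
  have "\<bar>(0 :: real^'n) $ j\<bar> < \<rho>/2" for j using pos by simp
  note d = cube_termwise_derivative(2)[OF \<rho> this, unfolded add_0_right]
  show ?thesis unfolding partial_deriv_eq[OF d] by (rule d)
qed

lemma has_power_series_at_center:
  assumes "has_power_series F a y"
  shows "F y = a (\<lambda>_. 0)"
proof -
  from assms obtain r where "r > 0" and
    hs: "\<And>z. z \<in> ball y r \<Longrightarrow> ((\<lambda>\<alpha>. a \<alpha> * monomial_val \<alpha> (z - y)) has_sum F z) UNIV"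
    unfolding has_power_series_def by blast
  then have "((\<lambda>\<alpha>. a \<alpha> * monomial_val \<alpha> 0) has_sum F y) UNIV"
    using hs[of y] by (simp only: centre_in_ball diff_self)
  moreover have "((\<lambda>\<alpha>. a \<alpha> * monomial_val \<alpha> 0) has_sum a (\<lambda>_. 0)) UNIV"
    by (rule has_sum_finite_neutralI[of "{\<lambda>_. 0}"]) (auto simp: monomial_val_at_0)
  ultimately show ?thesis by (rule has_sum_unique)
qed

text \<open>Locally equal functions have the same derivatives at \<open>y\<close>, so the choice
  operator inside \<open>frechet_derivative\<close> selects the same map for both.\<close>

lemma partial_deriv_cong_open:
  assumes "open W" "y \<in> W" "\<And>z. z \<in> W \<Longrightarrow> F z = G z"
  shows "partial_deriv i F y = partial_deriv i G y"
proof -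
  have "(F has_derivative D) (at y) \<longleftrightarrow> (G has_derivative D) (at y)" for D
    using assms by (metis has_derivative_transform_within_open)
  then show ?thesis unfolding partial_deriv_def frechet_derivative_def by simp
qed

text \<open>Induction on the degree: the value at the centre determines the constant coefficient,
  and a coefficient of degree \<open>k + 1\<close> is, up to a positive factor, one of degree
  \<open>k\<close> of some partial derivative. Hence \<open>F\<close>, \<open>a\<close> and
  \<open>b\<close> must vary in the induction.\<close>

lemma power_series_coeff_unique:
  assumes "has_power_series F a y" "has_power_series F b y"
  shows "sum \<alpha> UNIV = k \<Longrightarrow> a \<alpha> = b \<alpha>"
  using assms
proof (induction k arbitrary: \<alpha> a b F)
  case 0
  then have "\<alpha> = (\<lambda>_. 0)" by auto
  with 0 show ?case by (metis has_power_series_at_center)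
next
  case (Suc k)
  then obtain i where i: "\<alpha> i > 0" by (metis Zero_not_Suc gr0I sum.neutral)
  define \<beta> where "\<beta> = \<alpha>(i := \<alpha> i - 1)"
  have \<alpha>: "\<alpha> = \<beta>(i := \<beta> i + 1)" using i by (auto simp: \<beta>_def)
  have "sum \<beta> UNIV = k" using Suc.prems(1) sum_fun_upd_Suc[of \<beta> i] \<alpha> by simp
  then have "shift_coeff i a \<beta> = shift_coeff i b \<beta>"
    by (rule Suc.IH[OF _ has_power_series_partial_deriv[OF Suc.prems(2)]
          has_power_series_partial_deriv[OF Suc.prems(3)]])
  then have "a (\<beta>(i := \<beta> i + 1)) = b (\<beta>(i := \<beta> i + 1))" by (simp add: shift_coeff_def)
  then show ?case by (simp only: \<alpha>[symmetric])
qed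

lemma has_power_series_unique:
  assumes "has_power_series F a y" "has_power_series F b y"
  shows "a = b"
  by (rule ext) (rule power_series_coeff_unique[OF assms refl])

lemma taylor_coeff_eq: "has_power_series F a y \<Longrightarrow> taylor_coeff F y = a"
  unfolding taylor_coeff_def by (rule the_equality) (assumption, rule has_power_series_unique)

lemma has_power_series_diff:
  assumes "has_power_series F a y" "has_power_series G b y"
  shows "has_power_series (\<lambda>z. F z - G z) (\<lambda>\<alpha>. a \<alpha> - b \<alpha>) y"
proof -
  have diff: "((\<lambda>x. f x - g x) has_sum (u - v)) UNIV"
    if "(f has_sum u) UNIV" "(g has_sum v) UNIV" for f g :: "('a \<Rightarrow> nat) \<Rightarrow> real" and u v
  proof -
    have "((\<lambda>x. - g x) has_sum - v) UNIV"
      unfolding has_sum_uminus[of g UNIV "- v"] using that(2) by simp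
    from has_sum_add[OF that(1) this] show ?thesis by simp
  qed
  from assms obtain r s where "r > 0" "s > 0" and
    "\<And>z. z \<in> ball y r \<Longrightarrow> ((\<lambda>\<alpha>. a \<alpha> * monomial_val \<alpha> (z - y)) has_sum F z) UNIV"
    "\<And>z. z \<in> ball y s \<Longrightarrow> ((\<lambda>\<alpha>. b \<alpha> * monomial_val \<alpha> (z - y)) has_sum G z) UNIV"
    unfolding has_power_series_def by blast
  then show ?thesis
    unfolding has_power_series_def
    by (intro exI[of _ "min r s"]) (auto simp: left_diff_distrib intro!: diff)
qed

lemma has_power_series_polynomial:
  fixes a :: "('n::finite \<Rightarrow> nat) \<Rightarrow> real"
  assumes "finite I"
  shows "has_power_series (\<lambda>h. \<Sum>\<alpha>\<in>I. a \<alpha> * monomial_val \<alpha> h) (\<lambda>\<alpha>. if \<alpha> \<in> I then a \<alpha> else 0) 0"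
  unfolding has_power_series_def
  by (intro exI[of _ 1] conjI ballI has_sum_finite_neutralI[OF assms]) auto

text \<open>A polynomial is its own power series at 0, so uniqueness can compare it with the zero
  series.\<close>

lemma polynomial_coeffs_zero:
  fixes a :: "('n::finite \<Rightarrow> nat) \<Rightarrow> real"
  assumes "finite I" "\<And>h. (\<Sum>\<alpha>\<in>I. a \<alpha> * monomial_val \<alpha> h) = 0" "\<alpha> \<in> I"
  shows "a \<alpha> = 0"
proof -
  have "has_power_series (\<lambda>_. 0) (\<lambda>\<alpha>. if \<alpha> \<in> I then a \<alpha> else 0) (0 :: real^'n)"
    using has_power_series_polynomial[OF assms(1), of a] by (simp only: assms(2))
  moreover have "has_power_series (\<lambda>_. 0) (\<lambda>_. 0) (0 :: real^'n)"
    by (auto simp: has_power_series_def intro!: exI[of _ 1] has_sum_0)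
  ultimately have "(\<lambda>\<alpha>. if \<alpha> \<in> I then a \<alpha> else 0) = (\<lambda>_. 0)" by (rule has_power_series_unique)
  with assms(3) show ?thesis by (metis (mono_tags, lifting))
qed

text \<open>Every surviving term has degree at least \<open>m\<close>, so for
  \<open>norm h \<le> \<rho>\<close> it is at most its term in the majorant times
  \<open>(norm h / \<rho>) ^ m\<close>; the majorant is then summed.\<close>

lemma power_series_vanishing_order:
  fixes F :: "real^'n::finite \<Rightarrow> real"
  assumes "has_power_series F a 0" "\<And>\<alpha>. sum \<alpha> UNIV < m \<Longrightarrow> a \<alpha> = 0"
  shows "\<exists>C>0. \<exists>r>0. \<forall>h. norm h \<le> r \<longrightarrow> \<bar>F h\<bar> \<le> C * norm h ^ m"
proof -
  from assms(1) obtain \<rho> where "power_series_on_cube F a 0 \<rho>" by (rule has_power_series_imp_cube)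
  then have \<rho>: "\<rho> > 0" and sm: "(\<lambda>\<alpha>. \<bar>a \<alpha>\<bar> * \<rho> ^ sum \<alpha> UNIV) summable_on UNIV"
    and hs: "\<And>h. (\<And>i. \<bar>h $ i\<bar> \<le> \<rho>) \<Longrightarrow> ((\<lambda>\<alpha>. a \<alpha> * monomial_val \<alpha> h) has_sum F h) UNIV"
    by (auto simp: power_series_on_cube_def)
  define K where "K = infsum (\<lambda>\<alpha>. \<bar>a \<alpha>\<bar> * \<rho> ^ sum \<alpha> UNIV) UNIV"
  have K: "K \<ge> 0" unfolding K_def using \<rho> by (intro infsum_nonneg) auto
  \<comment> \<open>The summand 1 keeps the constant positive when \<open>K = 0\<close>.\<close>
  have "\<bar>F h\<bar> \<le> (K / \<rho>^m + 1) * norm h ^ m" if "norm h \<le> \<rho>" for h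
  proof -
    have le: "\<bar>h $ i\<bar> \<le> norm h" for i by (rule component_le_norm_cart)
    have "norm (F h) \<le> K * (norm h / \<rho>) ^ m"
    proof (rule norm_infsum_le[where X = UNIV])
      show "((\<lambda>\<alpha>. a \<alpha> * monomial_val \<alpha> h) has_sum F h) UNIV"
        using that le by (intro hs) (meson order_trans)
      show "((\<lambda>\<alpha>. \<bar>a \<alpha>\<bar> * \<rho> ^ sum \<alpha> UNIV * (norm h / \<rho>) ^ m) has_sum K * (norm h / \<rho>) ^ m) UNIV"
        unfolding K_def by (intro has_sum_cmult_left has_sum_infsum sm)
      fix \<alpha> :: "'n \<Rightarrow> nat"
      let ?n = "sum \<alpha> UNIV"
      show "norm (a \<alpha> * monomial_val \<alpha> h) \<le> \<bar>a \<alpha>\<bar> * \<rho> ^ ?n * (norm h / \<rho>) ^ m"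
      proof (cases "?n < m")
        case False
        have "\<bar>monomial_val \<alpha> h\<bar> \<le> norm h ^ ?n" by (rule monomial_val_bound[OF le])
        also have "\<dots> = \<rho> ^ ?n * (norm h / \<rho>) ^ ?n" using \<rho> by (simp add: power_divide)
        also have "\<dots> \<le> \<rho> ^ ?n * (norm h / \<rho>) ^ m"
          using False that \<rho> by (intro mult_left_mono power_decreasing) auto
        finally show ?thesis by (simp add: abs_mult mult_left_mono mult.assoc)
      qed (use assms(2) \<rho> in simp)
    qed
    also have "\<dots> = (K / \<rho>^m) * norm h ^ m" by (simp add: power_divide)
    finally have "\<bar>F h\<bar> \<le> (K / \<rho>^m) * norm h ^ m" by simp
    also have "\<dots> \<le> (K / \<rho>^m + 1) * norm h ^ m" by (intro mult_right_mono) auto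
    finally show ?thesis .
  qed
  moreover have "K / \<rho>^m + 1 > 0" using K \<rho> by (intro add_nonneg_pos) auto
  ultimately show ?thesis using \<rho> by blast
qed

lemma shift_coeff_vanishing:
  fixes a :: "('n::finite \<Rightarrow> nat) \<Rightarrow> real"
  assumes "\<And>\<alpha>. sum \<alpha> UNIV < m \<Longrightarrow> a \<alpha> = 0" "sum \<alpha> UNIV < m - 1"
  shows "shift_coeff i a \<alpha> = 0"
proof -
  have "sum (\<alpha>(i := \<alpha> i + 1)) UNIV < m"
    unfolding sum_fun_upd_Suc using assms(2) by linarith
  from assms(1)[OF this] show ?thesis by (simp add: shift_coeff_def)
qed

section \<open>Functions that are real analytic on a set\<close>

lemma real_analytic_onE:
  assumes "real_analytic_on F S" "y \<in> S"
  obtains a where "has_power_series F a y"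
  using assms unfolding real_analytic_on_def by blast

lemma real_analytic_on_partial_deriv:
  assumes "real_analytic_on F S"
  shows "real_analytic_on (partial_deriv i F) S"
  unfolding real_analytic_on_def
proof
  fix y assume "y \<in> S"
  with assms obtain a where "has_power_series F a y" by (rule real_analytic_onE)
  then show "\<exists>a. has_power_series (partial_deriv i F) a y"
    using has_power_series_partial_deriv by blast
qed

lemma real_analytic_on_has_derivative:
  assumes "real_analytic_on F S" "y \<in> S"
  shows "(F has_derivative (\<lambda>k. \<Sum>i\<in>UNIV. k $ i * partial_deriv i F y)) (at y)"
proof -
  from assms obtain a where "has_power_series F a y" by (rule real_analytic_onE)
  then show ?thesis by (rule has_power_series_has_derivative)
qed

lemma real_analytic_on_continuous: "real_analytic_on F S \<Longrightarrow> continuous_on S F"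
  by (rule continuous_at_imp_continuous_on)
     (blast intro: has_derivative_continuous real_analytic_on_has_derivative)

lemma real_analytic_on_subset: "real_analytic_on F S \<Longrightarrow> T \<subseteq> S \<Longrightarrow> real_analytic_on F T"
  unfolding real_analytic_on_def by blast

text \<open>Both sides are the constant coefficient of the twice shifted series, and updates at
  different indices commute.\<close>

lemma partial_deriv_commute:
  assumes "has_power_series F a y"
  shows "partial_deriv i (partial_deriv j F) y = partial_deriv j (partial_deriv i F) y"
proof -
  have "partial_deriv i (partial_deriv j F) y = shift_coeff i (shift_coeff j a) (\<lambda>_. 0)" for i j
    by (rule has_power_series_at_center[OF has_power_series_partial_deriv[OF
          has_power_series_partial_deriv[OF assms]]])
  then show ?thesis by (simp add: shift_coeff_def fun_upd_twist)
qed

section \<open>Ordinary differential equations\<close>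

text \<open>Successive Picard iterates differ by at most
  \<open>M * L ^ n * t ^ (n + 1) / (n + 1)!\<close>. This is summable for every \<open>t\<close>, so
  for a globally Lipschitz field the iteration converges uniformly on intervals of any
  length.\<close>

lemma picard_lindelof_global:
  fixes G :: "'a::banach \<Rightarrow> 'a"
  assumes lip: "L-lipschitz_on UNIV G" and "0 \<le> T"
  obtains x where "x 0 = x0"
    and "\<And>t. t \<in> {0..T} \<Longrightarrow> (x has_vector_derivative G (x t)) (at t within {0..T})"
proof -
  have L: "L \<ge> 0" using lip by (rule lipschitz_on_nonneg)
  have contG: "continuous_on S (\<lambda>t. G (y t))" if "continuous_on S y" for S :: "real set" and y
    by (rule continuous_on_compose2[OF lipschitz_on_continuous_on[OF lip] that]) auto
  define X :: "nat \<Rightarrow> real \<Rightarrow> 'a" where "X = rec_nat (\<lambda>_. x0) (\<lambda>_ y t. x0 + integral {0..t} (\<lambda>s. G (y s)))"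
  have X0: "X 0 = (\<lambda>_. x0)"
    and XS: "X (Suc n) = (\<lambda>t. x0 + integral {0..t} (\<lambda>s. G (X n s)))" for n
    by (simp_all add: X_def)
  have contX: "continuous_on {0..T} (X n)" for n
  proof (induction n)
    case (Suc n)
    then show ?case unfolding XS
      by (intro continuous_on_add continuous_on_const indefinite_integral_continuous_1
          integrable_continuous_real contG)
  qed (simp add: X0)
  have int: "(\<lambda>s. G (X n s)) integrable_on {0..t}" if "t \<in> {0..T}" for n t
    by (intro integrable_continuous_real contG continuous_on_subset[OF contX]) (use that in auto)
  define M where "M = norm (G x0)"
  have bound: "norm (X (Suc n) t - X n t) \<le> M * L ^ n * t ^ Suc n / fact (Suc n)"
    if "t \<in> {0..T}" for n t
    using that
  proof (induction n arbitrary: t)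
    case 0
    then show ?case by (simp add: X0 XS M_def)
  next
    case (Suc n)
    let ?b = "\<lambda>s. L * (M * L ^ n * s ^ Suc n / fact (Suc n))"
    have hb: "(?b has_integral (M * L ^ Suc n * t ^ Suc (Suc n) / fact (Suc (Suc n))
        - M * L ^ Suc n * 0 ^ Suc (Suc n) / fact (Suc (Suc n)))) {0..t}"
    proof (rule fundamental_theorem_of_calculus)
      show "0 \<le> t" using Suc.prems by simp
      fix s
      have "((\<lambda>s. M * L ^ Suc n * s ^ Suc (Suc n) / fact (Suc (Suc n))) has_real_derivative
          M * L ^ Suc n * (real (Suc (Suc n)) * s ^ Suc n) / fact (Suc (Suc n))) (at s within {0..t})"
        by (rule derivative_eq_intros refl | simp)+
      also have "M * L ^ Suc n * (real (Suc (Suc n)) * s ^ Suc n) / fact (Suc (Suc n)) = ?b s"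
        unfolding fact_Suc[of "Suc n"] by (simp add: field_simps del: fact_Suc of_nat_Suc)
      finally show "((\<lambda>s. M * L ^ Suc n * s ^ Suc (Suc n) / fact (Suc (Suc n))) has_vector_derivative ?b s) (at s within {0..t})"
        by (simp only: has_real_derivative_iff_has_vector_derivative)
    qed
    have "X (Suc (Suc n)) t - X (Suc n) t
        = integral {0..t} (\<lambda>s. G (X (Suc n) s) - G (X n s))"
      unfolding integral_diff[OF int[OF Suc.prems] int[OF Suc.prems]]
      by (simp only: XS[of "Suc n"]) (simp add: XS[of n])
    also have "norm \<dots> \<le> integral {0..t} ?b"
    proof (rule integral_norm_bound_integral)
      show "(\<lambda>s. G (X (Suc n) s) - G (X n s)) integrable_on {0..t}"
        by (intro integrable_diff int Suc.prems)
      show "?b integrable_on {0..t}" using hb by blast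
      fix s assume s: "s \<in> {0..t}"
      have "norm (G (X (Suc n) s) - G (X n s)) \<le> L * norm (X (Suc n) s - X n s)"
        using lipschitz_on_normD[OF lip] by simp
      also have "\<dots> \<le> ?b s" using s Suc.prems L by (intro mult_left_mono Suc.IH) auto
      finally show "norm (G (X (Suc n) s) - G (X n s)) \<le> ?b s" .
    qed
    also have "\<dots> = M * L ^ Suc n * t ^ Suc (Suc n) / fact (Suc (Suc n))"
      using integral_unique[OF hb] by (simp del: fact_Suc)
    finally show ?case .
  qed
  have "uniform_limit {0..T} (\<lambda>n t. \<Sum>m<n. X (Suc m) t - X m t)
      (\<lambda>t. suminf (\<lambda>m. X (Suc m) t - X m t)) sequentially"
  proof (rule Weierstrass_m_test)
    fix n t assume t: "t \<in> {0..T}"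
    have "norm (X (Suc n) t - X n t) \<le> M * L ^ n * t ^ Suc n / fact (Suc n)" using t by (rule bound)
    also have "\<dots> \<le> M * L ^ n * T ^ Suc n / fact n"
      using t L by (intro frac_le mult_left_mono power_mono fact_mono) (auto simp: M_def)
    also have "\<dots> = M * T * (inverse (fact n) * (L * T) ^ n)"
      by (simp add: field_simps power_mult_distrib)
    finally show "norm (X (Suc n) t - X n t) \<le> M * T * (inverse (fact n) * (L * T) ^ n)" .
  next
    show "summable (\<lambda>n. M * T * (inverse (fact n) * (L * T) ^ n))"
      by (intro summable_mult summable_exp)
  qed
  moreover have "(\<Sum>m<n. X (Suc m) t - X m t) = X n t - x0" for n t
    by (induction n) (simp_all add: X0)
  ultimately have "uniform_limit {0..T} (\<lambda>n t. x0 + (X n t - x0))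
      (\<lambda>t. x0 + suminf (\<lambda>m. X (Suc m) t - X m t)) sequentially"
    by (intro uniform_limit_add uniform_limit_const) simp
  then obtain x where ul: "uniform_limit {0..T} X x sequentially" by auto
  have contx: "continuous_on {0..T} x"
    by (rule uniform_limit_theorem[OF _ ul]) (auto simp: contX)
  have ulG: "uniform_limit {0..T} (\<lambda>n s. G (X n s)) (\<lambda>s. G (x s)) sequentially"
    by (rule uniform_limit_compose_uniformly_continuous_on[OF ul lipschitz_on_uniformly_continuous[OF lip]]) auto
  have fix_eq: "x t = x0 + integral {0..t} (\<lambda>s. G (x s))" if t: "t \<in> {0..T}" for t
  proof -
    obtain I J where IJ: "\<And>n. ((\<lambda>s. G (X n s)) has_integral I n) {0..t}"
      "((\<lambda>s. G (x s)) has_integral J) {0..t}" "I \<longlonglongrightarrow> J"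
      by (rule uniform_limit_integral[OF uniform_limit_on_subset[OF ulG, of "{0..t}"]])
         (use t in \<open>auto intro!: contG continuous_on_subset[OF contX]\<close>)
    have "(\<lambda>n. x0 + I n) \<longlonglongrightarrow> x0 + J" by (intro tendsto_intros IJ)
    moreover have "(\<lambda>n. X (Suc n) t) \<longlonglongrightarrow> x t"
      using tendsto_uniform_limitI[OF ul t] by (rule LIMSEQ_Suc)
    moreover have "X (Suc n) t = x0 + I n" for n
      using integral_unique[OF IJ(1)] by (simp add: XS)
    ultimately have "x t = x0 + J" by (simp add: LIMSEQ_unique)
    then show ?thesis using integral_unique[OF IJ(2)] by simp
  qed
  show ?thesis
  proof
    show "x 0 = x0" using fix_eq[of 0] \<open>0 \<le> T\<close> by simp
    fix t assume t: "t \<in> {0..T}"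
    have "((\<lambda>u. x0 + integral {0..u} (\<lambda>s. G (x s))) has_vector_derivative 0 + G (x t)) (at t within {0..T})"
      by (intro has_vector_derivative_add has_vector_derivative_const
          integral_has_vector_derivative contG contx t)
    then have "((\<lambda>u. x0 + integral {0..u} (\<lambda>s. G (x s))) has_vector_derivative G (x t)) (at t within {0..T})"
      by simp
    then show "(x has_vector_derivative G (x t)) (at t within {0..T})"
      by (rule has_vector_derivative_transform[OF t, rotated]) (rule fix_eq)
  qed
qed

text \<open>The vector field is extended beyond \<open>K\<close> by the nearest point projection, and the solution
  of the extended equation cannot leave \<open>K\<close> by hypothesis.\<close>

lemma ode_solution_confined:
  fixes G :: "'a::euclidean_space \<Rightarrow> 'a"
  assumes "convex K" "compact K" and lip: "L-lipschitz_on K G"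
    and "x0 \<in> K" "open W" "W \<subseteq> K" "0 \<le> T"
    and stay: "\<And>x S. 0 \<le> S \<Longrightarrow> S \<le> T \<Longrightarrow> x 0 = x0 \<Longrightarrow> (\<And>t. t \<in> {0..S} \<Longrightarrow> x t \<in> K) \<Longrightarrow>
       (\<And>t. t \<in> {0..S} \<Longrightarrow> (x has_vector_derivative G (x t)) (at t within {0..S})) \<Longrightarrow> x S \<in> W"
  obtains x where "x 0 = x0" and "\<And>t. t \<in> {0..T} \<Longrightarrow> x t \<in> W"
    and "\<And>t. t \<in> {0..T} \<Longrightarrow> (x has_vector_derivative G (x t)) (at t within {0..T})"
proof -
  let ?c = "closest_point K"
  have K: "closed K" "K \<noteq> {}" using assms compact_imp_closed by auto
  have cK: "?c y \<in> K" for y using K by (rule closest_point_in_set)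
  \<comment> \<open>The nearest point projection onto a convex set is 1-Lipschitz, so the extended
    field keeps the constant \<open>L\<close>.\<close>
  have "L-lipschitz_on UNIV (\<lambda>y. G (?c y))"
  proof (rule lipschitz_onI)
    fix y z
    have "dist (G (?c y)) (G (?c z)) \<le> L * dist (?c y) (?c z)"
      by (rule lipschitz_onD[OF lip cK cK])
    also have "\<dots> \<le> L * dist y z"
      by (intro mult_left_mono closest_point_lipschitz \<open>convex K\<close> K lipschitz_on_nonneg[OF lip])
    finally show "dist (G (?c y)) (G (?c z)) \<le> L * dist y z" .
  qed (rule lipschitz_on_nonneg[OF lip])
  then obtain x where x0: "x 0 = x0"
    and der: "\<And>t. t \<in> {0..T} \<Longrightarrow> (x has_vector_derivative G (?c (x t))) (at t within {0..T})"
    using picard_lindelof_global \<open>0 \<le> T\<close> by blast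
  have cont: "continuous_on {0..T} x"
    using der by (meson continuous_on_eq_continuous_within has_vector_derivative_continuous)
  have der': "(x has_vector_derivative G (x t)) (at t within {0..S})"
    if "S \<le> T" "t \<in> {0..S}" "x t \<in> K" for S t
    using has_vector_derivative_within_subset[OF der, of t "{0..S}"] that
    by (simp add: closest_point_self)
  have W: "x t \<in> W" if "t \<in> {0..T}" for t
  proof (rule ccontr)
    assume "x t \<notin> W"
    \<comment> \<open>The least element \<open>s\<close> of \<open>E\<close> is the first time
      outside \<open>W\<close>. Before \<open>s\<close> the curve lies in
      \<open>W \<subseteq> K\<close>, and by closedness of \<open>K\<close> also at
      \<open>s\<close>. Up to \<open>s\<close> it therefore solves the original equation, and
      \<open>stay\<close> puts \<open>x s\<close> into \<open>W\<close>.\<close>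
    define E where "E = {t \<in> {0..T}. x t \<in> - W}"
    have "compact E"
    proof -
      have "closed E" unfolding E_def
        using continuous_closed_preimage[OF cont, of "- W"] \<open>open W\<close>
        by (simp add: vimage_def Int_def closed_Compl)
      then show ?thesis by (auto simp: compact_eq_bounded_closed E_def intro: bounded_subset[of "{0..T}"])
    qed
    moreover have "E \<noteq> {}" using that \<open>x t \<notin> W\<close> by (auto simp: E_def)
    ultimately obtain s where s: "s \<in> E" "\<And>u. u \<in> E \<Longrightarrow> s \<le> u" by (metis compact_attains_inf)
    have sT: "0 \<le> s" "s \<le> T" and nW: "x s \<notin> W" using s by (auto simp: E_def)
    have before: "x u \<in> K" if "0 \<le> u" "u < s" for u
      using that sT s(2)[of u] \<open>W \<subseteq> K\<close> by (auto simp: E_def)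
    have sK: "x s \<in> K"
    proof (cases "s = 0")
      case False
      have "closed {u \<in> {0..T}. x u \<in> K}"
        using continuous_closed_preimage[OF cont _ K(1)] by (simp add: vimage_def Int_def closed_Compl)
      moreover have "{0..<s} \<subseteq> {u \<in> {0..T}. x u \<in> K}" using before sT by auto
      ultimately have "closure {0..<s} \<subseteq> {u \<in> {0..T}. x u \<in> K}" by (rule closure_minimal[rotated])
      moreover have "closure {0..<s} = {0..s}" using False sT by (intro closure_atLeastLessThan) simp
      ultimately show ?thesis using sT by auto
    qed (use x0 \<open>x0 \<in> K\<close> in simp)
    have inK: "x u \<in> K" if "u \<in> {0..s}" for u using that before sK by (cases "u = s") auto
    have "x s \<in> W" by (rule stay[OF sT x0 inK der'[OF sT(2) _ inK]])
    with nW show False by simp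
  qed
  show ?thesis
  proof (rule that[of x])
    show "(x has_vector_derivative G (x t)) (at t within {0..T})" if "t \<in> {0..T}" for t
      using der'[OF order_refl that] W[OF that] \<open>W \<subseteq> K\<close> by blast
  qed (use x0 W in auto)
qed

section \<open>Coordinate changes on the tangent bundle\<close>

text \<open>As a finite combination of partial derivatives it is linear in \<open>k\<close> by
  construction, and its dependence on \<open>y\<close> is again through functions that can be
  differentiated.\<close>

definition dir_deriv :: "(real^'n::finite \<Rightarrow> real) \<Rightarrow> real^'n \<Rightarrow> real^'n \<Rightarrow> real" where
  "dir_deriv F y k = (\<Sum>m\<in>UNIV. k $ m * partial_deriv m F y)"

lemma real_analytic_on_has_dir_deriv:
  assumes "real_analytic_on F S" "y \<in> S"
  shows "(F has_derivative dir_deriv F y) (at y)"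
  using real_analytic_on_has_derivative[OF assms] by (simp add: dir_deriv_def[abs_def])

lemma linear_real_expansion:
  fixes f :: "real^'n::finite \<Rightarrow> real"
  assumes "linear f"
  shows "f u = (\<Sum>i\<in>UNIV. u $ i * f (axis i 1))"
proof -
  have "f u = f (\<Sum>i\<in>UNIV. u $ i *s axis i 1)" by (simp add: basis_expansion)
  also have "\<dots> = (\<Sum>i\<in>UNIV. u $ i * f (axis i 1))"
    by (simp add: linear_sum[OF assms] scalar_mult_eq_scaleR linear_cmul[OF assms])
  finally show ?thesis .
qed

lemma dir_deriv_unique:
  assumes "(F has_derivative F') (at y)"
  shows "F' = dir_deriv F y"
proof
  fix k
  have "linear F'" using assms by (rule has_derivative_linear)
  then show "F' k = dir_deriv F y k"
    unfolding dir_deriv_def partial_deriv_def frechet_derivative_at[OF assms, symmetric]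
    by (rule linear_real_expansion)
qed

lemma has_derivative_cart_iff:
  fixes f :: "'a::real_normed_vector \<Rightarrow> real^'n::finite"
  shows "(f has_derivative f') (at x within S) \<longleftrightarrow>
    (\<forall>i. ((\<lambda>x. f x $ i) has_derivative (\<lambda>h. f' h $ i)) (at x within S))"
  unfolding has_derivative_componentwise_within[of f]
  by (simp add: Basis_vec_def inner_axis)

locale analytic_riemannian_manifold =
  fixes \<A> :: "('a::{t2_space, second_countable_topology}, 'n::finite) chart set"
    and g :: "('a, 'n) metric"
  assumes manifold: "real_analytic_manifold \<A>"
    and riemannian: "analytic_riemannian_metric \<A> g"
begin

lemma chart:
  assumes "c \<in> \<A>"
  shows "open (chart_dom c)" and "open (chart_map c ` chart_dom c)"
    and "homeomorphism (chart_dom c) (chart_map c ` chart_dom c) (chart_map c) (chart_inv c)"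
  using assms manifold by (auto simp: real_analytic_manifold_def is_chart_def)

lemma chart_inv_chart_map: "c \<in> \<A> \<Longrightarrow> x \<in> chart_dom c \<Longrightarrow> chart_inv c (chart_map c x) = x"
  using homeomorphism_apply1[OF chart(3)] .

lemma chart_image_open:
  assumes "c \<in> \<A>" "open S"
  shows "open (chart_map c ` (chart_dom c \<inter> S))"
proof -
  have "openin (top_of_set (chart_map c ` chart_dom c)) (chart_map c ` (chart_dom c \<inter> S))"
    using homeomorphism_imp_open_map[OF chart(3)[OF assms(1)]] assms(2) by (simp add: openin_open_Int)
  then show ?thesis using chart(2)[OF assms(1)] openin_open_trans by blast
qed

definition overlap :: "('a, 'n) chart \<Rightarrow> ('a, 'n) chart \<Rightarrow> (real^'n) set" where
  "overlap c d = chart_map c ` (chart_dom c \<inter> chart_dom d)"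

lemma overlap_open: "c \<in> \<A> \<Longrightarrow> d \<in> \<A> \<Longrightarrow> open (overlap c d)"
  unfolding overlap_def by (rule chart_image_open[OF _ chart(1)])

lemma in_overlap: "x \<in> chart_dom c \<Longrightarrow> x \<in> chart_dom d \<Longrightarrow> chart_map c x \<in> overlap c d"
  by (auto simp: overlap_def)

lemma transition_chart_map: "c \<in> \<A> \<Longrightarrow> x \<in> chart_dom c \<Longrightarrow> transition c d (chart_map c x) = chart_map d x"
  by (simp add: transition_def chart_inv_chart_map)

lemma transition_analytic:
  "c \<in> \<A> \<Longrightarrow> d \<in> \<A> \<Longrightarrow> real_analytic_on (\<lambda>y. transition c d y $ i) (overlap c d)"
  using manifold by (auto simp: real_analytic_manifold_def analytic_compatible_def overlap_def)

definition jac :: "('a, 'n) chart \<Rightarrow> ('a, 'n) chart \<Rightarrow> real^'n \<Rightarrow> real^'n \<Rightarrow> real^'n" where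
  "jac c d y k = (\<chi> a. dir_deriv (\<lambda>y. transition c d y $ a) y k)"

text \<open>The derivative of \<open>jac c d y k\<close> in \<open>y\<close> along \<open>h\<close>;
  it is the inhomogeneous term in the transformation of accelerations.\<close>

definition hess :: "('a, 'n) chart \<Rightarrow> ('a, 'n) chart \<Rightarrow> real^'n \<Rightarrow> real^'n \<Rightarrow> real^'n \<Rightarrow> real^'n" where
  "hess c d y h k =
     (\<chi> a. \<Sum>i\<in>UNIV. k $ i * dir_deriv (partial_deriv i (\<lambda>y. transition c d y $ a)) y h)"

lemma transition_has_derivative:
  assumes "c \<in> \<A>" "d \<in> \<A>" "y \<in> overlap c d"
  shows "(transition c d has_derivative jac c d y) (at y)"
  unfolding has_derivative_cart_iff jac_def
  using real_analytic_on_has_dir_deriv[OF transition_analytic[OF assms(1,2)] assms(3)] by simp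

lemma linear_jac: "linear (jac c d y)"
  by (rule linearI)
     (simp_all add: jac_def dir_deriv_def vec_eq_iff algebra_simps sum.distrib sum_distrib_left)

lemma jac_has_derivative:
  fixes Y :: "'b::real_normed_vector \<Rightarrow> real^'n"
  assumes "c \<in> \<A>" "d \<in> \<A>" "Y t \<in> overlap c d"
    and "(Y has_derivative Y') (at t within S)" "(V has_derivative V') (at t within S)"
  shows "((\<lambda>s. jac c d (Y s) (V s)) has_derivative
     (\<lambda>h. hess c d (Y t) (Y' h) (V t) + jac c d (Y t) (V' h))) (at t within S)"
  unfolding has_derivative_cart_iff
proof
  fix a
  let ?F = "\<lambda>i. partial_deriv i (\<lambda>y. transition c d y $ a)"
  have F: "((\<lambda>s. ?F i (Y s)) has_derivative (\<lambda>h. dir_deriv (?F i) (Y t) (Y' h))) (at t within S)" for i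
    using has_derivative_compose[OF assms(4) real_analytic_on_has_dir_deriv[OF
        real_analytic_on_partial_deriv[OF transition_analytic[OF assms(1,2)]] assms(3)]] .
  have V: "((\<lambda>s. V s $ i) has_derivative (\<lambda>h. V' h $ i)) (at t within S)" for i
    using assms(5) by (simp add: has_derivative_cart_iff)
  have "((\<lambda>s. \<Sum>i\<in>UNIV. V s $ i * ?F i (Y s)) has_derivative
      (\<lambda>h. \<Sum>i\<in>UNIV. V t $ i * dir_deriv (?F i) (Y t) (Y' h) + V' h $ i * ?F i (Y t))) (at t within S)"
    by (intro has_derivative_sum has_derivative_mult V F)
  then show "((\<lambda>s. jac c d (Y s) (V s) $ a) has_derivative
     (\<lambda>h. (hess c d (Y t) (Y' h) (V t) + jac c d (Y t) (V' h)) $ a)) (at t within S)"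
    by (simp add: jac_def hess_def dir_deriv_def[of "\<lambda>y. transition c d y $ a"] sum.distrib)
qed

lemma hess_commute:
  assumes "c \<in> \<A>" "d \<in> \<A>" "y \<in> overlap c d"
  shows "hess c d y h k = hess c d y k h"
proof -
  have "partial_deriv j (partial_deriv i (\<lambda>y. transition c d y $ a)) y
      = partial_deriv i (partial_deriv j (\<lambda>y. transition c d y $ a)) y" for i j a
    by (rule real_analytic_onE[OF transition_analytic[OF assms(1,2)] assms(3)])
       (rule partial_deriv_commute)
  then show ?thesis
    unfolding hess_def dir_deriv_def vec_eq_iff
    by (auto simp: sum_distrib_left mult.left_commute intro: sum.swap[THEN trans] sum.cong)
qed

text \<open>The composition of the transitions from \<open>c\<close> to \<open>d\<close> and from
  \<open>d\<close> to \<open>e\<close> agrees with the direct one on the open coordinate image of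
  the triple overlap, so both sides are its derivative.\<close>

lemma jac_chain:
  assumes "c \<in> \<A>" "d \<in> \<A>" "e \<in> \<A>" "x \<in> chart_dom c" "x \<in> chart_dom d" "x \<in> chart_dom e"
  shows "jac d e (chart_map d x) (jac c d (chart_map c x) u) = jac c e (chart_map c x) u"
proof -
  let ?y = "chart_map c x"
  define W where "W = chart_map c ` (chart_dom c \<inter> (chart_dom d \<inter> chart_dom e))"
  have W: "open W" "?y \<in> W"
    unfolding W_def using assms by (auto intro!: chart_image_open open_Int chart)
  have "(transition d e has_derivative jac d e (chart_map d x)) (at (transition c d ?y))"
    using assms by (simp add: transition_chart_map transition_has_derivative in_overlap)
  from has_derivative_compose[OF transition_has_derivative this]
  have "((\<lambda>z. transition d e (transition c d z)) has_derivative
      (\<lambda>u. jac d e (chart_map d x) (jac c d ?y u))) (at ?y)"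
    using assms by (simp add: in_overlap)
  then have "(transition c e has_derivative (\<lambda>u. jac d e (chart_map d x) (jac c d ?y u))) (at ?y)"
    by (rule has_derivative_transform_within_open[OF _ W])
       (use assms in \<open>auto simp: W_def transition_chart_map\<close>)
  moreover have "(transition c e has_derivative jac c e ?y) (at ?y)"
    using assms by (simp add: transition_has_derivative in_overlap)
  ultimately have "(\<lambda>u. jac d e (chart_map d x) (jac c d ?y u)) = jac c e ?y"
    by (rule has_derivative_unique)
  then show ?thesis by (rule fun_cong)
qed

lemma jac_self:
  assumes "c \<in> \<A>" "x \<in> chart_dom c"
  shows "jac c c (chart_map c x) u = u"
proof -
  have "(transition c c has_derivative jac c c (chart_map c x)) (at (chart_map c x))"
    using assms by (simp add: transition_has_derivative in_overlap)
  moreover have "(transition c c has_derivative (\<lambda>u. u)) (at (chart_map c x))"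
    by (rule has_derivative_transform_within_open[OF has_derivative_ident
          overlap_open[OF assms(1,1)] in_overlap[OF assms(2,2)]])
       (use assms in \<open>auto simp: overlap_def transition_chart_map\<close>)
  ultimately have "jac c c (chart_map c x) = (\<lambda>u. u)" by (rule has_derivative_unique)
  then show ?thesis by simp
qed

section \<open>Tangent vectors in coordinates\<close>

lemma charts_at_iff: "c \<in> charts_at \<A> x \<longleftrightarrow> c \<in> \<A> \<and> x \<in> chart_dom c"
  by (simp add: charts_at_def)

lemma frechet_transition:
  assumes "c \<in> charts_at \<A> x" "d \<in> charts_at \<A> x"
  shows "frechet_derivative (transition c d) (at (chart_map c x)) = jac c d (chart_map c x)"
  using assms by (intro frechet_derivative_at[symmetric] transition_has_derivative in_overlap)
    (auto simp: charts_at_iff)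

lemma tangent_of_apply:
  assumes "c \<in> charts_at \<A> x"
  shows "tangent_of \<A> c x u d = (if d \<in> charts_at \<A> x then jac c d (chart_map c x) u else 0)"
  by (simp add: tangent_of_def frechet_transition[OF assms])

lemma tangent_of_in_tangent_space:
  assumes "c \<in> charts_at \<A> x"
  shows "tangent_of \<A> c x u \<in> tangent_space \<A> x"
  unfolding tangent_space_def
  using assms by (auto simp: tangent_of_apply frechet_transition jac_chain charts_at_iff)

lemma tangent_of_self: "c \<in> charts_at \<A> x \<Longrightarrow> tangent_of \<A> c x u c = u"
  by (simp add: tangent_of_apply jac_self charts_at_iff)

lemma tangent_of_coord:
  assumes "c \<in> charts_at \<A> x" "\<xi> \<in> tangent_space \<A> x"
  shows "tangent_of \<A> c x (\<xi> c) = \<xi>"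
proof
  fix d
  show "tangent_of \<A> c x (\<xi> c) d = \<xi> d"
  proof (cases "d \<in> charts_at \<A> x")
    case True
    then have "\<xi> d = frechet_derivative (transition c d) (at (chart_map c x)) (\<xi> c)"
      using assms unfolding tangent_space_def by blast
    then show ?thesis unfolding tangent_of_def by (simp only: True if_True)
  next
    case False
    then have "\<xi> d = 0" using assms(2) unfolding tangent_space_def by blast
    then show ?thesis by (simp add: tangent_of_def False)
  qed
qed

lemma tangent_of_change:
  assumes "c \<in> charts_at \<A> x" "d \<in> charts_at \<A> x"
  shows "tangent_of \<A> d x (jac c d (chart_map c x) u) = tangent_of \<A> c x u"
  using tangent_of_coord[OF assms(2) tangent_of_in_tangent_space[OF assms(1)], of u] assms
  by (simp add: tangent_of_apply)

lemma tangent_of_combination: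
  assumes "c \<in> charts_at \<A> x"
  shows "tangent_of \<A> c x (a *\<^sub>R u + b *\<^sub>R w)
    = (\<lambda>d. a *\<^sub>R tangent_of \<A> c x u d + b *\<^sub>R tangent_of \<A> c x w d)"
  by (rule ext)
     (simp add: tangent_of_apply[OF assms] linear_add[OF linear_jac] linear_scale[OF linear_jac])

lemma linear_on_tangent_of:
  assumes "c \<in> charts_at \<A> x" "tangent_linear \<A> x \<omega>"
  shows "linear (\<lambda>u. \<omega> (tangent_of \<A> c x u))"
proof -
  have *: "\<omega> (tangent_of \<A> c x (a *\<^sub>R u + b *\<^sub>R w))
      = a * \<omega> (tangent_of \<A> c x u) + b * \<omega> (tangent_of \<A> c x w)" for a b u w
    using assms(2) tangent_of_in_tangent_space[OF assms(1)]
    unfolding tangent_linear_def tangent_of_combination[OF assms(1)] by blast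
  show ?thesis
    by (rule linearI) (use *[of 1 _ 1] *[of _ _ 0 0] in simp_all)
qed

section \<open>The metric in coordinates\<close>

definition metric_form :: "('a, 'n) chart \<Rightarrow> real^'n \<Rightarrow> real^'n \<Rightarrow> real^'n \<Rightarrow> real" where
  "metric_form c y u w = (\<Sum>i\<in>UNIV. \<Sum>j\<in>UNIV. metric_coord \<A> g c i j y * u $ i * w $ j)"

lemma riemannianD:
  assumes "\<xi> \<in> tangent_space \<A> x"
  shows "tangent_linear \<A> x (g x \<xi>)"
    and "\<eta> \<in> tangent_space \<A> x \<Longrightarrow> g x \<xi> \<eta> = g x \<eta> \<xi>"
    and "\<xi> \<noteq> (\<lambda>_. 0) \<Longrightarrow> g x \<xi> \<xi> > 0"
  using riemannian assms unfolding analytic_riemannian_metric_def by blast+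

lemma metric_tangent_of:
  assumes c: "c \<in> charts_at \<A> x"
  shows "g x (tangent_of \<A> c x u) (tangent_of \<A> c x w) = metric_form c (chart_map c x) u w"
proof -
  note T = tangent_of_in_tangent_space[OF c]
  let ?T = "tangent_of \<A> c x"
  have lin: "linear (\<lambda>w. g x (?T u) (?T w))" for u
    by (rule linear_on_tangent_of[OF c riemannianD(1)[OF T]])
  have lin': "linear (\<lambda>u. g x (?T u) (?T w))" for w
    using lin[of w] by (subst riemannianD(2)[OF T T])
  have "g x (?T u) (?T w) = (\<Sum>i\<in>UNIV. u $ i * g x (?T (axis i 1)) (?T w))"
    by (rule linear_real_expansion[OF lin'])
  also have "\<dots> = (\<Sum>i\<in>UNIV. u $ i * (\<Sum>j\<in>UNIV. w $ j * g x (?T (axis i 1)) (?T (axis j 1))))"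
    by (intro sum.cong refl arg_cong2[where f = "(*)"] linear_real_expansion[OF lin])
  also have "\<dots> = metric_form c (chart_map c x) u w"
    unfolding metric_form_def metric_coord_def using c
    by (simp add: chart_inv_chart_map charts_at_iff sum_distrib_left mult_ac)
  finally show ?thesis .
qed

lemma metric_form_change:
  assumes "c \<in> charts_at \<A> x" "d \<in> charts_at \<A> x"
  shows "metric_form c (chart_map c x) u w
    = metric_form d (chart_map d x) (jac c d (chart_map c x) u) (jac c d (chart_map c x) w)"
  using assms by (simp flip: metric_tangent_of add: tangent_of_change)

lemma metric_form_sym:
  assumes "c \<in> charts_at \<A> x"
  shows "metric_form c (chart_map c x) u w = metric_form c (chart_map c x) w u"
  using riemannianD(2)[OF tangent_of_in_tangent_space tangent_of_in_tangent_space] assms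
  by (simp flip: metric_tangent_of)

lemma metric_form_pos:
  assumes "c \<in> charts_at \<A> x" "u \<noteq> 0"
  shows "metric_form c (chart_map c x) u u > 0"
proof -
  have "tangent_of \<A> c x u \<noteq> (\<lambda>_. 0)" using tangent_of_self[OF assms(1), of u] assms(2) by auto
  then show ?thesis
    using riemannianD(3)[OF tangent_of_in_tangent_space[OF assms(1)]] metric_tangent_of[OF assms(1)] by simp
qed

lemma metric_coord_analytic:
  "c \<in> \<A> \<Longrightarrow> real_analytic_on (metric_coord \<A> g c i j) (chart_map c ` chart_dom c)"
  using riemannian by (simp add: analytic_riemannian_metric_def)

lemma metric_form_matrix: "u \<bullet> (metric_matrix \<A> g c y *v w) = metric_form c y u w"
  by (simp add: metric_form_def metric_matrix_def matrix_vector_mult_def inner_vec_def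
      sum_distrib_left mult_ac)

lemma metric_matrix_invertible:
  assumes "c \<in> \<A>" "y \<in> chart_map c ` chart_dom c"
  shows "invertible (metric_matrix \<A> g c y)"
proof -
  from assms obtain x where x: "c \<in> charts_at \<A> x" and y: "y = chart_map c x" by (auto simp: charts_at_iff)
  have "u = 0" if "metric_matrix \<A> g c y *v u = 0" for u
    using metric_form_pos[OF x, of u] that metric_form_matrix[of u c y u] y by auto
  then show ?thesis
    unfolding invertible_left_inverse matrix_left_invertible_ker by blast
qed

end

section \<open>Covariance of the Euler--Lagrange equation\<close>

locale lagrangian_system = analytic_riemannian_manifold \<A> g
  for \<A> :: "('a::{t2_space, second_countable_topology}, 'n::finite) chart set"
    and g :: "('a, 'n) metric" +
  fixes U :: "'a \<Rightarrow> real" and \<mu> :: "('a, 'n) one_form" and A :: "'a set"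
  assumes open_A: "open A"
    and potential: "analytic_function_on \<A> U A"
    and magnetic: "analytic_one_form_on \<A> \<mu> A"
begin

definition domain :: "('a, 'n) chart \<Rightarrow> (real^'n) set" where
  "domain c = chart_map c ` (chart_dom c \<inter> A)"

lemma domain_open: "c \<in> \<A> \<Longrightarrow> open (domain c)"
  unfolding domain_def by (rule chart_image_open[OF _ open_A])

lemma domain_subset: "domain c \<subseteq> chart_map c ` chart_dom c"
  by (auto simp: domain_def)

lemma metric_coord_analytic_domain:
  "c \<in> \<A> \<Longrightarrow> real_analytic_on (metric_coord \<A> g c i j) (domain c)"
  by (rule real_analytic_on_subset[OF metric_coord_analytic domain_subset])

lemma fun_coord_analytic: "c \<in> \<A> \<Longrightarrow> real_analytic_on (fun_coord U c) (domain c)"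
  using potential by (simp add: analytic_function_on_def domain_def)

lemma form_coord_analytic: "c \<in> \<A> \<Longrightarrow> real_analytic_on (form_coord \<A> \<mu> c i) (domain c)"
  using magnetic by (simp add: analytic_one_form_on_def domain_def)

definition form_eval :: "('a, 'n) chart \<Rightarrow> real^'n \<Rightarrow> real^'n \<Rightarrow> real" where
  "form_eval c y u = (\<Sum>i\<in>UNIV. form_coord \<A> \<mu> c i y * u $ i)"

lemma form_tangent_of:
  assumes c: "c \<in> charts_at \<A> x" and "x \<in> A"
  shows "\<mu> x (tangent_of \<A> c x u) = form_eval c (chart_map c x) u"
proof -
  have "linear (\<lambda>u. \<mu> x (tangent_of \<A> c x u))"
    using magnetic \<open>x \<in> A\<close> by (intro linear_on_tangent_of[OF c]) (simp add: analytic_one_form_on_def)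
  then have "\<mu> x (tangent_of \<A> c x u) = (\<Sum>i\<in>UNIV. u $ i * \<mu> x (tangent_of \<A> c x (axis i 1)))"
    by (rule linear_real_expansion)
  then show ?thesis using c
    by (simp add: form_eval_def form_coord_def chart_inv_chart_map charts_at_iff mult.commute)
qed

lemma form_eval_change:
  assumes "c \<in> charts_at \<A> x" "d \<in> charts_at \<A> x" "x \<in> A"
  shows "form_eval c (chart_map c x) u = form_eval d (chart_map d x) (jac c d (chart_map c x) u)"
  using assms by (simp flip: form_tangent_of add: tangent_of_change)

text \<open>The derivative of \<open>metric_form c y u w\<close> in \<open>y\<close> along
  \<open>k\<close>, with the coordinates \<open>u\<close> and \<open>w\<close> frozen;
  \<open>form_deriv\<close> is the analogue for the one-form. Neither is tensorial by
  itself.\<close>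

definition metric_deriv :: "('a, 'n) chart \<Rightarrow> real^'n \<Rightarrow> real^'n \<Rightarrow> real^'n \<Rightarrow> real^'n \<Rightarrow> real" where
  "metric_deriv c y k u w =
     (\<Sum>i\<in>UNIV. \<Sum>j\<in>UNIV. dir_deriv (metric_coord \<A> g c i j) y k * u $ i * w $ j)"

definition form_deriv :: "('a, 'n) chart \<Rightarrow> real^'n \<Rightarrow> real^'n \<Rightarrow> real^'n \<Rightarrow> real" where
  "form_deriv c y k u = (\<Sum>i\<in>UNIV. dir_deriv (form_coord \<A> \<mu> c i) y k * u $ i)"

lemma metric_form_has_derivative:
  assumes "c \<in> \<A>" "Y t \<in> domain c"
    and Y: "(Y has_derivative Y') (at t within S)"
    and V: "(V has_derivative V') (at t within S)" and W: "(W has_derivative W') (at t within S)"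
  shows "((\<lambda>s. metric_form c (Y s) (V s) (W s)) has_derivative
    (\<lambda>h. metric_deriv c (Y t) (Y' h) (V t) (W t)
        + metric_form c (Y t) (V' h) (W t) + metric_form c (Y t) (V t) (W' h))) (at t within S)"
proof -
  have G: "((\<lambda>s. metric_coord \<A> g c i j (Y s)) has_derivative
      (\<lambda>h. dir_deriv (metric_coord \<A> g c i j) (Y t) (Y' h))) (at t within S)" for i j
    using has_derivative_compose[OF Y real_analytic_on_has_dir_deriv[OF
        metric_coord_analytic_domain[OF assms(1)] assms(2)]] .
  have V: "((\<lambda>s. V s $ i) has_derivative (\<lambda>h. V' h $ i)) (at t within S)"
    and W: "((\<lambda>s. W s $ i) has_derivative (\<lambda>h. W' h $ i)) (at t within S)" for i
    using V W by (simp_all add: has_derivative_cart_iff)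
  show ?thesis
    unfolding metric_form_def
    by (rule has_derivative_eq_rhs[OF has_derivative_sum[OF has_derivative_sum[OF
            has_derivative_mult[OF has_derivative_mult[OF G V] W]]]])
       (simp add: metric_deriv_def fun_eq_iff algebra_simps flip: sum.distrib)
qed

lemma form_eval_has_derivative:
  assumes "c \<in> \<A>" "Y t \<in> domain c"
    and Y: "(Y has_derivative Y') (at t within S)" and V: "(V has_derivative V') (at t within S)"
  shows "((\<lambda>s. form_eval c (Y s) (V s)) has_derivative
    (\<lambda>h. form_deriv c (Y t) (Y' h) (V t) + form_eval c (Y t) (V' h))) (at t within S)"
proof -
  have M: "((\<lambda>s. form_coord \<A> \<mu> c i (Y s)) has_derivative
      (\<lambda>h. dir_deriv (form_coord \<A> \<mu> c i) (Y t) (Y' h))) (at t within S)" for i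
    using has_derivative_compose[OF Y real_analytic_on_has_dir_deriv[OF
        form_coord_analytic[OF assms(1)] assms(2)]] .
  have V: "((\<lambda>s. V s $ i) has_derivative (\<lambda>h. V' h $ i)) (at t within S)" for i
    using V by (simp add: has_derivative_cart_iff)
  show ?thesis
    unfolding form_eval_def
    by (rule has_derivative_eq_rhs[OF has_derivative_sum[OF has_derivative_mult[OF M V]]])
       (simp add: form_deriv_def fun_eq_iff algebra_simps flip: sum.distrib)
qed

lemma fun_coord_has_derivative:
  assumes "c \<in> \<A>" "Y t \<in> domain c" and Y: "(Y has_derivative Y') (at t within S)"
  shows "((\<lambda>s. fun_coord U c (Y s)) has_derivative (\<lambda>h. dir_deriv (fun_coord U c) (Y t) (Y' h)))
    (at t within S)"
  using has_derivative_compose[OF Y real_analytic_on_has_dir_deriv[OF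
        fun_coord_analytic[OF assms(1)] assms(2)]] .

text \<open>The Euler--Lagrange covector, paired with the vector \<open>e\<close>; \<open>w\<close> is the coordinate
  acceleration. Unlike the Christoffel symbols it transforms tensorially.\<close>

definition el_form :: "('a, 'n) chart \<Rightarrow> real^'n \<Rightarrow> real^'n \<Rightarrow> real^'n \<Rightarrow> real^'n \<Rightarrow> real" where
  "el_form c y v w e =
     metric_form c y w e + metric_deriv c y v v e - metric_deriv c y e v v / 2
     + dir_deriv (fun_coord U c) y e + (form_deriv c y v e - form_deriv c y e v)"

lemma metric_form_add:
  "metric_form c y (u + u') w = metric_form c y u w + metric_form c y u' w"
  by (simp add: metric_form_def algebra_simps sum.distrib)

context
  fixes c d x
  assumes c: "c \<in> charts_at \<A> x" and d: "d \<in> charts_at \<A> x" and x: "x \<in> A"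
begin

abbreviation (input) "yc \<equiv> chart_map c x"
abbreviation (input) "yd \<equiv> chart_map d x"

lemma change_facts:
  shows "c \<in> \<A>" "d \<in> \<A>" "yc \<in> domain c" "yd \<in> domain d" "yc \<in> overlap c d"
    "transition c d yc = yd"
    "open (overlap c d \<inter> domain c)"
    "(transition c d has_derivative jac c d yc) (at yc)"
  using c d x
  by (auto simp: charts_at_iff domain_def in_overlap transition_chart_map
      intro!: open_Int overlap_open transition_has_derivative domain_open[unfolded domain_def])

lemma change_points:
  assumes "z \<in> overlap c d \<inter> domain c"
  obtains x' where "z = chart_map c x'" "c \<in> charts_at \<A> x'" "d \<in> charts_at \<A> x'" "x' \<in> A"
    "transition c d z = chart_map d x'"
proof -
  from assms obtain x1 where x1: "z = chart_map c x1" "x1 \<in> chart_dom c" "x1 \<in> chart_dom d"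
    by (auto simp: overlap_def)
  from assms obtain x2 where x2: "z = chart_map c x2" "x2 \<in> chart_dom c" "x2 \<in> A"
    by (auto simp: domain_def)
  have "x1 = x2" using x1 x2 chart_inv_chart_map[OF change_facts(1)] by metis
  then show ?thesis
    using that[of x1] x1 x2 change_facts(1,2) by (simp add: charts_at_iff transition_chart_map)
qed

text \<open>Obtained by differentiating \<open>metric_form_change\<close> with respect to the base
  point, as an identity on an open set of coordinates. The two \<open>hess\<close> terms arise
  because the transformed vectors \<open>jac c d z u\<close> and \<open>jac c d z w\<close> vary
  with that point.\<close>

lemma metric_deriv_change:
  "metric_deriv c yc k u w = metric_deriv d yd (jac c d yc k) (jac c d yc u) (jac c d yc w)
     + metric_form d yd (hess c d yc k u) (jac c d yc w)
     + metric_form d yd (jac c d yc u) (hess c d yc k w)"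
proof -
  note cf = change_facts
  have J: "((\<lambda>z. jac c d z u) has_derivative (\<lambda>h. hess c d yc h u + jac c d yc 0)) (at yc)" for u
    by (rule jac_has_derivative[OF cf(1,2,5) has_derivative_ident has_derivative_const])
  have "((\<lambda>z. metric_form c z u w) has_derivative (\<lambda>h. metric_deriv c yc h u w
      + metric_form c yc 0 w + metric_form c yc u 0)) (at yc)"
    by (rule metric_form_has_derivative[OF cf(1,3) has_derivative_ident has_derivative_const has_derivative_const])
  moreover have "((\<lambda>z. metric_form c z u w) has_derivative
      (\<lambda>h. metric_deriv d yd (jac c d yc h) (jac c d yc u) (jac c d yc w)
        + metric_form d yd (hess c d yc h u + jac c d yc 0) (jac c d yc w)
        + metric_form d yd (jac c d yc u) (hess c d yc h w + jac c d yc 0))) (at yc)"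
  proof (rule has_derivative_transform_within_open)
    show "((\<lambda>z. metric_form d (transition c d z) (jac c d z u) (jac c d z w)) has_derivative
      (\<lambda>h. metric_deriv d yd (jac c d yc h) (jac c d yc u) (jac c d yc w)
        + metric_form d yd (hess c d yc h u + jac c d yc 0) (jac c d yc w)
        + metric_form d yd (jac c d yc u) (hess c d yc h w + jac c d yc 0))) (at yc)"
      using metric_form_has_derivative[OF cf(2) _ cf(8) J J] cf(4,6) by simp
    show "open (overlap c d \<inter> domain c)" "yc \<in> overlap c d \<inter> domain c" using cf by auto
    fix z assume "z \<in> overlap c d \<inter> domain c"
    then obtain x' where x': "z = chart_map c x'" "c \<in> charts_at \<A> x'" "d \<in> charts_at \<A> x'" "x' \<in> A"
      "transition c d z = chart_map d x'" by (rule change_points)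
    show "metric_form d (transition c d z) (jac c d z u) (jac c d z w) = metric_form c z u w"
      unfolding x'(5) using metric_form_change[OF x'(2,3)] x'(1,4) by simp
  qed
  ultimately have "(\<lambda>h. metric_deriv c yc h u w + metric_form c yc 0 w + metric_form c yc u 0)
    = (\<lambda>h. metric_deriv d yd (jac c d yc h) (jac c d yc u) (jac c d yc w)
        + metric_form d yd (hess c d yc h u + jac c d yc 0) (jac c d yc w)
        + metric_form d yd (jac c d yc u) (hess c d yc h w + jac c d yc 0))"
    by (rule has_derivative_unique)
  from fun_cong[OF this, of k] show ?thesis
    by (simp add: linear_0[OF linear_jac]) (simp add: metric_form_def)
qed

lemma form_deriv_change:
  "form_deriv c yc k u = form_deriv d yd (jac c d yc k) (jac c d yc u) + form_eval d yd (hess c d yc k u)"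
proof -
  note cf = change_facts
  have J: "((\<lambda>z. jac c d z u) has_derivative (\<lambda>h. hess c d yc h u + jac c d yc 0)) (at yc)" for u
    by (rule jac_has_derivative[OF cf(1,2,5) has_derivative_ident has_derivative_const])
  have "((\<lambda>z. form_eval c z u) has_derivative (\<lambda>h. form_deriv c yc h u + form_eval c yc 0)) (at yc)"
    by (rule form_eval_has_derivative[OF cf(1,3) has_derivative_ident has_derivative_const])
  moreover have "((\<lambda>z. form_eval c z u) has_derivative
      (\<lambda>h. form_deriv d yd (jac c d yc h) (jac c d yc u)
        + form_eval d yd (hess c d yc h u + jac c d yc 0))) (at yc)"
  proof (rule has_derivative_transform_within_open)
    show "((\<lambda>z. form_eval d (transition c d z) (jac c d z u)) has_derivative
      (\<lambda>h. form_deriv d yd (jac c d yc h) (jac c d yc u)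
        + form_eval d yd (hess c d yc h u + jac c d yc 0))) (at yc)"
      using form_eval_has_derivative[OF cf(2) _ cf(8) J] cf(4,6) by simp
    show "open (overlap c d \<inter> domain c)" "yc \<in> overlap c d \<inter> domain c" using cf by auto
    fix z assume "z \<in> overlap c d \<inter> domain c"
    then obtain x' where x': "z = chart_map c x'" "c \<in> charts_at \<A> x'" "d \<in> charts_at \<A> x'" "x' \<in> A"
      "transition c d z = chart_map d x'" by (rule change_points)
    show "form_eval d (transition c d z) (jac c d z u) = form_eval c z u"
      unfolding x'(5) using form_eval_change[OF x'(2,3)] x'(1,4) by simp
  qed
  ultimately have "(\<lambda>h. form_deriv c yc h u + form_eval c yc 0)
    = (\<lambda>h. form_deriv d yd (jac c d yc h) (jac c d yc u)
        + form_eval d yd (hess c d yc h u + jac c d yc 0))"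
    by (rule has_derivative_unique)
  from fun_cong[OF this, of k] show ?thesis
    by (simp add: linear_0[OF linear_jac]) (simp add: form_eval_def)
qed

lemma potential_deriv_change:
  "dir_deriv (fun_coord U c) yc k = dir_deriv (fun_coord U d) yd (jac c d yc k)"
proof -
  note cf = change_facts
  have "((\<lambda>z. fun_coord U d (transition c d z)) has_derivative
      (\<lambda>h. dir_deriv (fun_coord U d) (transition c d yc) (jac c d yc h))) (at yc)"
    using cf by (intro fun_coord_has_derivative) auto
  then have "(fun_coord U c has_derivative
      (\<lambda>h. dir_deriv (fun_coord U d) (transition c d yc) (jac c d yc h))) (at yc)"
  proof (rule has_derivative_transform_within_open)
    show "open (overlap c d \<inter> domain c)" "yc \<in> overlap c d \<inter> domain c" using cf by auto
    fix z assume "z \<in> overlap c d \<inter> domain c"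
    then show "fun_coord U d (transition c d z) = fun_coord U c z"
      by (rule change_points) (simp add: fun_coord_def chart_inv_chart_map charts_at_iff)
  qed
  from fun_cong[OF dir_deriv_unique[OF this], of k] cf show ?thesis by simp
qed

text \<open>Of the second derivatives of the transition, \<open>hess v v\<close> is absorbed into
  the transformed acceleration. The terms with \<open>hess v e\<close> cancel: in the metric part
  because \<open>metric_deriv c y e v v / 2\<close> produces two equal halves, in the magnetic part
  by antisymmetry and \<open>hess_commute\<close>.\<close>

lemma el_form_change:
  "el_form c yc v w e = el_form d yd (jac c d yc v) (jac c d yc w + hess c d yc v v) (jac c d yc e)"
proof -
  note h = hess_commute[OF change_facts(1,2,5), of e v]
  show ?thesis
    unfolding el_form_def metric_deriv_change form_deriv_change potential_deriv_change h
      metric_form_change[OF c d] metric_form_add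
      metric_form_sym[OF d, of "hess c d yc v e"]
    by (simp add: field_simps)
qed

end

text \<open>Multiplication by the invertible metric matrix removes the Riesz duality and lowers the
  index of the Christoffel term; pairing with all \<open>e\<close> then expresses the vector
  equation through the tensorial \<open>el_form\<close>.\<close>

lemma el_equation_iff:
  assumes "c \<in> \<A>" "y \<in> domain c"
  shows "covariant_deriv_coord \<A> g c y v v w =
      - grad_coord \<A> g U c y - riesz_coord \<A> g c y (contract_d_coord \<A> \<mu> c y v)
    \<longleftrightarrow> (\<forall>e. el_form c y v w e = 0)"
proof -
  define G where "G = metric_matrix \<A> g c y"
  \<comment> \<open>The Christoffel symbols of the first kind, contracted twice with
    \<open>v\<close>.\<close>
  define q :: "real^'n" where "q = (\<chi> m. (\<Sum>i\<in>UNIV. \<Sum>j\<in>UNIV.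
     (partial_deriv i (metric_coord \<A> g c j m) y + partial_deriv j (metric_coord \<A> g c i m) y
       - partial_deriv m (metric_coord \<A> g c i j) y) * v $ i * v $ j) / 2)"
  define DU :: "real^'n" where "DU = (\<chi> i. partial_deriv i (fun_coord U c) y)"
  define r where "r = contract_d_coord \<A> \<mu> c y v"
  have inv: "G ** matrix_inv G = mat 1" "matrix_inv G ** G = mat 1"
  proof -
    have "\<exists>B. G ** B = mat 1 \<and> B ** G = mat 1"
      using metric_matrix_invertible[OF assms(1)] assms(2) domain_subset
      unfolding G_def invertible_def by blast
    then show "G ** matrix_inv G = mat 1" "matrix_inv G ** G = mat 1"
      unfolding matrix_inv_def by (rule someI2_ex, simp)+
  qed
  have "covariant_deriv_coord \<A> g c y v v w = w + matrix_inv G *v q"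
  proof -
    have "(\<Sum>i\<in>UNIV. \<Sum>j\<in>UNIV. christoffel \<A> g c k i j y * v $ i * v $ j)
        = (\<Sum>m\<in>UNIV. matrix_inv G $ k $ m * q $ m)" for k
    proof -
      have "(\<Sum>m\<in>UNIV. matrix_inv G $ k $ m * q $ m)
          = (\<Sum>m\<in>UNIV. \<Sum>i\<in>UNIV. \<Sum>j\<in>UNIV. matrix_inv G $ k $ m *
           (partial_deriv i (metric_coord \<A> g c j m) y + partial_deriv j (metric_coord \<A> g c i m) y
             - partial_deriv m (metric_coord \<A> g c i j) y) / 2 * v $ i * v $ j)"
        by (simp add: q_def sum_distrib_left sum_divide_distrib mult.assoc)
      also have "\<dots> = (\<Sum>i\<in>UNIV. \<Sum>j\<in>UNIV. \<Sum>m\<in>UNIV. matrix_inv G $ k $ m *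
           (partial_deriv i (metric_coord \<A> g c j m) y + partial_deriv j (metric_coord \<A> g c i m) y
             - partial_deriv m (metric_coord \<A> g c i j) y) / 2 * v $ i * v $ j)"
        by (subst sum.swap) (intro sum.cong refl sum.swap)
      also have "\<dots> = (\<Sum>i\<in>UNIV. \<Sum>j\<in>UNIV. christoffel \<A> g c k i j y * v $ i * v $ j)"
        by (simp add: christoffel_def G_def sum_distrib_right sum_divide_distrib)
      finally show ?thesis ..
    qed
    then show ?thesis
      by (simp add: covariant_deriv_coord_def vec_eq_iff matrix_vector_mult_def)
  qed
  then have "covariant_deriv_coord \<A> g c y v v w =
      - grad_coord \<A> g U c y - riesz_coord \<A> g c y (contract_d_coord \<A> \<mu> c y v)
    \<longleftrightarrow> w + matrix_inv G *v (q + DU + r) = 0"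
  proof -
    have eq: "a + b = - x - z \<longleftrightarrow> a + (b + x + z) = 0" for a b x z :: "real^'n"
    proof -
      have "a + (b + x + z) = (a + b) - (- x - z)" by simp
      then show ?thesis by (simp only: right_minus_eq)
    qed
    assume "covariant_deriv_coord \<A> g c y v v w = w + matrix_inv G *v q"
    then show ?thesis
      unfolding grad_coord_def riesz_coord_def G_def[symmetric] DU_def[symmetric] r_def[symmetric]
      by (simp only: eq matrix_vector_right_distrib)
  qed
  also have "\<dots> \<longleftrightarrow> G *v w + (q + DU + r) = 0"
  proof
    assume "w + matrix_inv G *v (q + DU + r) = 0"
    then have "G *v (w + matrix_inv G *v (q + DU + r)) = 0" by simp
    then show "G *v w + (q + DU + r) = 0"
      by (simp add: matrix_vector_right_distrib[of G w] matrix_vector_mul_assoc inv)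
  next
    assume "G *v w + (q + DU + r) = 0"
    then have "matrix_inv G *v (G *v w + (q + DU + r)) = 0" by simp
    then show "w + matrix_inv G *v (q + DU + r) = 0"
      by (simp add: matrix_vector_right_distrib[of _ "G *v w"] matrix_vector_mul_assoc inv)
  qed
  also have "\<dots> \<longleftrightarrow> (\<forall>e. e \<bullet> (G *v w + (q + DU + r)) = 0)"
    by (metis inner_eq_zero_iff inner_zero_right)
  also have "\<dots> \<longleftrightarrow> (\<forall>e. el_form c y v w e = 0)"
  proof -
    have "e \<bullet> (G *v w + (q + DU + r)) = el_form c y v w e" for e
    proof -
      let ?d = "\<lambda>m i j. partial_deriv m (metric_coord \<A> g c i j) y"
      have 1: "e \<bullet> (G *v w) = metric_form c y w e"
      proof -
        from assms obtain x where "c \<in> charts_at \<A> x" "y = chart_map c x"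
          by (auto simp: charts_at_iff domain_def)
        then show ?thesis
          unfolding G_def metric_form_matrix using metric_form_sym by simp
      qed
      \<comment> \<open>The first two Christoffel terms coincide after exchanging \<open>i\<close>
        and \<open>j\<close>, so together with the overall factor one half they give a full
        \<open>metric_deriv c y v v e\<close>; the third keeps the one half.\<close>
      have 2: "e \<bullet> q = metric_deriv c y v v e - metric_deriv c y e v v / 2"
      proof -
        have a: "(\<Sum>m\<in>UNIV. \<Sum>i\<in>UNIV. \<Sum>j\<in>UNIV. e $ m * ?d i j m * v $ i * v $ j) = metric_deriv c y v v e"
        proof -
          have "metric_deriv c y v v e = (\<Sum>j\<in>UNIV. \<Sum>m\<in>UNIV. \<Sum>i\<in>UNIV. e $ m * ?d i j m * v $ i * v $ j)"
            by (simp add: metric_deriv_def dir_deriv_def sum_distrib_left sum_distrib_right mult_ac)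
          also have "\<dots> = (\<Sum>m\<in>UNIV. \<Sum>j\<in>UNIV. \<Sum>i\<in>UNIV. e $ m * ?d i j m * v $ i * v $ j)"
            by (rule sum.swap)
          also have "\<dots> = (\<Sum>m\<in>UNIV. \<Sum>i\<in>UNIV. \<Sum>j\<in>UNIV. e $ m * ?d i j m * v $ i * v $ j)"
            by (intro sum.cong refl sum.swap)
          finally show ?thesis ..
        qed
        have b: "(\<Sum>m\<in>UNIV. \<Sum>i\<in>UNIV. \<Sum>j\<in>UNIV. e $ m * ?d j i m * v $ i * v $ j) = metric_deriv c y v v e"
          unfolding a[symmetric]
          by (rule sum.cong[OF refl], subst sum.swap) (simp add: mult_ac)
        have c: "(\<Sum>m\<in>UNIV. \<Sum>i\<in>UNIV. \<Sum>j\<in>UNIV. e $ m * ?d m i j * v $ i * v $ j) = metric_deriv c y e v v"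
        proof -
          have "metric_deriv c y e v v = (\<Sum>i\<in>UNIV. \<Sum>j\<in>UNIV. \<Sum>m\<in>UNIV. e $ m * ?d m i j * v $ i * v $ j)"
            by (simp add: metric_deriv_def dir_deriv_def sum_distrib_left sum_distrib_right mult_ac)
          also have "\<dots> = (\<Sum>i\<in>UNIV. \<Sum>m\<in>UNIV. \<Sum>j\<in>UNIV. e $ m * ?d m i j * v $ i * v $ j)"
            by (intro sum.cong refl sum.swap)
          also have "\<dots> = (\<Sum>m\<in>UNIV. \<Sum>i\<in>UNIV. \<Sum>j\<in>UNIV. e $ m * ?d m i j * v $ i * v $ j)"
            by (rule sum.swap)
          finally show ?thesis ..
        qed
        have "e \<bullet> q = ((\<Sum>m\<in>UNIV. \<Sum>i\<in>UNIV. \<Sum>j\<in>UNIV. e $ m * ?d i j m * v $ i * v $ j)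
          + (\<Sum>m\<in>UNIV. \<Sum>i\<in>UNIV. \<Sum>j\<in>UNIV. e $ m * ?d j i m * v $ i * v $ j)
          - (\<Sum>m\<in>UNIV. \<Sum>i\<in>UNIV. \<Sum>j\<in>UNIV. e $ m * ?d m i j * v $ i * v $ j)) / 2"
          by (simp add: inner_vec_def q_def sum_distrib_left sum_divide_distrib[symmetric] algebra_simps
              flip: sum.distrib sum_subtractf)
        then show ?thesis unfolding a b c by simp
      qed
      have 3: "e \<bullet> DU = dir_deriv (fun_coord U c) y e"
        by (simp add: DU_def inner_vec_def dir_deriv_def)
      have 4: "e \<bullet> r = form_deriv c y v e - form_deriv c y e v"
      proof -
        let ?f = "\<lambda>j i. partial_deriv j (form_coord \<A> \<mu> c i) y"
        have "e \<bullet> r = (\<Sum>i\<in>UNIV. \<Sum>j\<in>UNIV. e $ i * v $ j * ?f j i) - (\<Sum>i\<in>UNIV. \<Sum>j\<in>UNIV. e $ i * v $ j * ?f i j)"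
          by (simp add: r_def contract_d_coord_def inner_vec_def sum_distrib_left algebra_simps
              flip: sum_subtractf)
        also have "(\<Sum>i\<in>UNIV. \<Sum>j\<in>UNIV. e $ i * v $ j * ?f i j) = form_deriv c y e v"
          by (subst sum.swap) (simp add: form_deriv_def dir_deriv_def sum_distrib_left sum_distrib_right mult_ac)
        also have "(\<Sum>i\<in>UNIV. \<Sum>j\<in>UNIV. e $ i * v $ j * ?f j i) = form_deriv c y v e"
          by (simp add: form_deriv_def dir_deriv_def sum_distrib_left sum_distrib_right mult_ac)
        finally show ?thesis .
      qed
      show ?thesis by (simp add: inner_add_right 1 2 3 4 el_form_def)
    qed
    then show ?thesis by simp
  qed
  finally show ?thesis .
qed

end

section \<open>The flow in a chart\<close>

text \<open>The constant is left implicit, so that on compact sets the property is closed under all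
  arithmetic operations that make up the acceleration.\<close>

definition lip_on :: "'b::metric_space set \<Rightarrow> ('b \<Rightarrow> real) \<Rightarrow> bool" where
  "lip_on K f \<longleftrightarrow> (\<exists>L. L-lipschitz_on K f)"

lemma lip_on_const: "lip_on K (\<lambda>_. c)"
  unfolding lip_on_def using lipschitz_on_constant by blast

lemma lip_on_add: "lip_on K f \<Longrightarrow> lip_on K h \<Longrightarrow> lip_on K (\<lambda>x. f x + h x)"
  unfolding lip_on_def using lipschitz_on_add by blast

lemma lip_on_minus: "lip_on K f \<Longrightarrow> lip_on K (\<lambda>x. - f x)"
  unfolding lip_on_def using lipschitz_on_minus by blast

lemma lip_on_diff: "lip_on K f \<Longrightarrow> lip_on K h \<Longrightarrow> lip_on K (\<lambda>x. f x - h x)"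
  unfolding lip_on_def using lipschitz_on_diff by blast

lemma lip_on_sum: "(\<And>i. i \<in> I \<Longrightarrow> lip_on K (f i)) \<Longrightarrow> lip_on K (\<lambda>x. \<Sum>i\<in>I. f i x)"
  by (induction I rule: infinite_finite_induct) (auto intro: lip_on_const lip_on_add)

lemma lip_on_continuous: "lip_on K f \<Longrightarrow> continuous_on K f"
  unfolding lip_on_def using lipschitz_on_continuous_on by blast

lemma lip_on_bounded:
  assumes "compact K" "lip_on K f"
  obtains B where "B \<ge> 0" "\<And>x. x \<in> K \<Longrightarrow> \<bar>f x\<bar> \<le> B"
proof -
  have "bounded (f ` K)"
    using assms by (intro compact_imp_bounded compact_continuous_image lip_on_continuous)
  then obtain B where "\<And>x. x \<in> K \<Longrightarrow> \<bar>f x\<bar> \<le> B" unfolding bounded_iff by auto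
  then show ?thesis using that[of "\<bar>B\<bar>"] by force
qed

lemma lip_on_mult:
  assumes K: "compact K" and f: "lip_on K f" and h: "lip_on K h"
  shows "lip_on K (\<lambda>x. f x * h x)"
proof -
  obtain A where A: "A \<ge> 0" "\<And>x. x \<in> K \<Longrightarrow> \<bar>f x\<bar> \<le> A" using lip_on_bounded[OF K f] by metis
  obtain B where B: "B \<ge> 0" "\<And>x. x \<in> K \<Longrightarrow> \<bar>h x\<bar> \<le> B" using lip_on_bounded[OF K h] by metis
  obtain L M where L: "L-lipschitz_on K f" and M: "M-lipschitz_on K h"
    using f h by (auto simp: lip_on_def)
  have "(A * M + L * B)-lipschitz_on K (\<lambda>x. f x * h x)"
  proof (rule lipschitz_onI)
    fix x y assume xy: "x \<in> K" "y \<in> K"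
    have "dist (f x * h x) (f y * h y) = \<bar>f x * (h x - h y) + (f x - f y) * h y\<bar>"
      by (simp add: dist_real_def algebra_simps)
    also have "\<dots> \<le> \<bar>f x\<bar> * \<bar>h x - h y\<bar> + \<bar>f x - f y\<bar> * \<bar>h y\<bar>"
      by (metis abs_mult abs_triangle_ineq)
    also have "\<dots> \<le> A * (M * dist x y) + (L * dist x y) * B"
      using lipschitz_onD[OF L xy] lipschitz_onD[OF M xy] A B xy
      by (intro add_mono mult_mono) (auto simp: dist_real_def intro: order_trans[OF abs_ge_zero])
    finally show "dist (f x * h x) (f y * h y) \<le> (A * M + L * B) * dist x y"
      by (simp add: algebra_simps)
  qed (use A B lipschitz_on_nonneg[OF L] lipschitz_on_nonneg[OF M] in simp)
  then show ?thesis by (auto simp: lip_on_def)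
qed

lemma lip_on_prod:
  "compact K \<Longrightarrow> (\<And>i. i \<in> I \<Longrightarrow> lip_on K (f i)) \<Longrightarrow> lip_on K (\<lambda>x. \<Prod>i\<in>I. f i x)"
  by (induction I rule: infinite_finite_induct) (auto intro: lip_on_const lip_on_mult)

lemma lip_on_inverse:
  assumes K: "compact K" and f: "lip_on K f" and nz: "\<And>x. x \<in> K \<Longrightarrow> f x \<noteq> 0"
  shows "lip_on K (\<lambda>x. inverse (f x))"
proof -
  have "continuous_on K (\<lambda>x. inverse (f x))"
    using lip_on_continuous[OF f] nz by (intro continuous_on_inverse) auto
  then have "bounded ((\<lambda>x. inverse (f x)) ` K)"
    using K by (intro compact_imp_bounded compact_continuous_image)
  then obtain B where B: "B > 0" "\<And>x. x \<in> K \<Longrightarrow> \<bar>inverse (f x)\<bar> \<le> B"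
    unfolding bounded_pos by auto
  obtain L where L: "L-lipschitz_on K f" using f by (auto simp: lip_on_def)
  have "(B * L * B)-lipschitz_on K (\<lambda>x. inverse (f x))"
  proof (rule lipschitz_onI)
    fix x y assume xy: "x \<in> K" "y \<in> K"
    have "dist (inverse (f x)) (inverse (f y)) = \<bar>inverse (f x)\<bar> * \<bar>f x - f y\<bar> * \<bar>inverse (f y)\<bar>"
      using nz xy by (simp add: dist_real_def inverse_diff_inverse abs_mult)
    also have "\<dots> \<le> B * (L * dist x y) * B"
      using lipschitz_onD[OF L xy] B xy lipschitz_on_nonneg[OF L]
      by (intro mult_mono) (auto simp: dist_real_def less_imp_le)
    finally show "dist (inverse (f x)) (inverse (f y)) \<le> (B * L * B) * dist x y"
      by (simp add: algebra_simps)
  qed (use B lipschitz_on_nonneg[OF L] in simp)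
  then show ?thesis by (auto simp: lip_on_def)
qed

lemma lip_on_divide:
  "compact K \<Longrightarrow> lip_on K f \<Longrightarrow> lip_on K h \<Longrightarrow> (\<And>x. x \<in> K \<Longrightarrow> h x \<noteq> 0) \<Longrightarrow> lip_on K (\<lambda>x. f x / h x)"
  unfolding divide_inverse by (intro lip_on_mult lip_on_inverse)

lemma lip_on_cong: "(\<And>x. x \<in> K \<Longrightarrow> f x = h x) \<Longrightarrow> lip_on K f \<longleftrightarrow> lip_on K h"
  unfolding lip_on_def lipschitz_on_def by auto

lemma lip_on_det:
  assumes K: "compact K" and "\<And>i j. lip_on K (\<lambda>x. M x $ i $ j)"
  shows "lip_on K (\<lambda>x. det (M x :: real^'n^'n))"
  unfolding det_def
  by (intro lip_on_sum lip_on_mult[OF K] lip_on_prod[OF K] lip_on_const assms(2))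

text \<open>By Cramer's rule an entry of the inverse is a quotient of determinants: the numerator
  has column \<open>k\<close> replaced by the unit vector \<open>axis m 1\<close>, and the
  denominator has no zero on \<open>K\<close>.\<close>

lemma lip_on_matrix_inv:
  fixes M :: "'b::metric_space \<Rightarrow> real^'n^'n"
  assumes K: "compact K" and M: "\<And>i j. lip_on K (\<lambda>x. M x $ i $ j)"
    and inv: "\<And>x. x \<in> K \<Longrightarrow> invertible (M x)"
  shows "lip_on K (\<lambda>x. matrix_inv (M x) $ k $ m)"
proof -
  let ?N = "\<lambda>x. (\<chi> i j. if j = k then axis m 1 $ i else M x $ i $ j) :: real^'n^'n"
  have "matrix_inv (M x) $ k $ m = det (?N x) / det (M x)" if "x \<in> K" for x
  proof -
    have "\<exists>B. M x ** B = mat 1 \<and> B ** M x = mat 1" using inv[OF that] by (simp add: invertible_def)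
    then have "M x ** matrix_inv (M x) = mat 1" unfolding matrix_inv_def by (rule someI2_ex) simp
    then have "M x *v (matrix_inv (M x) *v axis m 1) = axis m 1"
      by (simp add: matrix_vector_mul_assoc)
    moreover have "det (M x) \<noteq> 0" using inv[OF that] by (simp add: invertible_det_nz)
    ultimately have "matrix_inv (M x) *v axis m 1 =
        (\<chi> k. det (\<chi> i j. if j = k then axis m 1 $ i else M x $ i $ j) / det (M x))"
      using cramer by blast
    then have "(matrix_inv (M x) *v axis m 1) $ k = det (?N x) / det (M x)" by simp
    then show ?thesis by (simp add: matrix_vector_mult_basis column_def)
  qed
  moreover have "lip_on K (\<lambda>x. det (?N x) / det (M x))"
  proof (intro lip_on_divide[OF K] lip_on_det[OF K] M)
    show "lip_on K (\<lambda>x. ?N x $ i $ j)" for i j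
      by (cases "j = k") (auto intro: lip_on_const M)
    show "det (M x) \<noteq> 0" if "x \<in> K" for x using inv[OF that] by (simp add: invertible_det_nz)
  qed
  ultimately show ?thesis by (simp cong: lip_on_cong)
qed

text \<open>Partial derivatives are continuous, hence bounded on the compact \<open>K1\<close>, and
  convexity allows the mean value estimate. The product with \<open>K2\<close> appears because the
  coefficients are read as functions of position and velocity.\<close>

lemma lip_on_analytic:
  assumes F: "real_analytic_on F D" and "compact K1" "convex K1" "K1 \<subseteq> D"
  shows "lip_on (K1 \<times> K2) (\<lambda>z. F (fst z))"
proof -
  have "bounded (partial_deriv i F ` K1)" for i
    using assms by (intro compact_imp_bounded compact_continuous_image
        continuous_on_subset[OF real_analytic_on_continuous[OF real_analytic_on_partial_deriv]]) auto
  then have "\<exists>B. \<forall>y\<in>K1. \<bar>partial_deriv i F y\<bar> \<le> B" for i unfolding bounded_iff by auto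
  then obtain B where B: "\<And>i y. y \<in> K1 \<Longrightarrow> \<bar>partial_deriv i F y\<bar> \<le> B i" by metis
  have "(\<Sum>i\<in>UNIV. \<bar>B i\<bar>)-lipschitz_on K1 F"
  proof (rule bounded_derivative_imp_lipschitz)
    show "(F has_derivative dir_deriv F y) (at y within K1)" if "y \<in> K1" for y
      using real_analytic_on_has_dir_deriv[OF F] that \<open>K1 \<subseteq> D\<close> by (blast intro: has_derivative_at_withinI)
    show "onorm (dir_deriv F y) \<le> (\<Sum>i\<in>UNIV. \<bar>B i\<bar>)" if "y \<in> K1" for y
    proof (rule onorm_le)
      fix k
      have "norm (dir_deriv F y k) \<le> (\<Sum>i\<in>UNIV. \<bar>k $ i\<bar> * \<bar>partial_deriv i F y\<bar>)"
        unfolding dir_deriv_def real_norm_def by (rule order_trans[OF sum_abs]) (simp add: abs_mult)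
      also have "\<dots> \<le> (\<Sum>i\<in>UNIV. norm k * \<bar>B i\<bar>)"
        by (intro sum_mono mult_mono component_le_norm_cart order_trans[OF B[OF that] abs_ge_self]) auto
      finally show "norm (dir_deriv F y k) \<le> (\<Sum>i\<in>UNIV. \<bar>B i\<bar>) * norm k"
        by (simp add: sum_distrib_left mult.commute)
    qed
  qed (use assms in \<open>auto intro: sum_nonneg\<close>)
  moreover have "1-lipschitz_on (K1 \<times> K2) fst"
    by (rule lipschitz_onI) (auto simp: dist_fst_le)
  ultimately have "((\<Sum>i\<in>UNIV. \<bar>B i\<bar>) * 1)-lipschitz_on (K1 \<times> K2) (\<lambda>z. F (fst z))"
    by (intro lipschitz_on_compose2) (auto elim: lipschitz_on_subset)
  then show ?thesis by (auto simp: lip_on_def)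
qed

lemma lip_on_velocity: "lip_on K (\<lambda>z :: (real^'n) \<times> (real^'n). snd z $ i)"
proof -
  have "1-lipschitz_on K (\<lambda>z :: (real^'n) \<times> (real^'n). snd z $ i)"
  proof (rule lipschitz_onI)
    fix x y :: "(real^'n) \<times> (real^'n)"
    have "dist (snd x $ i) (snd y $ i) \<le> dist (snd x) (snd y)"
      using component_le_norm_cart[of "snd x - snd y" i] by (simp add: dist_norm)
    also have "\<dots> \<le> dist x y" by (rule dist_snd_le)
    finally show "dist (snd x $ i) (snd y $ i) \<le> 1 * dist x y" by simp
  qed simp
  then show ?thesis by (auto simp: lip_on_def)
qed

lemma lipschitz_on_cart:
  fixes h :: "'b::metric_space \<Rightarrow> real^'n::finite"
  assumes "\<And>i. lip_on K (\<lambda>x. h x $ i)"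
  shows "\<exists>L. L-lipschitz_on K h"
proof -
  from assms obtain L where L: "\<And>i. (L i)-lipschitz_on K (\<lambda>x. h x $ i)" unfolding lip_on_def by metis
  have "(\<Sum>i\<in>UNIV. L i)-lipschitz_on K h"
  proof (rule lipschitz_onI)
    fix x y assume xy: "x \<in> K" "y \<in> K"
    have "dist (h x) (h y) \<le> (\<Sum>i\<in>UNIV. \<bar>(h x - h y) $ i\<bar>)"
      unfolding dist_norm by (rule norm_le_l1_cart)
    also have "\<dots> \<le> (\<Sum>i\<in>UNIV. L i * dist x y)"
      using lipschitz_onD[OF L xy] by (intro sum_mono) (simp add: dist_real_def)
    finally show "dist (h x) (h y) \<le> (\<Sum>i\<in>UNIV. L i) * dist x y" by (simp add: sum_distrib_right)
  qed (auto intro: sum_nonneg lipschitz_on_nonneg[OF L])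
  then show ?thesis ..
qed

lemma has_derivative_imp_has_vector_derivative:
  assumes "(f has_derivative F') (at t within S)"
  shows "(f has_vector_derivative F' 1) (at t within S)"
proof -
  have "F' h = h *\<^sub>R F' 1" for h
    using linear_scale[OF has_derivative_linear[OF assms], of h 1] by simp
  then have "F' = (\<lambda>h. h *\<^sub>R F' 1)" by (rule ext)
  with assms show ?thesis unfolding has_vector_derivative_def by metis
qed

section \<open>Solutions in a chart, conservation of energy and the virial identity\<close>

context lagrangian_system
begin

text \<open>The equation solved for the acceleration \<open>w\<close>:
  \<open>covariant_deriv_coord\<close> is \<open>w\<close> plus a term free of \<open>w\<close>, and
  this term is its value at \<open>w = 0\<close>.\<close>

definition accel :: "('a, 'n) chart \<Rightarrow> real^'n \<Rightarrow> real^'n \<Rightarrow> real^'n" where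
  "accel c y v = - grad_coord \<A> g U c y - riesz_coord \<A> g c y (contract_d_coord \<A> \<mu> c y v)
     - covariant_deriv_coord \<A> g c y v v 0"

lemma el_form_accel: "c \<in> \<A> \<Longrightarrow> y \<in> domain c \<Longrightarrow> el_form c y v (accel c y v) e = 0"
proof -
  assume c: "c \<in> \<A>" and y: "y \<in> domain c"
  have "covariant_deriv_coord \<A> g c y v v (accel c y v)
      = accel c y v + covariant_deriv_coord \<A> g c y v v 0"
    by (simp add: covariant_deriv_coord_def vec_eq_iff)
  also have "\<dots> = - grad_coord \<A> g U c y - riesz_coord \<A> g c y (contract_d_coord \<A> \<mu> c y v)"
    by (simp add: accel_def)
  finally have "covariant_deriv_coord \<A> g c y v v (accel c y v) =
      - grad_coord \<A> g U c y - riesz_coord \<A> g c y (contract_d_coord \<A> \<mu> c y v)" .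
  then show ?thesis using el_equation_iff[OF c y] by blast
qed

text \<open>Each component is polynomial in the velocity, with coefficients built from derivatives
  of analytic functions and entries of the inverse metric; on a compact set such expressions are
  Lipschitz.\<close>

lemma accel_lipschitz:
  assumes c: "c \<in> \<A>" and K1: "compact K1" "convex K1" "K1 \<subseteq> domain c" and K2: "compact K2"
  shows "\<exists>L. L-lipschitz_on (K1 \<times> K2) (\<lambda>z. (snd z, accel c (fst z) (snd z)))"
proof -
  let ?K = "K1 \<times> K2"
  have K: "compact ?K" using K1 K2 by (intro compact_Times)
  note an = lip_on_analytic[OF _ K1]
  have inv: "lip_on ?K (\<lambda>z. matrix_inv (metric_matrix \<A> g c (fst z)) $ k $ m)" for k m
  proof (rule lip_on_matrix_inv[OF K])
    show "lip_on ?K (\<lambda>z. metric_matrix \<A> g c (fst z) $ i $ j)" for i j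
      unfolding metric_matrix_def using an[OF metric_coord_analytic_domain[OF c]] by simp
    show "invertible (metric_matrix \<A> g c (fst z))" if "z \<in> ?K" for z
      using that K1(3) domain_subset[of c] by (intro metric_matrix_invertible[OF c]) auto
  qed
  have dg: "lip_on ?K (\<lambda>z. partial_deriv m (metric_coord \<A> g c i j) (fst z))" for i j m
    by (rule an[OF real_analytic_on_partial_deriv[OF metric_coord_analytic_domain[OF c]]])
  have dU: "lip_on ?K (\<lambda>z. partial_deriv m (fun_coord U c) (fst z))" for m
    by (rule an[OF real_analytic_on_partial_deriv[OF fun_coord_analytic[OF c]]])
  have dm: "lip_on ?K (\<lambda>z. partial_deriv m (form_coord \<A> \<mu> c i) (fst z))" for m i
    by (rule an[OF real_analytic_on_partial_deriv[OF form_coord_analytic[OF c]]])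
  have acc: "lip_on ?K (\<lambda>z. accel c (fst z) (snd z) $ k)" for k
    unfolding accel_def grad_coord_def riesz_coord_def covariant_deriv_coord_def contract_d_coord_def
      christoffel_def matrix_vector_mult_def vec_lambda_beta vector_minus_component
      vector_uminus_component zero_index
    by (intro lip_on_diff lip_on_minus lip_on_add lip_on_sum lip_on_mult[OF K] lip_on_divide[OF K]
        lip_on_const lip_on_velocity inv dg dU dm) auto
  obtain L where L: "L-lipschitz_on ?K (\<lambda>z. accel c (fst z) (snd z))"
    using lipschitz_on_cart[OF acc] by blast
  have "1-lipschitz_on ?K snd" by (rule lipschitz_onI) (auto simp: dist_snd_le)
  from lipschitz_on_Pair[OF this L] show ?thesis by blast
qed

text \<open>\<open>euler_lagrange_solution\<close> asks for the equation in every chart around each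
  point of the curve. A curve that solves it in \<open>c\<close> passes the test in any other chart
  \<open>d\<close> by \<open>el_form_change\<close>.\<close>

lemma chart_solution_euler_lagrange:
  assumes c: "c \<in> \<A>"
    and Y: "\<And>t. t \<in> {0..T} \<Longrightarrow> Y t \<in> domain c"
    and dY: "\<And>t. t \<in> {0..T} \<Longrightarrow> (Y has_vector_derivative V t) (at t within {0..T})"
    and dV: "\<And>t. t \<in> {0..T} \<Longrightarrow> (V has_vector_derivative W t) (at t within {0..T})"
    and el: "\<And>t e. t \<in> {0..T} \<Longrightarrow> el_form c (Y t) (V t) (W t) e = 0"
  shows "euler_lagrange_solution \<A> g U \<mu> A T
    (\<lambda>t. (chart_inv c (Y t), tangent_of \<A> c (chart_inv c (Y t)) (V t)))"
proof -
  define X where "X t = chart_inv c (Y t)" for t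
  have X: "X t \<in> chart_dom c" "X t \<in> A" "chart_map c (X t) = Y t" "c \<in> charts_at \<A> (X t)"
    if "t \<in> {0..T}" for t
    using Y[OF that] c by (auto simp: X_def domain_def chart_inv_chart_map charts_at_iff)
  have contY: "continuous_on {0..T} Y"
    using dY by (meson continuous_on_eq_continuous_within has_vector_derivative_continuous)
  have "continuous_on {0..T} X"
    unfolding X_def
    by (rule continuous_on_compose2[OF homeomorphism_cont2[OF chart(3)[OF c]] contY])
       (use Y domain_subset in blast)
  moreover have "((\<lambda>s. chart_map d (X s)) has_vector_derivative tangent_of \<A> c (X t) (V t) d)
        (at t within {0..T})
      \<and> (\<exists>w. ((\<lambda>s. tangent_of \<A> c (X s) (V s) d) has_vector_derivative w) (at t within {0..T}) \<and>
         covariant_deriv_coord \<A> g d (chart_map d (X t)) (tangent_of \<A> c (X t) (V t) d)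
           (tangent_of \<A> c (X t) (V t) d) w =
         - grad_coord \<A> g U d (chart_map d (X t)) - riesz_coord \<A> g d (chart_map d (X t))
             (contract_d_coord \<A> \<mu> d (chart_map d (X t)) (tangent_of \<A> c (X t) (V t) d)))"
    if t: "t \<in> {0..T}" and d: "d \<in> charts_at \<A> (X t)" for t d
  proof -
    note x = X[OF t]
    have d': "d \<in> \<A>" "X t \<in> chart_dom d" using d by (auto simp: charts_at_iff)
    have ov: "Y t \<in> overlap c d" using in_overlap[OF x(1) d'(2)] x(3) by simp
    have v: "tangent_of \<A> c (X t) (V t) d = jac c d (Y t) (V t)"
      using d x by (simp add: tangent_of_apply)
    have dY': "(Y has_derivative (\<lambda>h. h *\<^sub>R V t)) (at t within {0..T})"
      and dV': "(V has_derivative (\<lambda>h. h *\<^sub>R W t)) (at t within {0..T})"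
      using dY[OF t] dV[OF t] by (simp_all add: has_vector_derivative_def)
    have "((\<lambda>s. transition c d (Y s)) has_vector_derivative jac c d (Y t) (1 *\<^sub>R V t)) (at t within {0..T})"
      by (rule has_derivative_imp_has_vector_derivative[OF has_derivative_compose[OF dY'
            transition_has_derivative[OF c d'(1) ov]]])
    then have 1: "((\<lambda>s. chart_map d (X s)) has_vector_derivative jac c d (Y t) (V t)) (at t within {0..T})"
      by (simp add: transition_def X_def)
    \<comment> \<open>The acceleration in the chart \<open>d\<close>, in the form in which it
      appears in \<open>el_form_change\<close>.\<close>
    define w where "w = hess c d (Y t) (V t) (V t) + jac c d (Y t) (W t)"
    have "((\<lambda>s. jac c d (Y s) (V s)) has_vector_derivative w) (at t within {0..T})"
      using has_derivative_imp_has_vector_derivative[OF jac_has_derivative[OF c d'(1) ov dY' dV']]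
      by (simp add: w_def)
    \<comment> \<open>The expression through \<open>jac\<close> describes the velocity in
      \<open>d\<close> only while the curve stays in the domain of \<open>d\<close>, which is true
      near \<open>t\<close> and suffices for the derivative there.\<close>
    moreover have "\<forall>\<^sub>F s in at t within {0..T}. jac c d (Y s) (V s) = tangent_of \<A> c (X s) (V s) d"
    proof -
      have "(Y \<longlongrightarrow> Y t) (at t within {0..T})" using contY t by (simp add: continuous_on_def)
      then have "\<forall>\<^sub>F s in at t within {0..T}. Y s \<in> overlap c d"
        using overlap_open[OF c d'(1)] ov by (rule topological_tendstoD)
      moreover have "\<forall>\<^sub>F s in at t within {0..T}. s \<in> {0..T}" by (simp add: eventually_at_filter)
      ultimately show ?thesis
      proof eventually_elim
        case (elim s)
        then have "X s \<in> chart_dom d" using c by (auto simp: overlap_def X_def chart_inv_chart_map)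
        then show ?case using X[OF elim(2)] d'(1) by (simp add: tangent_of_apply charts_at_iff)
      qed
    qed
    ultimately have 2: "((\<lambda>s. tangent_of \<A> c (X s) (V s) d) has_vector_derivative w) (at t within {0..T})"
      unfolding has_vector_derivative_def
      by (rule has_derivative_transform_eventually) (use v t in auto)
    have "el_form d (chart_map d (X t)) (jac c d (Y t) (V t)) w e = 0" for e
    proof -
      \<comment> \<open>Every test vector in \<open>d\<close> is the image of one in
        \<open>c\<close>, so vanishing of the covector in \<open>c\<close> carries over
        completely.\<close>
      have e: "jac c d (Y t) (jac d c (chart_map d (X t)) e) = e"
        using jac_chain[OF d'(1) c d'(1) d'(2) x(1) d'(2), of e] jac_self[OF d', of e] x(3) by simp
      show ?thesis
        using el_form_change[OF x(4) d x(2), of "V t" "W t" "jac d c (chart_map d (X t)) e"]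
          el[OF t] by (simp add: x(3) e w_def add.commute)
    qed
    moreover have "chart_map d (X t) \<in> domain d" using d'(2) x(2) by (auto simp: domain_def)
    ultimately show ?thesis
      using el_equation_iff[OF d'(1)] 1 2 unfolding v by blast
  qed
  moreover have "(X t, tangent_of \<A> c (X t) (V t)) \<in> tangent_bundle \<A> A" if "t \<in> {0..T}" for t
    using X[OF that] by (auto simp: tangent_bundle_def tangent_of_in_tangent_space)
  ultimately show ?thesis
    unfolding euler_lagrange_solution_def X_def[symmetric] Let_def fst_conv snd_conv by blast
qed

text \<open>The derivative of the energy is \<open>el_form\<close> paired with the velocity itself:
  for \<open>e = v\<close> the two magnetic terms cancel, so the magnetic force does no
  work.\<close>

lemma energy_derivative:
  assumes c: "c \<in> \<A>" and Y: "Y t \<in> domain c"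
    and dY: "(Y has_vector_derivative V t) (at t within S)"
    and dV: "(V has_vector_derivative w) (at t within S)"
    and el: "\<And>e. el_form c (Y t) (V t) w e = 0"
  shows "((\<lambda>s. metric_form c (Y s) (V s) (V s) / 2 + fun_coord U c (Y s)) has_vector_derivative 0)
    (at t within S)"
proof -
  have dY': "(Y has_derivative (\<lambda>h. h *\<^sub>R V t)) (at t within S)"
    and dV': "(V has_derivative (\<lambda>h. h *\<^sub>R w)) (at t within S)"
    using dY dV by (simp_all add: has_vector_derivative_def)
  have sym: "metric_form c (Y t) (V t) w = metric_form c (Y t) w (V t)"
  proof -
    obtain x where "c \<in> charts_at \<A> x" "Y t = chart_map c x"
      using Y c by (auto simp: domain_def charts_at_iff)
    then show ?thesis using metric_form_sym by simp
  qed
  from has_derivative_imp_has_vector_derivative[OF has_derivative_add[OF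
      has_derivative_mult_left[OF metric_form_has_derivative[OF c Y dY' dV' dV'], of "1/2"]
      fun_coord_has_derivative[OF c Y dY']]] el[of "V t"]
  show ?thesis by (simp add: sym el_form_def field_simps)
qed

text \<open>The product rule leaves a term with the acceleration, which the equation of motion
  paired with \<open>X (Y t)\<close> eliminates.\<close>

lemma virial_derivative:
  assumes c: "c \<in> \<A>" and Y: "Y t \<in> domain c"
    and dY: "(Y has_vector_derivative V t) (at t within S)"
    and dV: "(V has_vector_derivative w) (at t within S)"
    and el: "\<And>e. el_form c (Y t) (V t) w e = 0"
    and X: "(X has_derivative DX) (at (Y t))"
  shows "((\<lambda>s. metric_form c (Y s) (V s) (X (Y s))) has_vector_derivative
     (metric_form c (Y t) (V t) (DX (V t)) + metric_deriv c (Y t) (X (Y t)) (V t) (V t) / 2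
       - dir_deriv (fun_coord U c) (Y t) (X (Y t))
       - (form_deriv c (Y t) (V t) (X (Y t)) - form_deriv c (Y t) (X (Y t)) (V t)))) (at t within S)"
proof -
  have dY': "(Y has_derivative (\<lambda>h. h *\<^sub>R V t)) (at t within S)"
    and dV': "(V has_derivative (\<lambda>h. h *\<^sub>R w)) (at t within S)"
    using dY dV by (simp_all add: has_vector_derivative_def)
  from has_derivative_imp_has_vector_derivative[OF
      metric_form_has_derivative[OF c Y dY' dV' has_derivative_compose[OF dY' X]]]
  have "((\<lambda>s. metric_form c (Y s) (V s) (X (Y s))) has_vector_derivative
     (metric_deriv c (Y t) (V t) (V t) (X (Y t)) + metric_form c (Y t) w (X (Y t))
       + metric_form c (Y t) (V t) (DX (V t)))) (at t within S)"
    by simp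
  moreover have "metric_deriv c (Y t) (V t) (V t) (X (Y t)) + metric_form c (Y t) w (X (Y t))
       + metric_form c (Y t) (V t) (DX (V t)) =
     metric_form c (Y t) (V t) (DX (V t)) + metric_deriv c (Y t) (X (Y t)) (V t) (V t) / 2
       - dir_deriv (fun_coord U c) (Y t) (X (Y t))
       - (form_deriv c (Y t) (V t) (X (Y t)) - form_deriv c (Y t) (X (Y t)) (V t))"
    using el[of "X (Y t)"] unfolding el_form_def by linarith
  ultimately show ?thesis by (simp only:)
qed

end

section \<open>The leading form of the potential\<close>

definition grad :: "(real^'n::finite \<Rightarrow> real) \<Rightarrow> real^'n \<Rightarrow> real^'n" where
  "grad F x = (\<chi> i. partial_deriv i F x)"

lemma dir_deriv_grad: "dir_deriv F x k = grad F x \<bullet> k"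
  by (simp add: dir_deriv_def grad_def inner_vec_def mult.commute)

section \<open>Homogeneous polynomials and their gradients\<close>

definition hom_poly :: "(('n::finite \<Rightarrow> nat) \<Rightarrow> real) \<Rightarrow> nat \<Rightarrow> real^'n \<Rightarrow> real" where
  "hom_poly a k h = (\<Sum>\<alpha> | sum \<alpha> UNIV = k. a \<alpha> * monomial_val \<alpha> h)"

definition hom_grad :: "(('n::finite \<Rightarrow> nat) \<Rightarrow> real) \<Rightarrow> nat \<Rightarrow> real^'n \<Rightarrow> real^'n" where
  "hom_grad a k h =
     (\<chi> i. \<Sum>\<alpha> | sum \<alpha> UNIV = k. a \<alpha> * (real (\<alpha> i) * monomial_val (\<alpha>(i := \<alpha> i - 1)) h))"

lemma taylor_term_eq: "has_power_series F a 0 \<Longrightarrow> taylor_term F 0 k = hom_poly a k"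
  by (auto simp: taylor_term_def hom_poly_def taylor_coeff_eq)

lemma hom_poly_zero_imp_coeffs:
  assumes "\<And>h. hom_poly a k h = 0" "sum \<alpha> UNIV = k"
  shows "a \<alpha> = 0"
  by (rule polynomial_coeffs_zero[OF finite_multiindices[of k]])
     (use assms in \<open>simp_all add: hom_poly_def\<close>)

lemma hom_poly_has_derivative:
  "(hom_poly a k has_derivative (\<lambda>v. hom_grad a k h \<bullet> v)) (at h)"
proof -
  have "((\<lambda>h. \<Sum>\<alpha> | sum \<alpha> UNIV = k. a \<alpha> * monomial_val \<alpha> h) has_derivative
     (\<lambda>v. \<Sum>\<alpha> | sum \<alpha> UNIV = k. a \<alpha> *
        (\<Sum>i\<in>UNIV. v $ i * (real (\<alpha> i) * monomial_val (\<alpha>(i := \<alpha> i - 1)) h)))) (at h)"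
    by (intro has_derivative_sum has_derivative_mult_right monomial_val_has_derivative)
  moreover have "(\<Sum>\<alpha> | sum \<alpha> UNIV = k. a \<alpha> *
        (\<Sum>i\<in>UNIV. v $ i * (real (\<alpha> i) * monomial_val (\<alpha>(i := \<alpha> i - 1)) h))) = hom_grad a k h \<bullet> v" for v
    unfolding hom_grad_def inner_vec_def vec_lambda_beta inner_real_def
    by (simp add: sum_distrib_left sum_distrib_right mult_ac) (rule sum.swap)
  ultimately show ?thesis by (simp add: hom_poly_def[abs_def])
qed

lemma grad_hom_poly: "grad (hom_poly a k) h = hom_grad a k h"
proof -
  have "(hom_poly a k has_derivative (\<lambda>v. \<Sum>i\<in>UNIV. v $ i * hom_grad a k h $ i)) (at h)"
    using hom_poly_has_derivative[of a k h] by (simp add: inner_vec_def mult.commute)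
  from partial_deriv_eq[OF this] show ?thesis by (simp add: grad_def vec_eq_iff)
qed

lemma monomial_val_scaleR: "monomial_val \<alpha> (t *\<^sub>R h) = t ^ sum \<alpha> UNIV * monomial_val \<alpha> h"
  by (simp add: monomial_val_def power_mult_distrib prod.distrib power_sum)

lemma sum_fun_upd_pred:
  fixes \<alpha> :: "'n::finite \<Rightarrow> nat"
  assumes "\<alpha> i > 0"
  shows "sum (\<alpha>(i := \<alpha> i - 1)) UNIV = sum \<alpha> UNIV - 1"
proof -
  let ?\<beta> = "\<alpha>(i := \<alpha> i - 1)"
  have "\<alpha> = ?\<beta>(i := ?\<beta> i + 1)" using assms by auto
  then have "sum \<alpha> UNIV = sum ?\<beta> UNIV + 1" using sum_fun_upd_Suc[of ?\<beta> i] by simp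
  then show ?thesis by simp
qed

lemma monomial_val_euler:
  "h $ i * (real (\<alpha> i) * monomial_val (\<alpha>(i := \<alpha> i - 1)) h) = real (\<alpha> i) * monomial_val \<alpha> h"
proof (cases "\<alpha> i")
  case (Suc n)
  have "monomial_val \<alpha> h = h $ i ^ \<alpha> i * (\<Prod>j\<in>UNIV - {i}. h $ j ^ \<alpha> j)"
    unfolding monomial_val_def by (subst prod.remove[of _ i]) auto
  moreover have "monomial_val (\<alpha>(i := \<alpha> i - 1)) h = h $ i ^ (\<alpha> i - 1) * (\<Prod>j\<in>UNIV - {i}. h $ j ^ \<alpha> j)"
    unfolding monomial_val_def by (subst prod.remove[of _ i]) auto
  ultimately show ?thesis by (simp add: Suc)
qed simp

lemma hom_poly_scaleR: "hom_poly a k (t *\<^sub>R h) = t ^ k * hom_poly a k h"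
  by (simp add: hom_poly_def monomial_val_scaleR sum_distrib_left mult_ac)

text \<open>The truncated exponent is safe at \<open>k = 0\<close>: there all terms carry the factor
  \<open>real (\<alpha> i) = 0\<close>.\<close>

lemma hom_grad_scaleR: "hom_grad a k (t *\<^sub>R h) = t ^ (k - 1) *\<^sub>R hom_grad a k h"
proof -
  have "real (\<alpha> i) * monomial_val (\<alpha>(i := \<alpha> i - 1)) (t *\<^sub>R h)
      = t ^ (sum \<alpha> UNIV - 1) * (real (\<alpha> i) * monomial_val (\<alpha>(i := \<alpha> i - 1)) h)" for \<alpha> :: "'a \<Rightarrow> nat" and i
  proof (cases "\<alpha> i = 0")
    case False
    then show ?thesis unfolding monomial_val_scaleR using sum_fun_upd_pred[of \<alpha> i] by (simp only:) simp
  qed simp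
  note scale = this
  show ?thesis
    unfolding hom_grad_def vec_eq_iff vec_lambda_beta vector_scaleR_component scale sum_distrib_left
      real_scaleR_def
    by (auto intro!: sum.cong)
qed

lemma hom_grad_euler: "hom_grad a k h \<bullet> h = real k * hom_poly a k h"
proof -
  have "hom_grad a k h \<bullet> h = (\<Sum>i\<in>UNIV. \<Sum>\<alpha> | sum \<alpha> UNIV = k. a \<alpha> * (real (\<alpha> i) * monomial_val \<alpha> h))"
    unfolding hom_grad_def inner_vec_def inner_real_def vec_lambda_beta monomial_val_euler[symmetric]
    by (simp add: sum_distrib_left sum_distrib_right mult_ac)
  also have "\<dots> = (\<Sum>\<alpha> | sum \<alpha> UNIV = k. a \<alpha> * (real (sum \<alpha> UNIV) * monomial_val \<alpha> h))"
    by (subst sum.swap) (simp only: of_nat_sum sum_distrib_left sum_distrib_right)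
  also have "\<dots> = real k * hom_poly a k h"
    by (simp add: hom_poly_def sum_distrib_left mult_ac)
  finally show ?thesis .
qed

lemma continuous_monomial_val: "continuous_on S (monomial_val \<alpha>)"
  unfolding monomial_val_def[abs_def] by (intro continuous_intros)

lemma continuous_hom_poly: "continuous_on S (hom_poly a k)"
  unfolding hom_poly_def[abs_def] by (intro continuous_intros continuous_monomial_val)

lemma continuous_hom_grad: "continuous_on S (hom_grad a k)"
  unfolding hom_grad_def[abs_def] by (intro continuous_on_vec_lambda continuous_intros continuous_monomial_val)

text \<open>Chain rule through \<open>sphere_param\<close>. As \<open>f\<close> is a restriction, it
  agrees with the polynomial only at points of the sphere, so \<open>x + u\<close> must be non-zero;
  this holds for every \<open>u\<close> orthogonal to \<open>x\<close>.\<close>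

lemma sphere_critical_of_critical_zero:
  assumes x: "x \<in> sphere 0 1" and "hom_grad a k x = 0"
    and f: "f = restrict (hom_poly a k) (sphere 0 1)"
  shows "sphere_critical f x"
proof -
  have nz: "x + u \<noteq> 0" if "u \<in> sphere_tangent x" for u
  proof
    assume "x + u = 0"
    then have "x \<bullet> (x + u) = 0" by simp
    then show False using that x by (simp add: inner_add_right sphere_tangent_def dot_square_norm)
  qed
  have "x \<noteq> 0" using x by auto
  have shift: "(\<lambda>u. x + u) differentiable (at 0)" by simp
  then have "(\<lambda>u. norm (x + u)) differentiable (at 0)"
    by (rule differentiable_compose[of norm "\<lambda>u. x + u", rotated])
       (use \<open>x \<noteq> 0\<close> in \<open>simp add: differentiable_norm_at\<close>)
  then have "sphere_param x differentiable (at 0)"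
    unfolding sphere_param_def[abs_def] using shift \<open>x \<noteq> 0\<close>
    by (intro differentiable_scaleR differentiable_inverse) auto
  then obtain D where D: "(sphere_param x has_derivative D) (at 0)"
    unfolding differentiable_def by blast
  have "sphere_param x 0 = x" using x by (simp add: sphere_param_def)
  then have "(hom_poly a k has_derivative (\<lambda>v. 0)) (at (sphere_param x 0))"
    using hom_poly_has_derivative[of a k x] assms(2) by simp
  from has_derivative_compose[OF D this]
  have "((\<lambda>u. hom_poly a k (sphere_param x u)) has_derivative (\<lambda>_. 0)) (at 0 within sphere_tangent x)"
    by (rule has_derivative_at_withinI)
  then have "((\<lambda>u. f (sphere_param x u)) has_derivative (\<lambda>_. 0)) (at 0 within sphere_tangent x)"
  proof (rule has_derivative_transform[rotated 2])
    show "0 \<in> sphere_tangent x" by (simp add: sphere_tangent_def)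
    show "f (sphere_param x u) = hom_poly a k (sphere_param x u)" if "u \<in> sphere_tangent x" for u
      using nz[OF that] by (simp add: f sphere_param_def)
  qed
  with x show ?thesis by (simp add: sphere_critical_def)
qed

text \<open>Compactness is applied to the maximum of \<open>W\<close> and the form itself. It is
  positive everywhere: for a negative form the Euler term is positive, on its zeros regularity makes
  the gradient non-zero. Where the form is below the minimum \<open>c\<close> of this maximum,
  \<open>W\<close> must reach \<open>c\<close>. Thus the bound persists slightly into the region
  where the form is positive, as the remainder of the Taylor expansion requires.\<close>

lemma sphere_lower_bound:
  fixes a :: "('n::finite \<Rightarrow> nat) \<Rightarrow> real"
  assumes reg: "sphere_regular_value (restrict (hom_poly a k) (sphere 0 1)) 0"
    and "k > 0" "\<epsilon> > 0"
  obtains c where "c > 0"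
    "\<And>\<omega>. norm \<omega> = 1 \<Longrightarrow> hom_poly a k \<omega> < c \<Longrightarrow>
       \<epsilon> * (hom_grad a k \<omega> \<bullet> hom_grad a k \<omega>) - real k * hom_poly a k \<omega> \<ge> c"
proof -
  let ?Q = "hom_poly a k" and ?D = "hom_grad a k"
  define W where "W \<omega> = \<epsilon> * (?D \<omega> \<bullet> ?D \<omega>) - real k * ?Q \<omega>" for \<omega>
  have cont: "continuous_on (sphere 0 1) (\<lambda>\<omega>. max (W \<omega>) (?Q \<omega>))"
    unfolding W_def by (intro continuous_intros continuous_hom_poly continuous_hom_grad)
  have "sphere (0 :: real^'n) 1 \<noteq> {}" by simp
  from continuous_attains_inf[OF compact_sphere this cont] obtain \<omega>\<^sub>0 where w0: "\<omega>\<^sub>0 \<in> sphere 0 1"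
    and min: "\<And>\<omega>. \<omega> \<in> sphere 0 1 \<Longrightarrow> max (W \<omega>\<^sub>0) (?Q \<omega>\<^sub>0) \<le> max (W \<omega>) (?Q \<omega>)"
    by blast
  let ?c = "max (W \<omega>\<^sub>0) (?Q \<omega>\<^sub>0)"
  have "?c > 0"
  proof (cases "?Q \<omega>\<^sub>0" "0 :: real" rule: linorder_cases)
    case less
    have "real k * ?Q \<omega>\<^sub>0 < 0" using less \<open>k > 0\<close> by (simp add: mult_pos_neg)
    moreover have "\<epsilon> * (?D \<omega>\<^sub>0 \<bullet> ?D \<omega>\<^sub>0) \<ge> 0" using \<open>\<epsilon> > 0\<close> by simp
    ultimately have "W \<omega>\<^sub>0 > 0" unfolding W_def by linarith
    then show ?thesis by simp
  next
    case equal
    then have "?D \<omega>\<^sub>0 \<noteq> 0"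
      using sphere_critical_of_critical_zero[OF w0 _ refl, of a k] reg w0
      unfolding sphere_regular_value_def by auto
    then have "W \<omega>\<^sub>0 > 0" using \<open>\<epsilon> > 0\<close> equal by (simp add: W_def)
    then show ?thesis by simp
  qed simp
  moreover have "W \<omega> \<ge> ?c" if "norm \<omega> = 1" "?Q \<omega> < ?c" for \<omega>
    using min[of \<omega>] that by auto
  ultimately show ?thesis using that[of ?c] unfolding W_def by blast
qed

text \<open>With \<open>l = k + 2\<close> both terms are homogeneous of degree
  \<open>2 * k + 2\<close>, the first as the square of a gradient of degree \<open>k + 1\<close>,
  the second as \<open>k + l\<close>; hence the bound on the sphere scales.\<close>

lemma scaled_lower_bound:
  fixes a :: "('n::finite \<Rightarrow> nat) \<Rightarrow> real"
  assumes reg: "sphere_regular_value (restrict (hom_poly a l) (sphere 0 1)) 0"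
    and "l = k + 2" "\<epsilon> > 0"
  obtains c where "c > 0"
    "\<And>x. x \<noteq> 0 \<Longrightarrow> hom_poly a l x < c * norm x ^ l \<Longrightarrow>
       \<epsilon> * (hom_grad a l x \<bullet> hom_grad a l x) - norm x ^ k * (real l * hom_poly a l x) \<ge> c * norm x ^ (2 * k + 2)"
proof -
  have "l > 0" using assms by simp
  then obtain c where c: "c > 0"
    "\<And>\<omega>. norm \<omega> = 1 \<Longrightarrow> hom_poly a l \<omega> < c \<Longrightarrow>
       \<epsilon> * (hom_grad a l \<omega> \<bullet> hom_grad a l \<omega>) - real l * hom_poly a l \<omega> \<ge> c"
    using sphere_lower_bound[OF reg _ \<open>\<epsilon> > 0\<close>] by metis
  have "\<epsilon> * (hom_grad a l x \<bullet> hom_grad a l x) - norm x ^ k * (real l * hom_poly a l x) \<ge> c * norm x ^ (2 * k + 2)"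
    if x: "x \<noteq> 0" "hom_poly a l x < c * norm x ^ l" for x
  proof -
    define \<omega> where "\<omega> = x /\<^sub>R norm x"
    have w: "norm \<omega> = 1" "x = norm x *\<^sub>R \<omega>" using x by (auto simp: \<omega>_def)
    have Q: "hom_poly a l x = norm x ^ l * hom_poly a l \<omega>"
      by (subst w(2)) (rule hom_poly_scaleR)
    have D: "hom_grad a l x = norm x ^ (k + 1) *\<^sub>R hom_grad a l \<omega>"
      by (subst w(2), subst hom_grad_scaleR) (simp add: assms(2))
    have "hom_poly a l \<omega> < c" using x unfolding Q by simp
    from c(2)[OF w(1) this]
    have "c * norm x ^ (2 * k + 2) \<le>
      (\<epsilon> * (hom_grad a l \<omega> \<bullet> hom_grad a l \<omega>) - real l * hom_poly a l \<omega>) * norm x ^ (2 * k + 2)"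
      by (intro mult_right_mono) auto
    also have "\<dots> = \<epsilon> * (hom_grad a l x \<bullet> hom_grad a l x) - norm x ^ k * (real l * hom_poly a l x)"
    proof -
      have p: "r ^ (k + 1) * r ^ (k + 1) = r ^ (2 * k + 2)" "r ^ k * r ^ (k + 2) = r ^ (2 * k + 2)" for r :: real
        by (simp_all only: power_add[symmetric]) (simp_all add: mult_2)
      have "(\<epsilon> * A - L * B) * r ^ (2 * k + 2) =
          \<epsilon> * ((r ^ (k + 1) * r ^ (k + 1)) * A) - (r ^ k * r ^ (k + 2)) * (L * B)" for A B L r :: real
        unfolding p by (simp add: left_diff_distrib)
      then show ?thesis unfolding Q D unfolding assms(2) inner_scaleR_left inner_scaleR_right
        by (simp only: mult.assoc mult.left_commute)
    qed
    finally show ?thesis .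
  qed
  with c(1) show ?thesis using that by blast
qed

text \<open>An upper bound \<open>O(norm x ^ m)\<close>; the function may vanish to higher
  order.\<close>

definition vanishes_to_order :: "nat \<Rightarrow> (real^'n::finite \<Rightarrow> real) \<Rightarrow> bool" where
  "vanishes_to_order m F \<longleftrightarrow> (\<exists>C>0. \<forall>\<^sub>F x in nhds 0. \<bar>F x\<bar> \<le> C * norm x ^ m)"

lemma power_series_vanishes_to_order:
  assumes "has_power_series F a 0" "\<And>\<alpha>. sum \<alpha> UNIV < m \<Longrightarrow> a \<alpha> = 0"
  shows "vanishes_to_order m F"
proof -
  from power_series_vanishing_order[OF assms] obtain C r where "C > 0" "r > 0"
    and le: "\<And>h. norm h \<le> r \<Longrightarrow> \<bar>F h\<bar> \<le> C * norm h ^ m" by blast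
  then show ?thesis
    unfolding vanishes_to_order_def eventually_nhds_metric
    by (intro exI[of _ C] conjI exI[of _ r]) (auto simp: dist_norm)
qed

lemma vanishes_to_order_uniform:
  fixes F :: "'i::finite \<Rightarrow> real^'n::finite \<Rightarrow> real"
  assumes "\<And>i. vanishes_to_order m (F i)"
  obtains C where "C > 0" "\<forall>\<^sub>F x in nhds 0. \<forall>i. \<bar>F i x\<bar> \<le> C * norm x ^ m"
proof -
  from assms obtain C where C: "\<And>i. C i > 0" "\<And>i. \<forall>\<^sub>F x in nhds 0. \<bar>F i x\<bar> \<le> C i * norm x ^ m"
    unfolding vanishes_to_order_def by metis
  have le: "C i \<le> sum C UNIV" for i using C(1) by (intro member_le_sum) (auto intro: less_imp_le)
  have "\<forall>\<^sub>F x in nhds 0. \<forall>i. \<bar>F i x\<bar> \<le> C i * norm x ^ m"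
    using C(2) by (intro eventually_all_finite) auto
  then have "\<forall>\<^sub>F x in nhds 0. \<forall>i. \<bar>F i x\<bar> \<le> sum C UNIV * norm x ^ m"
    by eventually_elim (meson le mult_right_mono norm_ge_zero order_trans zero_le_power)
  moreover have "sum C UNIV > 0" using C(1) by (intro sum_pos) auto
  ultimately show ?thesis using that by blast
qed

lemma norm_vec_le:
  fixes z :: "real^'n::finite"
  assumes "\<And>i. \<bar>z $ i\<bar> \<le> B"
  shows "norm z \<le> real CARD('n) * B"
proof -
  have "norm z \<le> (\<Sum>i\<in>UNIV. \<bar>z $ i\<bar>)" by (rule norm_le_l1_cart)
  also have "\<dots> \<le> (\<Sum>i\<in>(UNIV :: 'n set). B)" by (intro sum_mono assms)
  finally show ?thesis by simp
qed

text \<open>The truncated \<open>m - 1\<close> is intended: for \<open>m = 0\<close> the statement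
  is boundedness of the gradient near 0, which is all that the metric coefficients need.\<close>

lemma grad_vanishes:
  fixes F :: "real^'n::finite \<Rightarrow> real"
  assumes F: "has_power_series F a 0" "\<And>\<alpha>. sum \<alpha> UNIV < m \<Longrightarrow> a \<alpha> = 0"
  obtains C where "C > 0" "\<forall>\<^sub>F x in nhds 0. norm (grad F x) \<le> C * norm x ^ (m - 1)"
proof -
  have "vanishes_to_order (m - 1) (partial_deriv i F)" for i
    by (rule power_series_vanishes_to_order[OF has_power_series_partial_deriv[OF F(1)]])
       (rule shift_coeff_vanishing[OF F(2)])
  from vanishes_to_order_uniform[of "m - 1" "\<lambda>i. partial_deriv i F", OF this]
  obtain C where C: "C > 0" "\<forall>\<^sub>F x in nhds 0. \<forall>i. \<bar>partial_deriv i F x\<bar> \<le> C * norm x ^ (m - 1)"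
    by blast
  have "\<forall>\<^sub>F x in nhds 0. norm (grad F x) \<le> (real CARD('n) * C) * norm x ^ (m - 1)"
    using C(2) by eventually_elim (auto simp: grad_def mult.assoc intro!: norm_vec_le)
  then show ?thesis using that[of "real CARD('n) * C"] C(1) by simp
qed

lemma bilinear_bound:
  fixes M :: "'n::finite \<Rightarrow> 'n \<Rightarrow> real" and u w :: "real^'n"
  assumes "\<And>i j. \<bar>M i j\<bar> \<le> B"
  shows "\<bar>\<Sum>i\<in>UNIV. \<Sum>j\<in>UNIV. M i j * u $ i * w $ j\<bar> \<le> (real CARD('n))\<^sup>2 * B * norm u * norm w"
proof -
  have "\<bar>\<Sum>i\<in>UNIV. \<Sum>j\<in>UNIV. M i j * u $ i * w $ j\<bar> \<le> (\<Sum>i\<in>UNIV. \<Sum>j\<in>UNIV. \<bar>M i j * u $ i * w $ j\<bar>)"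
    by (intro order_trans[OF sum_abs] sum_mono sum_abs)
  also have "\<dots> \<le> (\<Sum>i\<in>(UNIV :: 'n set). \<Sum>j\<in>(UNIV :: 'n set). B * norm u * norm w)"
    unfolding abs_mult
    by (intro sum_mono mult_mono assms component_le_norm_cart mult_nonneg_nonneg)
       (use order_trans[OF abs_ge_zero assms] in auto)
  also have "\<dots> = (real CARD('n))\<^sup>2 * B * norm u * norm w" by (simp add: power2_eq_square)
  finally show ?thesis .
qed

text \<open>Only the leading form enters at a point of the sphere, and \<open>u x < 0\<close> bounds it from above
  by a term of higher order; hence the estimate needs regularity of the zero value alone.\<close>

lemma potential_lower_bound:
  fixes u :: "real^'n::finite \<Rightarrow> real"
  assumes u: "has_power_series u a 0" "\<And>\<alpha>. sum \<alpha> UNIV < l \<Longrightarrow> a \<alpha> = 0"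
    and reg: "sphere_regular_value (restrict (hom_poly a l) (sphere 0 1)) 0"
    and l: "l = k + 2" and "\<epsilon> > 0"
  obtains c where "c > 0"
    "\<forall>\<^sub>F x in nhds 0. x \<noteq> 0 \<longrightarrow> u x < 0 \<longrightarrow>
       \<epsilon> * (grad u x \<bullet> grad u x) - norm x ^ k * (grad u x \<bullet> x) \<ge> c * norm x ^ (2 * k + 2)"
proof -
  let ?Q = "hom_poly a l" and ?q = "\<lambda>\<alpha>. if sum \<alpha> UNIV = l then a \<alpha> else 0"
  obtain c where c: "c > 0" "\<And>x. x \<noteq> 0 \<Longrightarrow> ?Q x < c * norm x ^ l \<Longrightarrow>
       \<epsilon> * (hom_grad a l x \<bullet> hom_grad a l x) - norm x ^ k * (real l * ?Q x) \<ge> c * norm x ^ (2 * k + 2)"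
    using scaled_lower_bound[OF reg l \<open>\<epsilon> > 0\<close>] by metis
  have "has_power_series ?Q ?q 0"
    using has_power_series_polynomial[OF finite_multiindices, of a l] by (simp add: hom_poly_def[abs_def])
  then have Q: "has_power_series ?Q ?q (0 :: real^'n)" .
  have q0: "?q \<alpha> = 0" if "sum \<alpha> UNIV < l" for \<alpha> using that by simp
  have R: "has_power_series (\<lambda>x. u x - ?Q x) (\<lambda>\<alpha>. a \<alpha> - ?q \<alpha>) 0"
    by (rule has_power_series_diff[OF u(1) Q])
  have r0: "a \<alpha> - ?q \<alpha> = 0" if "sum \<alpha> UNIV < l + 1" for \<alpha>
    using that u(2)[of \<alpha>] by (auto simp: less_Suc_eq)
  have "vanishes_to_order (l + 1) (\<lambda>x. u x - ?Q x)"
    by (rule power_series_vanishes_to_order[OF R]) (rule r0)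
  then obtain C1 where C1: "C1 > 0" "\<forall>\<^sub>F x in nhds 0. \<bar>u x - ?Q x\<bar> \<le> C1 * norm x ^ (l + 1)"
    unfolding vanishes_to_order_def by blast
  obtain C2 where C2: "C2 > 0" "\<forall>\<^sub>F x in nhds 0. norm (grad (\<lambda>x. u x - ?Q x) x) \<le> C2 * norm x ^ l"
  proof (rule grad_vanishes[OF R, of "l + 1"])
    show "a \<alpha> - ?q \<alpha> = 0" if "sum \<alpha> UNIV < l + 1" for \<alpha> using that by (rule r0)
  qed auto
  obtain C3 where C3: "C3 > 0" "\<forall>\<^sub>F x in nhds 0. norm (grad ?Q x) \<le> C3 * norm x ^ (l - 1)"
  proof (rule grad_vanishes[OF Q, of l])
    show "?q \<alpha> = 0" if "sum \<alpha> UNIV < l" for \<alpha> using that by (rule q0)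
  qed auto
  \<comment> \<open>Splitting the gradient of the remainder into a difference of gradients needs
    \<open>u\<close> differentiable at all points near 0.\<close>
  have diffu: "\<forall>\<^sub>F x in nhds 0. u differentiable (at x)"
  proof -
    obtain \<rho> where \<rho>: "power_series_on_cube u a 0 \<rho>" using has_power_series_imp_cube[OF u(1)] .
    then have "\<rho> > 0" by (simp add: power_series_on_cube_def)
    show ?thesis
      unfolding eventually_nhds_metric
    proof (intro exI[of _ "\<rho>/2"] conjI allI impI)
      fix x :: "real^'n" assume "dist x 0 < \<rho>/2"
      then have "\<bar>x $ j\<bar> < \<rho>/2" for j using component_le_norm_cart[of x j] by (simp add: dist_norm)
      from cube_termwise_derivative(2)[OF \<rho> this] show "u differentiable (at x)"
        unfolding differentiable_def by auto
    qed (use \<open>\<rho> > 0\<close> in simp)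
  qed
  \<comment> \<open>The coefficient of the total error of order \<open>2 * k + 3\<close>: twice
    \<epsilon> times the mixed product of the gradients of form and remainder, plus the radial
    product with the gradient of the remainder.\<close>
  define C where "C = 2 * \<epsilon> * C3 * C2 + C2"
  have C: "C > 0" using \<open>\<epsilon> > 0\<close> C2 C3 by (simp add: C_def add_pos_pos)
  have small: "\<forall>\<^sub>F x :: real^'n in nhds 0. norm x < \<delta>" if "\<delta> > 0" for \<delta>
    using that unfolding eventually_nhds_metric by (auto simp: dist_norm)
  \<comment> \<open>Below the first radius \<open>u x < 0\<close> forces the form under
    \<open>c * norm x ^ l\<close>; below the second the error is at most half of the main
    term.\<close>
  have pos: "c / C1 > 0" "c / (2 * C) > 0" using c(1) C1(1) C by auto
  have "\<forall>\<^sub>F x in nhds 0. x \<noteq> 0 \<longrightarrow> u x < 0 \<longrightarrow>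
       \<epsilon> * (grad u x \<bullet> grad u x) - norm x ^ k * (grad u x \<bullet> x) \<ge> (c/2) * norm x ^ (2 * k + 2)"
    using C1(2) C2(2) C3(2) diffu small[OF pos(1)] small[OF pos(2)]
  proof (eventually_elim, intro impI)
    case (elim x)
    let ?r = "norm x" and ?D = "grad ?Q x" and ?d = "grad u x - grad ?Q x"
    assume "x \<noteq> 0" "u x < 0"
    then have r: "?r > 0" by simp
    have d: "norm ?d \<le> C2 * ?r ^ l"
    proof -
      have "(u has_derivative (\<lambda>k. grad u x \<bullet> k)) (at x)"
        using elim(4) dir_deriv_unique[of u _ x] unfolding differentiable_def
        by (auto simp: dir_deriv_grad[abs_def] fun_eq_iff intro: has_derivative_eq_rhs)
      from has_derivative_diff[OF this hom_poly_has_derivative[of a l x]]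
      have "dir_deriv (\<lambda>x. u x - ?Q x) x = (\<lambda>k. grad u x \<bullet> k - hom_grad a l x \<bullet> k)"
        by (rule dir_deriv_unique[symmetric])
      then have "grad (\<lambda>x. u x - ?Q x) x \<bullet> k = ?d \<bullet> k" for k
        by (simp add: dir_deriv_grad[symmetric] grad_hom_poly inner_diff_left)
      then have "grad (\<lambda>x. u x - ?Q x) x = ?d" by (metis vector_eq_rdot)
      then show ?thesis using elim(2) by simp
    qed
    have "?Q x \<le> C1 * ?r ^ (l + 1)" using elim(1) \<open>u x < 0\<close> by linarith
    also have "\<dots> < c * ?r ^ l" using elim(5) r C1(1) by (simp add: field_simps)
    finally have main: "\<epsilon> * (?D \<bullet> ?D) - ?r ^ k * (real l * ?Q x) \<ge> c * ?r ^ (2 * k + 2)"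
      unfolding grad_hom_poly by (rule c(2)[OF \<open>x \<noteq> 0\<close>])
    have "norm ?d * norm ?D \<le> (C2 * ?r ^ l) * (C3 * ?r ^ (l - 1))"
      using d elim(3) C2 by (intro mult_mono) auto
    also have "\<dots> = C3 * C2 * ?r ^ (2 * k + 3)"
      by (simp add: l power_add mult_2 mult_2_right eval_nat_numeral mult_ac)
    finally have dD: "?d \<bullet> ?D \<ge> - (C3 * C2 * ?r ^ (2 * k + 3))"
      using Cauchy_Schwarz_ineq2[of ?d ?D] by linarith
    have dx: "?r ^ k * (?d \<bullet> x) \<le> C2 * ?r ^ (2 * k + 3)"
    proof -
      have "?d \<bullet> x \<le> norm ?d * ?r" by (rule norm_cauchy_schwarz)
      also have "\<dots> \<le> C2 * ?r ^ l * ?r" using d by (intro mult_right_mono) auto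
      finally have "?r ^ k * (?d \<bullet> x) \<le> ?r ^ k * (C2 * ?r ^ l * ?r)" by (intro mult_left_mono) auto
      also have "\<dots> = C2 * ?r ^ (2 * k + 3)"
        by (simp add: l power_add mult_2 mult_2_right eval_nat_numeral mult_ac)
      finally show ?thesis .
    qed
    have "grad u x \<bullet> grad u x = ?D \<bullet> ?D + 2 * (?d \<bullet> ?D) + ?d \<bullet> ?d"
      by (simp add: inner_diff_left inner_diff_right inner_commute)
    then have "grad u x \<bullet> grad u x \<ge> ?D \<bullet> ?D - 2 * (C3 * C2 * ?r ^ (2 * k + 3))"
      using dD inner_ge_zero[of ?d] by linarith
    then have gg: "\<epsilon> * (grad u x \<bullet> grad u x) \<ge> \<epsilon> * (?D \<bullet> ?D - 2 * (C3 * C2 * ?r ^ (2 * k + 3)))"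
      using \<open>\<epsilon> > 0\<close> by (intro mult_left_mono) auto
    have "grad u x \<bullet> x = real l * ?Q x + ?d \<bullet> x"
      by (simp add: inner_diff_left grad_hom_poly hom_grad_euler)
    then have gx: "?r ^ k * (grad u x \<bullet> x) \<le> ?r ^ k * (real l * ?Q x) + C2 * ?r ^ (2 * k + 3)"
      using dx by (simp add: distrib_left)
    have "C * ?r ^ (2 * k + 3) = (C * ?r) * ?r ^ (2 * k + 2)"
      by (simp add: power_add mult_2 mult_2_right eval_nat_numeral mult_ac)
    also have "\<dots> \<le> (c/2) * ?r ^ (2 * k + 2)"
      using elim(6) C by (intro mult_right_mono) (auto simp: field_simps)
    finally have "C * ?r ^ (2 * k + 3) \<le> (c/2) * ?r ^ (2 * k + 2)" .
    then have "2 * \<epsilon> * C3 * C2 * ?r ^ (2 * k + 3) + C2 * ?r ^ (2 * k + 3) \<le> (c/2) * ?r ^ (2 * k + 2)"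
      by (simp add: C_def distrib_right)
    then show "\<epsilon> * (grad u x \<bullet> grad u x) - ?r ^ k * (grad u x \<bullet> x) \<ge> (c/2) * ?r ^ (2 * k + 2)"
      using main gg gx by (simp add: right_diff_distrib)
  qed
  then show ?thesis using that[of "c/2"] c(1) by simp
qed

section \<open>The virial function\<close>

lemma has_power_series_const: "has_power_series (\<lambda>_. b) (\<lambda>\<alpha>. if \<alpha> = (\<lambda>_. 0) then b else 0) (0 :: real^'n::finite)"
proof -
  have "has_power_series (\<lambda>h :: real^'n. \<Sum>\<alpha>\<in>{\<lambda>_. 0}. b * monomial_val \<alpha> h)
      (\<lambda>\<alpha>. if \<alpha> \<in> {\<lambda>_. 0} then b else 0) 0"
    by (rule has_power_series_polynomial) simp
  then show ?thesis by (simp add: monomial_val_def)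
qed

text \<open>\<open>grad\<close> is the coordinate gradient and not the Riemannian one: then
  \<open>- dU(X)\<close> equals \<open>\<epsilon> * (grad u x \<bullet> grad u x) - norm x ^ k *
  (grad u x \<bullet> x)\<close> exactly, with no metric involved.\<close>

definition virial_field :: "nat \<Rightarrow> real \<Rightarrow> (real^'n::finite \<Rightarrow> real) \<Rightarrow> real^'n \<Rightarrow> real^'n" where
  "virial_field k \<epsilon> u x = norm x ^ k *\<^sub>R x - \<epsilon> *\<^sub>R grad u x"

definition virial_field_deriv :: "nat \<Rightarrow> real \<Rightarrow> (real^'n::finite \<Rightarrow> real) \<Rightarrow> real^'n \<Rightarrow> real^'n \<Rightarrow> real^'n" where
  "virial_field_deriv k \<epsilon> u x v =
     norm x ^ k *\<^sub>R v + (real k * (v \<bullet> sgn x) * norm x ^ (k - 1)) *\<^sub>R x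
     - \<epsilon> *\<^sub>R (\<chi> i. grad (partial_deriv i u) x \<bullet> v)"

text \<open>The origin is excluded because of the derivative of \<open>norm\<close>; orbits of
  negative energy do not meet it, as the potential vanishes there.\<close>

lemma virial_field_has_derivative:
  assumes u: "real_analytic_on u D" and x: "x \<in> D" "x \<noteq> 0"
  shows "(virial_field k \<epsilon> u has_derivative virial_field_deriv k \<epsilon> u x) (at x)"
proof -
  have 1: "((\<lambda>x. norm x ^ k) has_derivative (\<lambda>v. real k * (v \<bullet> sgn x) * norm x ^ (k - 1))) (at x)"
    by (rule has_derivative_power[OF has_derivative_norm[OF x(2)]])
  have 2: "(grad u has_derivative (\<lambda>v. \<chi> i. grad (partial_deriv i u) x \<bullet> v)) (at x)"
    unfolding has_derivative_cart_iff grad_def[of u]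
    using real_analytic_on_has_dir_deriv[OF real_analytic_on_partial_deriv[OF u] x(1)]
    by (simp add: dir_deriv_grad[abs_def])
  have "((\<lambda>x. norm x ^ k *\<^sub>R x - \<epsilon> *\<^sub>R grad u x) has_derivative
     (\<lambda>v. (norm x ^ k *\<^sub>R v + (real k * (v \<bullet> sgn x) * norm x ^ (k - 1)) *\<^sub>R x)
      - \<epsilon> *\<^sub>R (\<chi> i. grad (partial_deriv i u) x \<bullet> v))) (at x)"
    by (intro has_derivative_diff has_derivative_scaleR[OF 1 has_derivative_ident]
        has_derivative_scaleR_right[OF 2])
  then show ?thesis
    by (simp add: virial_field_def[abs_def] virial_field_deriv_def[abs_def])
qed

text \<open>Differentiating the weight contributes a multiple of
  \<open>(v \<bullet> sgn x)\<^sup>2\<close> with non-negative factor, and the condition on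
  \<epsilon> limits the Hessian to half of \<open>norm x ^ k * (norm v)\<^sup>2\<close>. The second
  bound serves to replace the Euclidean product by the metric.\<close>

lemma virial_field_deriv_bounds:
  fixes u :: "real^'n::finite \<Rightarrow> real"
  assumes x: "x \<noteq> 0" and "\<epsilon> \<ge> 0"
    and H: "\<And>i. norm (grad (partial_deriv i u) x) \<le> C * norm x ^ k"
    and \<epsilon>: "\<epsilon> * (real CARD('n) * C) \<le> 1/2"
  shows "v \<bullet> virial_field_deriv k \<epsilon> u x v \<ge> (1/2) * norm x ^ k * (norm v)\<^sup>2"
    and "norm (virial_field_deriv k \<epsilon> u x v) \<le> (real k + 2) * norm x ^ k * norm v"
proof -
  let ?H = "\<chi> i. grad (partial_deriv i u) x \<bullet> v"
  let ?R = "(real k * (v \<bullet> sgn x) * norm x ^ (k - 1)) *\<^sub>R x"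
  have "\<bar>?H $ i\<bar> \<le> C * norm x ^ k * norm v" for i
    using Cauchy_Schwarz_ineq2[of "grad (partial_deriv i u) x" v] mult_right_mono[OF H[of i], of "norm v"]
    by simp
  then have "norm ?H \<le> real CARD('n) * (C * norm x ^ k * norm v)" by (rule norm_vec_le)
  then have "\<epsilon> * norm ?H \<le> \<epsilon> * (real CARD('n) * (C * norm x ^ k * norm v))"
    using \<open>\<epsilon> \<ge> 0\<close> by (rule mult_left_mono)
  also have "\<dots> = \<epsilon> * (real CARD('n) * C) * (norm x ^ k * norm v)" by (simp add: mult_ac)
  also have "\<dots> \<le> (1/2) * (norm x ^ k * norm v)" using \<epsilon> by (intro mult_right_mono) auto
  finally have eH: "\<epsilon> * norm ?H \<le> (1/2) * (norm x ^ k * norm v)" .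
  have "v \<bullet> (\<epsilon> *\<^sub>R ?H) \<le> norm v * (\<epsilon> * norm ?H)"
    using norm_cauchy_schwarz[of v "\<epsilon> *\<^sub>R ?H"] \<open>\<epsilon> \<ge> 0\<close> by simp
  also have "\<dots> \<le> norm v * ((1/2) * (norm x ^ k * norm v))" by (intro mult_left_mono eH) simp
  finally have vH: "v \<bullet> (\<epsilon> *\<^sub>R ?H) \<le> (1/2) * norm x ^ k * (norm v)\<^sup>2"
    by (simp add: power2_eq_square mult_ac)
  have "v \<bullet> x = norm x * (v \<bullet> sgn x)" using x by (simp add: sgn_div_norm)
  then have "v \<bullet> ?R = real k * norm x ^ (k - 1) * norm x * (v \<bullet> sgn x)\<^sup>2"
    by (simp only: inner_scaleR_right power2_eq_square mult_ac)
  moreover have "\<dots> \<ge> 0" by (intro mult_nonneg_nonneg) auto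
  ultimately have vR: "v \<bullet> ?R \<ge> 0" by (simp only:)
  have "v \<bullet> virial_field_deriv k \<epsilon> u x v = norm x ^ k * (norm v)\<^sup>2 + v \<bullet> ?R - v \<bullet> (\<epsilon> *\<^sub>R ?H)"
    unfolding virial_field_deriv_def inner_diff_right inner_add_right
    by (simp only: inner_scaleR_right[of v "norm x ^ k"] power2_norm_eq_inner)
  then show "v \<bullet> virial_field_deriv k \<epsilon> u x v \<ge> (1/2) * norm x ^ k * (norm v)\<^sup>2"
    using vH vR by (simp add: field_simps)
  have nR: "norm ?R \<le> real k * norm x ^ k * norm v"
  proof (cases k)
    case (Suc m)
    have "\<bar>v \<bullet> sgn x\<bar> \<le> norm v" using Cauchy_Schwarz_ineq2[of v "sgn x"] x by (simp add: norm_sgn)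
    then have "(real k * norm x ^ k) * \<bar>v \<bullet> sgn x\<bar> \<le> (real k * norm x ^ k) * norm v"
      by (intro mult_left_mono) auto
    moreover have "norm ?R = (real k * norm x ^ k) * \<bar>v \<bullet> sgn x\<bar>"
      by (simp add: Suc abs_mult mult_ac)
    ultimately show ?thesis by simp
  qed simp
  have "norm (virial_field_deriv k \<epsilon> u x v) \<le> norm (norm x ^ k *\<^sub>R v) + norm ?R + norm (\<epsilon> *\<^sub>R ?H)"
    unfolding virial_field_deriv_def
    by (rule order_trans[OF norm_triangle_ineq4 add_right_mono[OF norm_triangle_ineq]])
  also have "\<dots> \<le> norm x ^ k * norm v + real k * norm x ^ k * norm v + (1/2) * (norm x ^ k * norm v)"
    using nR eH \<open>\<epsilon> \<ge> 0\<close> by (intro add_mono) auto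
  also have "\<dots> = (real k + 3/2) * (norm x ^ k * norm v)" by (simp add: algebra_simps)
  also have "\<dots> \<le> (real k + 2) * (norm x ^ k * norm v)" by (intro mult_right_mono) auto
  finally show "norm (virial_field_deriv k \<epsilon> u x v) \<le> (real k + 2) * norm x ^ k * norm v"
    by (simp add: mult.assoc)
qed

text \<open>Weak magnetism is the inequality \<open>2 e \<ge> k + 2\<close>: it lets the magnetic term be absorbed by
  the kinetic and the potential one.\<close>

lemma virial_absorption:
  fixes a s :: real
  assumes a: "0 < a" "a \<le> 1" and "s \<ge> 0" and e: "2 * e \<ge> k + 2"
    and C: "A \<ge> 0" "B \<ge> 0" and Aa: "A * a \<le> 1/4" and Ba: "B * a \<le> 1/4" and Bc: "B * a \<le> c / 2"
  shows "(1/2) * a ^ k * s\<^sup>2 + c * a ^ (2*k+2) - A * a ^ (k+1) * s\<^sup>2 - 2 * B * (a ^ e * s * a ^ (k+1))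
    \<ge> (c/2) * a ^ (2*k+2)"
proof -
  \<comment> \<open>\<open>q\<close> is the size of the virial field, \<open>p\<close> that of the
    magnetic derivative times the velocity.\<close>
  define p q where "p = a ^ e * s" and "q = a ^ (k + 1)"
  have "p\<^sup>2 = a ^ (2 * e) * s\<^sup>2" by (simp add: p_def power_mult_distrib power_mult[symmetric] mult.commute)
  also have "\<dots> \<le> a ^ (k + 2) * s\<^sup>2" using a e by (intro mult_right_mono power_decreasing) auto
  also have "\<dots> = a * (a * (a ^ k * s\<^sup>2))" by (simp add: power_add power2_eq_square)
  finally have p2: "p\<^sup>2 \<le> a * (a * (a ^ k * s\<^sup>2))" .
  have q2: "q\<^sup>2 = a ^ (2 * k + 2)"
    by (simp add: q_def power2_eq_square power_add mult_2 mult_2_right mult_ac)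
  \<comment> \<open>The weight \<open>a\<close> balances the two squares: \<open>p\<^sup>2\<close>
    is already smaller than the kinetic term by \<open>a\<^sup>2\<close>, so after division by
    \<open>a\<close> both parts of the bound for \<open>2 * (p * q)\<close> retain a small factor
    \<open>a\<close>.\<close>
  have "(p - a * q)\<^sup>2 \<ge> 0" by simp
  then have "a * (2 * (p * q)) \<le> p\<^sup>2 + a * (a * q\<^sup>2)" by (simp add: power2_eq_square algebra_simps)
  also have "\<dots> \<le> a * (a * (a ^ k * s\<^sup>2) + a * q\<^sup>2)" using p2 by (simp add: distrib_left)
  finally have "2 * (p * q) \<le> a * (a ^ k * s\<^sup>2) + a * q\<^sup>2" using a by simp
  then have "B * (2 * (p * q)) \<le> B * (a * (a ^ k * s\<^sup>2) + a * q\<^sup>2)" using C by (intro mult_left_mono)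
  also have "\<dots> = (B * a) * (a ^ k * s\<^sup>2) + (B * a) * q\<^sup>2" by (simp add: algebra_simps)
  also have "\<dots> \<le> (1/4) * (a ^ k * s\<^sup>2) + (c/2) * q\<^sup>2"
    using Ba Bc a by (intro add_mono mult_right_mono) auto
  finally have 1: "2 * B * (a ^ e * s * a ^ (k+1)) \<le> (1/4) * (a ^ k * s\<^sup>2) + (c/2) * a ^ (2*k+2)"
    unfolding q2 by (simp add: p_def q_def mult_ac)
  have "A * a ^ (k+1) * s\<^sup>2 = (A * a) * (a ^ k * s\<^sup>2)" by simp
  also have "\<dots> \<le> (1/4) * (a ^ k * s\<^sup>2)" using Aa a by (intro mult_right_mono) auto
  finally have 2: "A * a ^ (k+1) * s\<^sup>2 \<le> (1/4) * (a ^ k * s\<^sup>2)" .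
  have "(1/2) * E1 + c * E2 - E3 - E4 \<ge> (c/2) * E2"
    if "E4 \<le> (1/4) * E1 + (c/2) * E2" "E3 \<le> (1/4) * E1" "E1 \<ge> 0" for E1 E2 E3 E4 :: real
    using that by (simp add: field_simps)
  from this[OF 1 2] a show ?thesis by (simp only: mult.assoc) simp
qed

section \<open>Instability from estimates in one chart\<close>

context lagrangian_system
begin

text \<open>The deviation of the metric from the identity is \<open>O(norm x)\<close> and meets
  \<open>DX x v\<close>, of size \<open>norm x ^ k * norm v\<close>; its derivative is bounded and
  is taken along \<open>X\<close>, of size \<open>norm x ^ (k + 1)\<close>. Both errors lose a
  factor \<open>norm x\<close> against the kinetic gain, so a small radius absorbs them, and
  \<open>virial_absorption\<close> adds the magnetic terms.\<close>

lemma virial_growth: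
  assumes c: "c \<in> \<A>" and dom: "0 \<in> domain c"
    and normal: "\<And>i j. metric_coord \<A> g c i j 0 = (if i = j then 1 else 0)"
    and u: "has_power_series (fun_coord U c) a 0" "\<And>\<alpha>. sum \<alpha> UNIV < l \<Longrightarrow> a \<alpha> = 0"
    and reg: "sphere_regular_value (restrict (hom_poly a l) (sphere 0 1)) 0"
    and l: "l = k + 2"
    and mag: "\<And>i m. vanishes_to_order e (partial_deriv m (form_coord \<A> \<mu> c i))" and e: "2 * e \<ge> k + 2"
  obtains X DX \<kappa> M r where "r > 0" "\<kappa> > 0" "M > 0" "cball 0 r \<subseteq> domain c"
    and "\<And>x. norm x \<le> r \<Longrightarrow> x \<noteq> 0 \<Longrightarrow> (X has_derivative DX x) (at x)"
    and "\<And>x. norm x \<le> r \<Longrightarrow> norm (X x) \<le> M"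
    and "\<And>x v. norm x \<le> r \<Longrightarrow> metric_form c x v v \<ge> (1/2) * (norm v)\<^sup>2"
    and "\<And>x v w. norm x \<le> r \<Longrightarrow> \<bar>metric_form c x v w\<bar> \<le> 2 * norm v * norm w"
    and "\<And>x. norm x \<le> r \<Longrightarrow> \<bar>fun_coord U c x\<bar> \<le> M * norm x"
    and "\<And>x v. norm x \<le> r \<Longrightarrow> x \<noteq> 0 \<Longrightarrow> fun_coord U c x < 0 \<Longrightarrow>
       metric_form c x v (DX x v) + metric_deriv c x (X x) v v / 2 - dir_deriv (fun_coord U c) x (X x)
         - (form_deriv c x v (X x) - form_deriv c x (X x) v) \<ge> \<kappa> * norm x ^ (2 * k + 2)"
proof -
  let ?u = "fun_coord U c" and ?n = "real CARD('n)"
  have n: "?n > 0" by simp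
  obtain Cg where Cg: "Cg > 0" "\<forall>\<^sub>F x in nhds 0. \<forall>ij. \<bar>metric_coord \<A> g c (fst ij) (snd ij) x
      - (if fst ij = snd ij then 1 else 0)\<bar> \<le> Cg * norm x ^ 1"
  proof (rule vanishes_to_order_uniform)
    fix ij :: "'n \<times> 'n"
    let ?G = "metric_coord \<A> g c (fst ij) (snd ij)" and ?\<delta> = "if fst ij = snd ij then 1 else 0 :: real"
    obtain b where b: "has_power_series ?G b 0"
      using real_analytic_onE[OF metric_coord_analytic_domain[OF c] dom] .
    show "vanishes_to_order 1 (\<lambda>x. ?G x - ?\<delta>)"
    proof (rule power_series_vanishes_to_order[OF has_power_series_diff[OF b has_power_series_const]])
      fix \<alpha> :: "'n \<Rightarrow> nat" assume "sum \<alpha> UNIV < 1"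
      then have "\<alpha> = (\<lambda>_. 0)" by auto
      then show "b \<alpha> - (if \<alpha> = (\<lambda>_. 0) then ?\<delta> else 0) = 0"
        using has_power_series_at_center[OF b] normal by simp
    qed
  qed
  obtain Cd where Cd: "Cd > 0" "\<forall>\<^sub>F x in nhds 0. \<forall>ij. \<bar>norm (grad (metric_coord \<A> g c (fst ij) (snd ij)) x)\<bar>
      \<le> Cd * norm x ^ 0"
  proof (rule vanishes_to_order_uniform)
    fix ij :: "'n \<times> 'n"
    let ?G = "metric_coord \<A> g c (fst ij) (snd ij)"
    obtain b where b: "has_power_series ?G b 0"
      using real_analytic_onE[OF metric_coord_analytic_domain[OF c] dom] .
    show "vanishes_to_order 0 (\<lambda>x. norm (grad ?G x))"
      using grad_vanishes[OF b, of 0] unfolding vanishes_to_order_def by auto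
  qed
  obtain Ch where Ch: "Ch > 0" "\<forall>\<^sub>F x in nhds 0. \<forall>i. \<bar>norm (grad (partial_deriv i ?u) x)\<bar> \<le> Ch * norm x ^ k"
  proof (rule vanishes_to_order_uniform)
    fix i :: 'n
    have "shift_coeff i a \<alpha> = 0" if "sum \<alpha> UNIV < k + 1" for \<alpha>
    proof (rule shift_coeff_vanishing[OF u(2)])
      show "sum \<alpha> UNIV < l - 1" using that l by linarith
    qed
    then show "vanishes_to_order k (\<lambda>x. norm (grad (partial_deriv i ?u) x))"
      using grad_vanishes[OF has_power_series_partial_deriv[OF u(1)], of "k + 1" i]
      unfolding vanishes_to_order_def by auto
  qed
  obtain Cu where Cu: "Cu > 0" "\<forall>\<^sub>F x in nhds 0. norm (grad ?u x) \<le> Cu * norm x ^ (l - 1)"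
    by (rule grad_vanishes[OF u])
  obtain C0 where C0: "C0 > 0" "\<forall>\<^sub>F x in nhds 0. \<bar>?u x\<bar> \<le> C0 * norm x ^ l"
    using power_series_vanishes_to_order[OF u] unfolding vanishes_to_order_def by blast
  obtain Cm where Cm: "Cm > 0" "\<forall>\<^sub>F x in nhds 0. \<forall>im. \<bar>partial_deriv (snd im) (form_coord \<A> \<mu> c (fst im)) x\<bar>
      \<le> Cm * norm x ^ e"
    by (rule vanishes_to_order_uniform[of e "\<lambda>im. partial_deriv (snd im) (form_coord \<A> \<mu> c (fst im))"])
       (use mag in auto)
  \<comment> \<open>Exactly the value for which the Hessian of the potential, bounded through
    \<open>Ch\<close>, uses up half of the kinetic gain.\<close>
  define \<epsilon> where "\<epsilon> = 1 / (2 * (?n * Ch))"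
  have \<epsilon>: "\<epsilon> > 0" "\<epsilon> * (?n * Ch) \<le> 1/2" using n Ch(1) by (auto simp: \<epsilon>_def)
  obtain \<kappa> where \<kappa>: "\<kappa> > 0" "\<forall>\<^sub>F x in nhds 0. x \<noteq> 0 \<longrightarrow> ?u x < 0 \<longrightarrow>
       \<epsilon> * (grad ?u x \<bullet> grad ?u x) - norm x ^ k * (grad ?u x \<bullet> x) \<ge> \<kappa> * norm x ^ (2 * k + 2)"
    using potential_lower_bound[OF u reg l \<epsilon>(1)] by blast
  \<comment> \<open>\<open>CX\<close> bounds the virial field by \<open>norm x ^ (k + 1)\<close>.
    \<open>A'\<close> collects the two metric errors, from the deviation of the metric and from its
    derivative along the field, and \<open>B'\<close> one of the two magnetic terms.\<close>
  define CX where "CX = 1 + \<epsilon> * Cu"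
  define A' where "A' = ?n\<^sup>2 * Cg * (real k + 2) + ?n\<^sup>2 * Cd * CX"
  define B' where "B' = ?n\<^sup>2 * Cm * CX"
  have CX: "CX > 0" using \<epsilon> Cu by (simp add: CX_def add_pos_pos)
  have AB: "A' \<ge> 0" "B' \<ge> 0" using CX Cg Cd Cm by (auto simp: A'_def B'_def)
  have small: "\<forall>\<^sub>F x :: real^'n in nhds 0. norm x < \<delta>" if "\<delta> > 0" for \<delta>
    using that unfolding eventually_nhds_metric by (auto simp: dist_norm)
  \<comment> \<open>The second entry keeps the metric within one half of the identity, the others
    are the smallness conditions of \<open>virial_absorption\<close>. Adding 1 to \<open>A'\<close>
    and \<open>B'\<close>, which are only known to be non-negative, avoids division by zero.\<close>
  define \<delta> where "\<delta> = min 1 (min (1 / (2 * (?n\<^sup>2 * Cg + 1))) (min (1 / (4 * (A' + 1)))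
     (min (1 / (4 * (B' + 1))) (\<kappa> / (2 * (B' + 1))))))"
  have \<delta>: "\<delta> > 0" unfolding \<delta>_def using \<kappa>(1) AB Cg(1) by (auto intro!: divide_pos_pos add_nonneg_pos)
  have "\<forall>\<^sub>F x in nhds 0. x \<in> domain c" by (rule eventually_nhds_in_open[OF domain_open[OF c] dom])
  then have "\<forall>\<^sub>F x in nhds 0. x \<in> domain c \<and> norm x < \<delta>
     \<and> (\<forall>ij. \<bar>metric_coord \<A> g c (fst ij) (snd ij) x - (if fst ij = snd ij then 1 else 0)\<bar> \<le> Cg * norm x ^ 1)
     \<and> (\<forall>ij. \<bar>norm (grad (metric_coord \<A> g c (fst ij) (snd ij)) x)\<bar> \<le> Cd * norm x ^ 0)
     \<and> (\<forall>i. \<bar>norm (grad (partial_deriv i ?u) x)\<bar> \<le> Ch * norm x ^ k)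
     \<and> norm (grad ?u x) \<le> Cu * norm x ^ (l - 1) \<and> \<bar>?u x\<bar> \<le> C0 * norm x ^ l
     \<and> (\<forall>im. \<bar>partial_deriv (snd im) (form_coord \<A> \<mu> c (fst im)) x\<bar> \<le> Cm * norm x ^ e)
     \<and> (x \<noteq> 0 \<longrightarrow> ?u x < 0 \<longrightarrow>
       \<epsilon> * (grad ?u x \<bullet> grad ?u x) - norm x ^ k * (grad ?u x \<bullet> x) \<ge> \<kappa> * norm x ^ (2 * k + 2))"
    by (intro eventually_conj small[OF \<delta>] Cg(2) Cd(2) Ch(2) Cu(2) C0(2) Cm(2) \<kappa>(2))
  then obtain r' where r': "r' > 0" and near: "\<And>x. norm x < r' \<Longrightarrow> x \<in> domain c \<and> norm x < \<delta>
     \<and> (\<forall>ij. \<bar>metric_coord \<A> g c (fst ij) (snd ij) x - (if fst ij = snd ij then 1 else 0)\<bar> \<le> Cg * norm x ^ 1)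
     \<and> (\<forall>ij. \<bar>norm (grad (metric_coord \<A> g c (fst ij) (snd ij)) x)\<bar> \<le> Cd * norm x ^ 0)
     \<and> (\<forall>i. \<bar>norm (grad (partial_deriv i ?u) x)\<bar> \<le> Ch * norm x ^ k)
     \<and> norm (grad ?u x) \<le> Cu * norm x ^ (l - 1) \<and> \<bar>?u x\<bar> \<le> C0 * norm x ^ l
     \<and> (\<forall>im. \<bar>partial_deriv (snd im) (form_coord \<A> \<mu> c (fst im)) x\<bar> \<le> Cm * norm x ^ e)
     \<and> (x \<noteq> 0 \<longrightarrow> ?u x < 0 \<longrightarrow>
       \<epsilon> * (grad ?u x \<bullet> grad ?u x) - norm x ^ k * (grad ?u x \<bullet> x) \<ge> \<kappa> * norm x ^ (2 * k + 2))"
    unfolding eventually_nhds_metric dist_norm by (auto simp only: diff_0_right)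
  \<comment> \<open>Half the radius, so that the closed ball lies in the open ball of
    validity.\<close>
  define r where "r = r' / 2"
  have r: "r > 0" "r < r'" using r' by (auto simp: r_def)
  let ?X = "virial_field k \<epsilon> ?u" and ?DX = "virial_field_deriv k \<epsilon> ?u"
  have \<delta>s: "norm x \<le> 1" "?n\<^sup>2 * Cg * norm x \<le> 1/2" "A' * norm x \<le> 1/4" "B' * norm x \<le> 1/4"
    "B' * norm x \<le> \<kappa> / 2" if "norm x < \<delta>" for x :: "real^'n"
  proof -
    have le: "y * norm x \<le> z" if "norm x < z / (y + 1)" "y \<ge> 0" for y z
    proof -
      have "(y + 1) * norm x < z" using that by (simp add: pos_less_divide_eq mult.commute)
      then show ?thesis using norm_ge_zero[of x] unfolding distrib_right by linarith
    qed
    have sm: "norm x < (1/2) / (?n\<^sup>2 * Cg + 1)" "norm x < (1/4) / (A' + 1)" "norm x < (1/4) / (B' + 1)"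
      "norm x < (\<kappa>/2) / (B' + 1)"
      using that by (simp_all add: \<delta>_def)
    have "?n\<^sup>2 * Cg \<ge> 0" using Cg(1) by simp
    from le[OF sm(1) this] le[OF sm(2) AB(1)] le[OF sm(3) AB(2)] le[OF sm(4) AB(2)]
    show "?n\<^sup>2 * Cg * norm x \<le> 1/2" "A' * norm x \<le> 1/4" "B' * norm x \<le> 1/4" "B' * norm x \<le> \<kappa> / 2" .
    show "norm x \<le> 1" using that by (simp add: \<delta>_def)
  qed
  have metric: "\<bar>metric_form c x v w - v \<bullet> w\<bar> \<le> (?n\<^sup>2 * Cg) * norm x * norm v * norm w"
    if "norm x \<le> r" for x v w
  proof -
    have "v \<bullet> w = (\<Sum>i\<in>UNIV. \<Sum>j\<in>UNIV. (if i = j then 1 else 0) * v $ i * w $ j)"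
      by (simp add: inner_vec_def mult_delta_left if_distribR if_distrib[of "\<lambda>t. t * _"] cong: if_cong)
    then have "metric_form c x v w - v \<bullet> w =
        (\<Sum>i\<in>UNIV. \<Sum>j\<in>UNIV. (metric_coord \<A> g c i j x - (if i = j then 1 else 0)) * v $ i * w $ j)"
      by (simp only: metric_form_def left_diff_distrib sum_subtractf)
    also have "\<bar>\<dots>\<bar> \<le> ?n\<^sup>2 * (Cg * norm x) * norm v * norm w"
    proof (rule bilinear_bound)
      fix i j show "\<bar>metric_coord \<A> g c i j x - (if i = j then 1 else 0)\<bar> \<le> Cg * norm x"
        using near[of x] that r(2) by (auto dest: spec[of _ "(i, j)"])
    qed
    finally show ?thesis by (simp add: mult_ac)
  qed
  have X_le: "norm (?X x) \<le> CX * norm x ^ (k + 1)" if "norm x \<le> r" for x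
  proof -
    have "norm (?X x) \<le> norm (norm x ^ k *\<^sub>R x) + norm (\<epsilon> *\<^sub>R grad ?u x)"
      unfolding virial_field_def by (rule norm_triangle_ineq4)
    also have "\<dots> \<le> norm x ^ (k + 1) + \<epsilon> * (Cu * norm x ^ (k + 1))"
      using near[of x] that r(2) \<epsilon>(1) by (intro add_mono) (auto simp: l intro!: mult_left_mono)
    finally show ?thesis by (simp add: CX_def algebra_simps)
  qed
  have main: "metric_form c x v (?DX x v) + metric_deriv c x (?X x) v v / 2 - dir_deriv ?u x (?X x)
         - (form_deriv c x v (?X x) - form_deriv c x (?X x) v) \<ge> (\<kappa>/2) * norm x ^ (2 * k + 2)"
    if x: "norm x \<le> r" "x \<noteq> 0" "?u x < 0" for x v
  proof -
    let ?a = "norm x" and ?s = "norm v"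
    have xn: "norm x < r'" using x r(2) by simp
    note nr = near[OF xn]
    note ds = \<delta>s[of x]
    have a: "?a > 0" using x by simp
    have DX: "v \<bullet> ?DX x v \<ge> (1/2) * ?a ^ k * ?s\<^sup>2" "norm (?DX x v) \<le> (real k + 2) * ?a ^ k * ?s"
      using virial_field_deriv_bounds[of x \<epsilon> ?u Ch k v] x(2) \<epsilon> nr by auto
    have 1: "metric_form c x v (?DX x v) \<ge> (1/2) * ?a ^ k * ?s\<^sup>2 - (?n\<^sup>2 * Cg * (real k + 2)) * ?a ^ (k + 1) * ?s\<^sup>2"
    proof -
      have "(?n\<^sup>2 * Cg) * ?a * ?s * norm (?DX x v) \<le> (?n\<^sup>2 * Cg) * ?a * ?s * ((real k + 2) * ?a ^ k * ?s)"
        using Cg(1) by (intro mult_left_mono DX(2)) auto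
      also have "\<dots> = (?n\<^sup>2 * Cg * (real k + 2)) * ?a ^ (k + 1) * ?s\<^sup>2"
        by (simp add: power2_eq_square mult_ac)
      finally show ?thesis using metric[OF x(1), of v "?DX x v"] DX(1) by linarith
    qed
    have 2: "\<bar>metric_deriv c x (?X x) v v\<bar> \<le> (?n\<^sup>2 * Cd * CX) * ?a ^ (k + 1) * ?s\<^sup>2"
    proof -
      have "\<bar>metric_deriv c x (?X x) v v\<bar> \<le> ?n\<^sup>2 * (Cd * norm (?X x)) * ?s * ?s"
        unfolding metric_deriv_def
      proof (rule bilinear_bound)
        fix i j
        have "norm (grad (metric_coord \<A> g c i j) x) \<le> Cd"
          using nr by (auto dest!: spec[of _ "(i, j)"])
        then show "\<bar>dir_deriv (metric_coord \<A> g c i j) x (?X x)\<bar> \<le> Cd * norm (?X x)"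
          unfolding dir_deriv_grad
          using Cauchy_Schwarz_ineq2 mult_right_mono[of _ Cd "norm (?X x)"] norm_ge_zero order_trans by blast
      qed
      also have "\<dots> \<le> ?n\<^sup>2 * (Cd * (CX * ?a ^ (k + 1))) * ?s * ?s"
        using X_le[OF x(1)] Cd(1) by (intro mult_right_mono mult_left_mono) auto
      finally show ?thesis by (simp add: power2_eq_square mult_ac)
    qed
    have form: "\<bar>form_deriv c x p q\<bar> \<le> ?n\<^sup>2 * (Cm * ?a ^ e) * norm q * norm p" for p q
    proof -
      have "form_deriv c x p q = (\<Sum>i\<in>UNIV. \<Sum>m\<in>UNIV. partial_deriv m (form_coord \<A> \<mu> c i) x * q $ i * p $ m)"
        by (simp add: form_deriv_def dir_deriv_def sum_distrib_left sum_distrib_right mult_ac)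
      also have "\<bar>\<dots>\<bar> \<le> ?n\<^sup>2 * (Cm * ?a ^ e) * norm q * norm p"
      proof (rule bilinear_bound)
        fix i m show "\<bar>partial_deriv m (form_coord \<A> \<mu> c i) x\<bar> \<le> Cm * ?a ^ e"
          using nr by (auto dest!: spec[of _ "(i, m)"])
      qed
      finally show ?thesis .
    qed
    have 3: "\<bar>form_deriv c x v (?X x) - form_deriv c x (?X x) v\<bar> \<le> 2 * B' * (?a ^ e * ?s * ?a ^ (k + 1))"
    proof -
      have "\<bar>form_deriv c x v (?X x) - form_deriv c x (?X x) v\<bar> \<le> 2 * (?n\<^sup>2 * (Cm * ?a ^ e) * ?s * norm (?X x))"
        using form[of v "?X x"] form[of "?X x" v] by (simp add: mult_ac)
      also have "\<dots> \<le> 2 * (?n\<^sup>2 * (Cm * ?a ^ e) * ?s * (CX * ?a ^ (k + 1)))"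
        using X_le[OF x(1)] Cm(1) by (intro mult_left_mono) auto
      finally show ?thesis by (simp add: B'_def mult_ac)
    qed
    have "dir_deriv ?u x (?X x) = norm x ^ k * (grad ?u x \<bullet> x) - \<epsilon> * (grad ?u x \<bullet> grad ?u x)"
      by (simp add: dir_deriv_grad virial_field_def inner_diff_right)
    then have 4: "- dir_deriv ?u x (?X x) \<ge> \<kappa> * ?a ^ (2 * k + 2)" using nr x by auto
    have "(1/2) * ?a ^ k * ?s\<^sup>2 + \<kappa> * ?a ^ (2*k+2) - A' * ?a ^ (k+1) * ?s\<^sup>2 - 2 * B' * (?a ^ e * ?s * ?a ^ (k+1))
      \<ge> (\<kappa>/2) * ?a ^ (2*k+2)"
      using nr by (intro virial_absorption a ds e AB) auto
    moreover have "A' * ?a ^ (k+1) * ?s\<^sup>2 = (?n\<^sup>2 * Cg * (real k + 2)) * ?a ^ (k + 1) * ?s\<^sup>2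
        + (?n\<^sup>2 * Cd * CX) * ?a ^ (k + 1) * ?s\<^sup>2"
      by (simp add: A'_def distrib_right)
    moreover have "(?n\<^sup>2 * Cd * CX) * ?a ^ (k + 1) * ?s\<^sup>2 \<ge> 0" using Cd(1) CX by simp
    ultimately show ?thesis using 1 2 3 4 by linarith
  qed
  show ?thesis
  proof (rule that[of r "\<kappa>/2" "CX + C0" ?X ?DX])
    show "r > 0" "\<kappa>/2 > 0" "CX + C0 > 0" using r \<kappa>(1) CX C0(1) by auto
    show "cball 0 r \<subseteq> domain c" using near r(2) by auto
    fix x :: "real^'n" assume x: "norm x \<le> r"
    then have nr: "norm x < r'" using r by simp
    have a1: "norm x \<le> 1" using near[OF nr] \<delta>s by blast
    show "x \<noteq> 0 \<Longrightarrow> (?X has_derivative ?DX x) (at x)"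
      using near[OF nr] by (intro virial_field_has_derivative[OF fun_coord_analytic[OF c]]) auto
    have "norm (?X x) \<le> CX * norm x ^ (k + 1)" by (rule X_le[OF x])
    also have "\<dots> \<le> CX * 1" using a1 CX by (intro mult_left_mono power_le_one) auto
    finally show "norm (?X x) \<le> CX + C0" using C0(1) by simp
    have half: "(?n\<^sup>2 * Cg) * norm x * norm v * norm w \<le> (1/2) * norm v * norm w" for v w :: "real^'n"
      using near[OF nr] \<delta>s(2)[of x] by (intro mult_right_mono) auto
    show "metric_form c x v v \<ge> (1/2) * (norm v)\<^sup>2" for v
      using metric[OF x, of v v] half[of v v] by (simp add: dot_square_norm power2_eq_square)
    show "\<bar>metric_form c x v w\<bar> \<le> 2 * norm v * norm w" for v w
      using metric[OF x, of v w] half[of v w] Cauchy_Schwarz_ineq2[of v w]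
        mult_nonneg_nonneg[OF norm_ge_zero[of v] norm_ge_zero[of w]] by simp
    have "\<bar>?u x\<bar> \<le> C0 * norm x ^ l" using near[OF nr] by blast
    also have "\<dots> \<le> (CX + C0) * norm x"
      using C0(1) CX a1 power_decreasing[of 1 l "norm x"] l by (intro mult_mono) auto
    finally show "\<bar>?u x\<bar> \<le> (CX + C0) * norm x" .
    show "x \<noteq> 0 \<Longrightarrow> ?u x < 0 \<Longrightarrow>
       metric_form c x v (?DX x v) + metric_deriv c x (?X x) v v / 2 - dir_deriv ?u x (?X x)
         - (form_deriv c x v (?X x) - form_deriv c x (?X x) v) \<ge> (\<kappa>/2) * norm x ^ (2 * k + 2)" for v
      by (rule main[OF x])
  qed
qed

text \<open>\<open>ode_solution_confined\<close> is applied on a product of balls. A partial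
  solution in the chart is a solution on the manifold, so \<open>orbit\<close> keeps its end point
  inside the open ball of positions, and conservation of energy with \<open>R\<close> does the same
  for the velocity. Hence the solution reaches any prescribed time \<open>T\<close>.\<close>

lemma confined_solution:
  assumes c: "c \<in> \<A>" and r: "cball 0 r \<subseteq> domain c"
    and x0: "x0 \<in> chart_dom c" "norm (chart_map c x0) < r" and \<xi>: "\<xi> \<in> tangent_space \<A> x0"
    and B: "B = {x \<in> chart_dom c. norm (chart_map c x) < r}"
    and orbit: "positive_orbit \<A> g U \<mu> A (x0, \<xi>) \<subseteq> tangent_bundle \<A> B"
    and R: "\<And>y v. norm y \<le> r \<Longrightarrow> metric_form c y v v / 2 + fun_coord U c y = energy g U (x0, \<xi>) \<Longrightarrow> norm v < R"
    and "0 \<le> T"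
  obtains Y V where
    "\<And>t. t \<in> {0..T} \<Longrightarrow> norm (Y t) \<le> r"
    "\<And>t. t \<in> {0..T} \<Longrightarrow> metric_form c (Y t) (V t) (V t) / 2 + fun_coord U c (Y t) = energy g U (x0, \<xi>)"
    "\<And>t. t \<in> {0..T} \<Longrightarrow> (Y has_vector_derivative V t) (at t within {0..T})"
    "\<And>t. t \<in> {0..T} \<Longrightarrow> (V has_vector_derivative accel c (Y t) (V t)) (at t within {0..T})"
proof -
  let ?h = "energy g U (x0, \<xi>)"
  define y0 v0 where "y0 = chart_map c x0" and "v0 = \<xi> c"
  have cx: "c \<in> charts_at \<A> x0" using c x0 by (simp add: charts_at_iff)
  have x0y: "chart_inv c y0 = x0" using x0 c by (simp add: y0_def chart_inv_chart_map)
  have T\<xi>: "tangent_of \<A> c x0 v0 = \<xi>" using tangent_of_coord[OF cx \<xi>] by (simp add: v0_def)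
  have h0: "metric_form c y0 v0 v0 / 2 + fun_coord U c y0 = ?h"
    using metric_tangent_of[OF cx, of v0 v0] by (simp add: energy_def T\<xi> y0_def[symmetric] fun_coord_def x0y)
  let ?K = "cball (0 :: real^'n) r \<times> cball (0 :: real^'n) R"
  let ?G = "\<lambda>z. (snd z, accel c (fst z) (snd z))"
  obtain L where L: "L-lipschitz_on ?K ?G"
    using accel_lipschitz[OF c compact_cball convex_cball r compact_cball] by blast
  \<comment> \<open>Stated for arbitrary curves and times, as it is needed for the partial solutions
    in the confinement argument and again for the final one.\<close>
  have energy: "metric_form c (Y t) (V t) (V t) / 2 + fun_coord U c (Y t) = ?h"
    if S: "0 \<le> S" and init: "Y 0 = y0" "V 0 = v0"
      and dom: "\<And>t. t \<in> {0..S} \<Longrightarrow> norm (Y t) \<le> r"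
      and dY: "\<And>t. t \<in> {0..S} \<Longrightarrow> (Y has_vector_derivative V t) (at t within {0..S})"
      and dV: "\<And>t. t \<in> {0..S} \<Longrightarrow> (V has_vector_derivative accel c (Y t) (V t)) (at t within {0..S})"
      and t: "t \<in> {0..S}" for S t Y V
  proof -
    let ?e = "\<lambda>t. metric_form c (Y t) (V t) (V t) / 2 + fun_coord U c (Y t)"
    have "(?e has_vector_derivative 0) (at t within {0..S})" if t: "t \<in> {0..S}" for t
    proof -
      have "Y t \<in> domain c" using dom[OF t] r by auto
      then show ?thesis
        by (intro energy_derivative[OF c _ dY[OF t] dV[OF t]] el_form_accel[OF c])
    qed
    then obtain b where "\<And>t. t \<in> {0..S} \<Longrightarrow> ?e t = b"
      using has_vector_derivative_zero_constant[of "{0..S}" ?e] by blast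
    then have "?e t = ?e 0" using t S by simp
    then show ?thesis using h0 init by simp
  qed
  obtain z where z0: "z 0 = (y0, v0)" and zW: "\<And>t. t \<in> {0..T} \<Longrightarrow> z t \<in> ball 0 r \<times> ball 0 R"
    and dz: "\<And>t. t \<in> {0..T} \<Longrightarrow> (z has_vector_derivative ?G (z t)) (at t within {0..T})"
  proof (rule ode_solution_confined[of ?K L ?G "(y0, v0)" "ball 0 r \<times> ball 0 R" T])
    note obt = that
    show thesis if "z 0 = (y0, v0)" "\<And>t. t \<in> {0..T} \<Longrightarrow> z t \<in> ball 0 r \<times> ball 0 R"
      "\<And>t. t \<in> {0..T} \<Longrightarrow> (z has_vector_derivative ?G (z t)) (at t within {0..T})" for z
      using that by (rule obt)
    show "convex ?K" by (intro convex_Times convex_cball)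
    show "compact ?K" by (intro compact_Times compact_cball)
    show "L-lipschitz_on ?K ?G" by (rule L)
    have "norm y0 < r" using x0 by (simp add: y0_def)
    then show "(y0, v0) \<in> ?K" using R[OF _ h0] by (auto simp: less_imp_le)
    show "open (ball (0 :: real^'n) r \<times> ball (0 :: real^'n) R)" by (intro open_Times open_ball)
    show "ball 0 r \<times> ball 0 R \<subseteq> ?K" by (auto simp: less_imp_le)
    show "0 \<le> T" by fact
    fix z S
    assume S: "0 \<le> S" and init: "z 0 = (y0, v0)" and K: "\<And>t. t \<in> {0..S} \<Longrightarrow> z t \<in> ?K"
      and dz: "\<And>t. t \<in> {0..S} \<Longrightarrow> (z has_vector_derivative ?G (z t)) (at t within {0..S})"
    define Y V where "Y t = fst (z t)" and "V t = snd (z t)" for t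
    have dY: "(Y has_vector_derivative V t) (at t within {0..S})" if "t \<in> {0..S}" for t
      using has_derivative_fst[OF dz[OF that, unfolded has_vector_derivative_def]]
      by (simp add: has_vector_derivative_def Y_def[abs_def] V_def)
    have dV: "(V has_vector_derivative accel c (Y t) (V t)) (at t within {0..S})" if "t \<in> {0..S}" for t
      using has_derivative_snd[OF dz[OF that, unfolded has_vector_derivative_def]]
      by (simp add: has_vector_derivative_def V_def[abs_def] Y_def)
    have Yr: "norm (Y t) \<le> r" if "t \<in> {0..S}" for t
      using K[OF that] by (auto simp: Y_def mem_Times_iff)
    have Ydom: "Y t \<in> domain c" if "t \<in> {0..S}" for t using Yr[OF that] r by auto
    let ?\<gamma> = "\<lambda>t. (chart_inv c (Y t), tangent_of \<A> c (chart_inv c (Y t)) (V t))"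
    have sol: "euler_lagrange_solution \<A> g U \<mu> A S ?\<gamma>"
      by (rule chart_solution_euler_lagrange[OF c Ydom dY dV el_form_accel[OF c Ydom]])
    have start: "?\<gamma> 0 = (x0, \<xi>)" using init by (simp add: Y_def V_def x0y T\<xi>)
    \<comment> \<open>The orbit consists of end points of solutions, so the solution is cut at the
      time \<open>S\<close> under consideration.\<close>
    have "?\<gamma> S \<in> positive_orbit \<A> g U \<mu> A (x0, \<xi>)"
      unfolding positive_orbit_def
      by (rule CollectI, rule exI[of _ ?\<gamma>], rule exI[of _ S]) (intro conjI refl S sol start)
    with orbit have "chart_inv c (Y S) \<in> B" by (auto simp: tangent_bundle_def)
    moreover have "chart_map c (chart_inv c (Y S)) = Y S"
      using Ydom[of S] S c by (auto simp: domain_def chart_inv_chart_map)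
    ultimately have "norm (Y S) < r" by (simp add: B)
    moreover have "norm (V S) < R"
    proof (rule R[OF Yr])
      show "metric_form c (Y S) (V S) (V S) / 2 + fun_coord U c (Y S) = ?h"
        using S init by (intro energy[OF S _ _ Yr dY dV]) (auto simp: Y_def V_def)
    qed (use S in simp)
    ultimately show "z S \<in> ball 0 r \<times> ball 0 R" by (simp add: mem_Times_iff Y_def V_def)
  qed
  define Y V where "Y t = fst (z t)" and "V t = snd (z t)" for t
  have dY: "(Y has_vector_derivative V t) (at t within {0..T})" if "t \<in> {0..T}" for t
    using has_derivative_fst[OF dz[OF that, unfolded has_vector_derivative_def]]
    by (simp add: has_vector_derivative_def Y_def[abs_def] V_def)
  have dV: "(V has_vector_derivative accel c (Y t) (V t)) (at t within {0..T})" if "t \<in> {0..T}" for t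
    using has_derivative_snd[OF dz[OF that, unfolded has_vector_derivative_def]]
    by (simp add: has_vector_derivative_def V_def[abs_def] Y_def)
  have Yr: "norm (Y t) \<le> r" if "t \<in> {0..T}" for t
    using zW[OF that] by (simp add: Y_def mem_Times_iff)
  show ?thesis
  proof (rule that[of Y V])
    show "metric_form c (Y t) (V t) (V t) / 2 + fun_coord U c (Y t) = ?h" if "t \<in> {0..T}" for t
      using z0 by (intro energy[OF \<open>0 \<le> T\<close> _ _ Yr dY dV that]) (auto simp: Y_def V_def)
  qed (fact Yr dY dV)+
qed

text \<open>The order \<open>e\<close> refers to the first derivatives of the coefficients of \<mu>,
  since only the exterior derivative enters the equation of motion; in this form a zero germ and a
  jet of sufficient degree are treated alike.\<close>

lemma totally_unstable_of_jets:
  assumes c: "c \<in> \<A>" and p: "p \<in> chart_dom c" "p \<in> A" "chart_map c p = 0"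
    and normal: "\<And>i j. metric_coord \<A> g c i j 0 = (if i = j then 1 else 0)"
    and u: "has_power_series (fun_coord U c) a 0" "\<And>\<alpha>. sum \<alpha> UNIV < l \<Longrightarrow> a \<alpha> = 0"
    and reg: "sphere_regular_value (restrict (hom_poly a l) (sphere 0 1)) 0"
    and l: "l = k + 2"
    and mag: "\<And>i m. vanishes_to_order e (partial_deriv m (form_coord \<A> \<mu> c i))" and e: "2 * e \<ge> k + 2"
  shows "totally_unstable \<A> g U \<mu> A p"
proof -
  have dom: "0 \<in> domain c" unfolding domain_def using p by (metis IntI image_eqI)
  obtain X DX \<kappa> M r where pos: "r > 0" "\<kappa> > 0" "M > 0" and r: "cball 0 r \<subseteq> domain c"
    and dX: "\<And>x. norm x \<le> r \<Longrightarrow> x \<noteq> 0 \<Longrightarrow> (X has_derivative DX x) (at x)"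
    and XM: "\<And>x. norm x \<le> r \<Longrightarrow> norm (X x) \<le> M"
    and lower: "\<And>x v. norm x \<le> r \<Longrightarrow> metric_form c x v v \<ge> (1/2) * (norm v)\<^sup>2"
    and upper: "\<And>x v w. norm x \<le> r \<Longrightarrow> \<bar>metric_form c x v w\<bar> \<le> 2 * norm v * norm w"
    and UM: "\<And>x. norm x \<le> r \<Longrightarrow> \<bar>fun_coord U c x\<bar> \<le> M * norm x"
    and growth: "\<And>x v. norm x \<le> r \<Longrightarrow> x \<noteq> 0 \<Longrightarrow> fun_coord U c x < 0 \<Longrightarrow>
       metric_form c x v (DX x v) + metric_deriv c x (X x) v v / 2 - dir_deriv (fun_coord U c) x (X x)
         - (form_deriv c x v (X x) - form_deriv c x (X x) v) \<ge> \<kappa> * norm x ^ (2 * k + 2)"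
  proof (rule virial_growth[OF c dom normal u reg l mag e], assumption, goal_cases)
    case 1
    from 1(2-) show ?case by (rule 1(1))
  qed
  define B where "B = {x \<in> chart_dom c. norm (chart_map c x) < r}"
  have "open B"
  proof -
    have "open (chart_dom c \<inter> chart_map c -` ball 0 r)"
      by (rule continuous_open_preimage[OF homeomorphism_cont1[OF chart(3)[OF c]] chart(1)[OF c] open_ball])
    moreover have "chart_dom c \<inter> chart_map c -` ball 0 r = B" by (auto simp: B_def)
    ultimately show ?thesis by simp
  qed
  moreover have "p \<in> B" using p pos by (simp add: B_def)
  ultimately have "p \<in> interior B" by (simp add: interior_open)
  moreover have "B \<subseteq> A"
  proof
    fix x assume x: "x \<in> B"
    then have "chart_map c x \<in> domain c" using r by (auto simp: B_def)
    then obtain x' where x': "x' \<in> chart_dom c" "x' \<in> A" "chart_map c x = chart_map c x'"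
      by (auto simp: domain_def)
    have "x = x'" using chart_inv_chart_map[OF c] x x' by (metis (lifting) B_def mem_Collect_eq)
    with x' show "x \<in> A" by simp
  qed
  moreover have "\<not> positive_orbit \<A> g U \<mu> A z \<subseteq> tangent_bundle \<A> B"
    if z: "z \<in> tangent_bundle \<A> B" and neg: "energy g U z < 0" for z
  proof
    assume orbit: "positive_orbit \<A> g U \<mu> A z \<subseteq> tangent_bundle \<A> B"
    obtain x0 \<xi> where zx: "z = (x0, \<xi>)" "x0 \<in> B" "\<xi> \<in> tangent_space \<A> x0"
      using z by (auto simp: tangent_bundle_def)
    define h where "h = energy g U (x0, \<xi>)"
    have h: "h < 0" using neg zx by (simp add: h_def)
    \<comment> \<open>Energy \<open>h < 0\<close>, the lower bound for the metric and
      \<open>\<bar>U\<bar> \<le> M * r\<close> give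
      \<open>(norm v)\<^sup>2 \<le> 4 * (M * r)\<close>; the chosen number has a larger square,
      without taking a root.\<close>
    define R where "R = 2 * M * r + 2"
    have R: "norm v < R" if "norm y \<le> r" "metric_form c y v v / 2 + fun_coord U c y = h" for y v
    proof -
      have "M * norm y \<le> M * r" using that pos by (intro mult_left_mono) auto
      then have "(norm v)\<^sup>2 \<le> 4 * (M * r)"
        using lower[OF that(1), of v] UM[OF that(1)] that(2) h by (simp add: field_simps abs_le_iff)
      also have "\<dots> < R\<^sup>2"
      proof -
        have "R\<^sup>2 = 4 * (M * r)\<^sup>2 + 8 * (M * r) + 4"
          by (simp add: R_def power2_eq_square algebra_simps)
        moreover have "M * r > 0" using pos by simp
        ultimately show ?thesis using zero_le_power2[of "M * r"] by linarith
      qed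
      finally show ?thesis
        by (rule power2_less_imp_less) (use pos in \<open>simp add: R_def\<close>)
    qed
    have Rpos: "R > 0" using pos by (simp add: R_def add_pos_pos)
    \<comment> \<open>Kinetic energy is non-negative, so \<open>U \<le> h\<close> along the
      solution, and \<open>\<bar>U\<bar> \<le> M * norm x\<close> then keeps the solution at
      distance at least \<rho> from 0. There \<eta> bounds the growth rate of the virial function
      from below.\<close>
    define \<rho> where "\<rho> = - h / M"
    define \<eta> where "\<eta> = \<kappa> * \<rho> ^ (2 * k + 2)"
    have \<rho>: "\<rho> > 0" using h pos by (simp add: \<rho>_def divide_neg_pos)
    have \<eta>: "\<eta> > 0" using \<rho> pos by (simp add: \<eta>_def)
    \<comment> \<open>In this time the virial function would grow by at least
      \<open>4 * R * M + 1\<close>, but its absolute value never exceeds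
      \<open>2 * R * M\<close>.\<close>
    define T where "T = (4 * R * M + 1) / \<eta>"
    have T: "T > 0" using \<eta> Rpos pos by (simp add: T_def add_pos_pos)
    obtain Y V where Yr: "\<And>t. t \<in> {0..T} \<Longrightarrow> norm (Y t) \<le> r"
      and en: "\<And>t. t \<in> {0..T} \<Longrightarrow> metric_form c (Y t) (V t) (V t) / 2 + fun_coord U c (Y t) = h"
      and dY: "\<And>t. t \<in> {0..T} \<Longrightarrow> (Y has_vector_derivative V t) (at t within {0..T})"
      and dV: "\<And>t. t \<in> {0..T} \<Longrightarrow> (V has_vector_derivative accel c (Y t) (V t)) (at t within {0..T})"
    proof (rule confined_solution[OF c r _ _ zx(3) B_def, unfolded h_def[symmetric]])
      show "x0 \<in> chart_dom c" "norm (chart_map c x0) < r" using zx(2) by (simp_all add: B_def)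
      show "positive_orbit \<A> g U \<mu> A (x0, \<xi>) \<subseteq> tangent_bundle \<A> B" using orbit zx by simp
      show "norm v < R" if "norm y \<le> r" "metric_form c y v v / 2 + fun_coord U c y = h" for y v
        using that by (rule R)
      show "0 \<le> T" using T by simp
      note obt = that
      show thesis if "\<And>t. t \<in> {0..T} \<Longrightarrow> norm (Y t) \<le> r"
        "\<And>t. t \<in> {0..T} \<Longrightarrow> metric_form c (Y t) (V t) (V t) / 2 + fun_coord U c (Y t) = h"
        "\<And>t. t \<in> {0..T} \<Longrightarrow> (Y has_vector_derivative V t) (at t within {0..T})"
        "\<And>t. t \<in> {0..T} \<Longrightarrow> (V has_vector_derivative accel c (Y t) (V t)) (at t within {0..T})"
        for Y V using that by (rule obt)
    qed
    let ?\<Lambda> = "\<lambda>t. metric_form c (Y t) (V t) (X (Y t))"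
    define D where "D t = metric_form c (Y t) (V t) (DX (Y t) (V t))
       + metric_deriv c (Y t) (X (Y t)) (V t) (V t) / 2
       - dir_deriv (fun_coord U c) (Y t) (X (Y t))
       - (form_deriv c (Y t) (V t) (X (Y t)) - form_deriv c (Y t) (X (Y t)) (V t))" for t
    have step: "(?\<Lambda> has_derivative (\<lambda>s. s * D t)) (at t within {0..T}) \<and> D t \<ge> \<eta>"
      if t: "t \<in> {0..T}" for t
    proof -
      have "metric_form c (Y t) (V t) (V t) \<ge> 0" using lower[OF Yr[OF t], of "V t"] by (rule order_trans[rotated]) simp
      then have uh: "fun_coord U c (Y t) \<le> h" using en[OF t] by linarith
      then have "- h \<le> M * norm (Y t)" using UM[OF Yr[OF t]] by linarith
      then have \<rho>Y: "\<rho> \<le> norm (Y t)"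
        unfolding \<rho>_def pos_divide_le_eq[OF pos(3)] by (simp only: mult.commute)
      then have nz: "Y t \<noteq> 0" using \<rho> by auto
      have Yd: "Y t \<in> domain c" using Yr[OF t] r by auto
      have "(?\<Lambda> has_vector_derivative D t) (at t within {0..T})"
        unfolding D_def
        by (rule virial_derivative[OF c Yd dY[OF t] dV[OF t] el_form_accel[OF c Yd] dX[OF Yr[OF t] nz]])
      moreover have "\<eta> \<le> \<kappa> * norm (Y t) ^ (2 * k + 2)"
        unfolding \<eta>_def using \<rho>Y \<rho> pos by (intro mult_left_mono power_mono) auto
      moreover have "\<dots> \<le> D t" unfolding D_def using uh h by (intro growth[OF Yr[OF t] nz]) simp
      ultimately show ?thesis by (simp add: has_vector_derivative_def)
    qed
    obtain s where s: "s \<in> {0<..<T}" "?\<Lambda> T - ?\<Lambda> 0 = (T - 0) * D s"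
      using mvt_simple[of 0 T ?\<Lambda> "\<lambda>t s. s * D t"] T step by auto
    have "\<eta> * T \<le> T * D s" using step[of s] s(1) T by (simp add: mult.commute)
    moreover have "\<eta> * T = 4 * R * M + 1" using \<eta> by (simp add: T_def)
    moreover have "\<bar>?\<Lambda> t\<bar> \<le> 2 * R * M" if t: "t \<in> {0..T}" for t
    proof -
      have "\<bar>?\<Lambda> t\<bar> \<le> 2 * norm (V t) * norm (X (Y t))" by (rule upper[OF Yr[OF t]])
      also have "\<dots> \<le> 2 * R * M"
        using R[OF Yr[OF t] en[OF t]] XM[OF Yr[OF t]] Rpos by (intro mult_mono) auto
      finally show ?thesis .
    qed
    from this[of T] this[of 0] have "\<bar>?\<Lambda> T\<bar> \<le> 2 * R * M" "\<bar>?\<Lambda> 0\<bar> \<le> 2 * R * M" using T by auto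
    ultimately show False using s(2)[unfolded diff_0_right] by (simp only: abs_le_iff) linarith
  qed
  ultimately show ?thesis unfolding totally_unstable_def by blast
qed

end

text \<open>If all Taylor terms vanished, so would all coefficients and hence the germ; this makes
  \<open>LEAST\<close> meaningful. Degrees 0 and 1 are excluded because their coefficients are the
  value and the first derivatives at 0.\<close>

lemma potential_degree_facts:
  assumes u: "has_power_series F a 0" and nz: "\<not> (\<forall>\<^sub>F x in nhds 0. F x = 0)"
    and F0: "F 0 = 0" and dF: "(F has_derivative (\<lambda>_. 0)) (at 0)"
    and l: "l = (LEAST k. \<exists>h. taylor_term F 0 k h \<noteq> 0)"
  shows "l \<ge> 2" and "\<And>\<alpha>. sum \<alpha> UNIV < l \<Longrightarrow> a \<alpha> = 0"
proof -
  note tt = taylor_term_eq[OF u]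
  have ex: "\<exists>k h. taylor_term F 0 k h \<noteq> 0"
  proof (rule ccontr)
    assume "\<not> (\<exists>k h. taylor_term F 0 k h \<noteq> 0)"
    then have "a \<alpha> = 0" for \<alpha> using hom_poly_zero_imp_coeffs[of a "sum \<alpha> UNIV" \<alpha>] by (simp add: tt)
    moreover obtain r where "r > 0" and
      hs: "\<And>z. z \<in> ball 0 r \<Longrightarrow> ((\<lambda>\<alpha>. a \<alpha> * monomial_val \<alpha> (z - 0)) has_sum F z) UNIV"
      using u unfolding has_power_series_def by blast
    ultimately have "F z = 0" if "z \<in> ball 0 r" for z
      using has_sum_unique[OF hs[OF that] has_sum_0] by simp
    then have "\<forall>\<^sub>F x in nhds 0. F x = 0"
      using \<open>r > 0\<close> unfolding eventually_nhds_metric by (auto simp: dist_commute)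
    with nz show False by contradiction
  qed
  then have Least: "\<exists>h. hom_poly a l h \<noteq> 0" unfolding l tt by (rule LeastI_ex)
  show below: "a \<alpha> = 0" if "sum \<alpha> UNIV < l" for \<alpha>
    using not_less_Least[OF that[unfolded l]] hom_poly_zero_imp_coeffs[of a "sum \<alpha> UNIV" \<alpha>]
    by (auto simp: tt)
  have a0: "a (\<lambda>_. 0) = 0" using has_power_series_at_center[OF u] F0 by simp
  have ai: "shift_coeff i a (\<lambda>_. 0) = 0" for i
  proof -
    have "partial_deriv i F 0 = 0"
      unfolding partial_deriv_def frechet_derivative_at[OF dF, symmetric] ..
    then show ?thesis
      using has_power_series_at_center[OF has_power_series_partial_deriv[OF u], of i] by simp
  qed
  show "l \<ge> 2"
  proof (rule ccontr)
    assume "\<not> l \<ge> 2"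
    \<comment> \<open>With \<open>l \<le> 1\<close> such an exponent is zero or a unit
      vector.\<close>
    have "a \<alpha> = 0" if \<alpha>: "sum \<alpha> UNIV = l" for \<alpha>
    proof (cases "\<alpha> = (\<lambda>_. 0)")
      case False
      then obtain i where i: "\<alpha> i > 0" by auto
      define \<beta> where "\<beta> = \<alpha>(i := \<alpha> i - 1)"
      have \<alpha>\<beta>: "\<alpha> = \<beta>(i := \<beta> i + 1)" using i by (auto simp: \<beta>_def)
      have "sum \<beta> UNIV = 0"
        using sum_fun_upd_pred[of \<alpha> i, OF i] \<alpha> \<open>\<not> l \<ge> 2\<close> by (simp only: \<beta>_def)
      then have "\<beta> = (\<lambda>_. 0)" by auto
      then have "a (\<beta>(i := \<beta> i + 1)) = 0" using ai[of i] by (simp add: shift_coeff_def)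
      then show ?thesis by (simp only: \<alpha>\<beta>[symmetric])
    qed (use a0 in simp)
    then have "hom_poly a l h = 0" for h by (simp add: hom_poly_def)
    with Least show False by simp
  qed
qed

theorem proposition1p2:
  fixes \<A> :: "('a::{t2_space, second_countable_topology}, 'n::finite) chart set"
    and g :: "('a, 'n) metric"
    and U :: "'a \<Rightarrow> real"
    and \<mu> :: "('a, 'n) one_form"
    and A :: "'a set"
    and p :: 'a
    and \<phi> :: "('a, 'n) chart"
    and f :: "real^'n \<Rightarrow> real"
  assumes "real_analytic_manifold \<A>"
    and "analytic_riemannian_metric \<A> g"
    and "open A" and "p \<in> A"
    and "analytic_function_on \<A> U A"
    and "analytic_one_form_on \<A> \<mu> A"
    and "\<not> (\<forall>\<^sub>F x in nhds p. U x = 0)"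
    and "U p = 0"
    and "differential_zero_at \<A> U p"
    and "normal_chart_at \<A> g p \<phi>"
    and "weak_magnetism \<A> U \<mu> p \<phi>"
    and "f = restrict (potential_jet U \<phi>) (sphere 0 1)"
    and "sphere_morse f"
    and "sphere_regular_value f 0"
  shows "totally_unstable \<A> g U \<mu> A p"
proof -
  interpret lagrangian_system \<A> g U \<mu> A
    by unfold_locales (fact assms)+
  have at: "\<phi> \<in> charts_at \<A> p" and p0: "chart_map \<phi> p = 0"
    and normal: "\<And>i j. metric_coord \<A> g \<phi> i j 0 = (if i = j then 1 else 0)"
    using \<open>normal_chart_at \<A> g p \<phi>\<close> by (auto simp: normal_chart_at_def)
  then have c: "\<phi> \<in> \<A>" and p: "p \<in> chart_dom \<phi>" by (auto simp: charts_at_iff)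
  have inv0: "chart_inv \<phi> 0 = p" using chart_inv_chart_map[OF c p] p0 by simp
  have dom: "0 \<in> domain \<phi>" unfolding domain_def using p p0 \<open>p \<in> A\<close> by (metis IntI image_eqI)
  let ?u = "fun_coord U \<phi>" and ?l = "potential_degree U \<phi>"
  obtain a where a: "has_power_series ?u a 0"
    using real_analytic_onE[OF fun_coord_analytic[OF c] dom] .
  have nz: "\<not> (\<forall>\<^sub>F y in nhds 0. ?u y = 0)"
  proof
    assume "\<forall>\<^sub>F y in nhds 0. ?u y = 0"
    then obtain S where S: "open S" "0 \<in> S" "\<And>y. y \<in> S \<Longrightarrow> ?u y = 0"
      unfolding eventually_nhds by blast
    have "open (chart_dom \<phi> \<inter> chart_map \<phi> -` S)"
      by (rule continuous_open_preimage[OF homeomorphism_cont1[OF chart(3)[OF c]] chart(1)[OF c] S(1)])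
    moreover have "p \<in> chart_dom \<phi> \<inter> chart_map \<phi> -` S" using p p0 S(2) by simp
    moreover have "U x = 0" if "x \<in> chart_dom \<phi> \<inter> chart_map \<phi> -` S" for x
      using S(3)[of "chart_map \<phi> x"] that chart_inv_chart_map[OF c, of x] by (simp add: fun_coord_def)
    ultimately have "\<forall>\<^sub>F x in nhds p. U x = 0" unfolding eventually_nhds by blast
    with \<open>\<not> (\<forall>\<^sub>F x in nhds p. U x = 0)\<close> show False by contradiction
  qed
  have u0: "?u 0 = 0" using \<open>U p = 0\<close> by (simp add: fun_coord_def inv0)
  have du: "(?u has_derivative (\<lambda>_. 0)) (at 0)"
    using \<open>differential_zero_at \<A> U p\<close> at p0 by (force simp: differential_zero_at_def)
  have l2: "?l \<ge> 2"
    by (rule potential_degree_facts(1)[OF a nz u0 du]) (rule potential_degree_def)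
  have below: "a \<alpha> = 0" if "sum \<alpha> UNIV < ?l" for \<alpha>
    by (rule potential_degree_facts(2)[OF a nz u0 du _ that]) (rule potential_degree_def)
  obtain k where k: "?l = k + 2" using le_Suc_ex[OF l2] by (metis add.commute)
  have "potential_jet U \<phi> = hom_poly a ?l" unfolding potential_jet_def by (rule taylor_term_eq[OF a])
  then have reg: "sphere_regular_value (restrict (hom_poly a ?l) (sphere 0 1)) 0"
    using assms(12,14) by simp
  \<comment> \<open>For a zero germ any order is available and \<open>k + 2\<close> is taken.
    Otherwise one derivative lowers the degree \<open>d\<close> of the jet by one, and
    \<open>d - l / 2 \<ge> 1\<close> reads \<open>2 * (d - 1) \<ge> l = k + 2\<close>.\<close>
  have "\<exists>e. 2 * e \<ge> k + 2 \<and> (\<forall>i m. vanishes_to_order e (partial_deriv m (form_coord \<A> \<mu> \<phi> i)))"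
    using \<open>weak_magnetism \<A> U \<mu> p \<phi>\<close> unfolding weak_magnetism_def
  proof
    assume "\<forall>\<^sub>F x in nhds p. \<forall>v\<in>tangent_space \<A> x. \<mu> x v = 0"
    then obtain S where S: "open S" "p \<in> S" "\<And>x v. x \<in> S \<Longrightarrow> v \<in> tangent_space \<A> x \<Longrightarrow> \<mu> x v = 0"
      unfolding eventually_nhds by blast
    define N where "N = chart_map \<phi> ` (chart_dom \<phi> \<inter> S)"
    have N: "open N" "0 \<in> N"
      unfolding N_def using chart_image_open[OF c S(1)] p p0 S(2) by (auto intro!: image_eqI[of 0 _ p])
    have form0: "form_coord \<A> \<mu> \<phi> i y = 0" if "y \<in> N" for i y
      using that c S(3) unfolding N_def
      by (auto simp: form_coord_def chart_inv_chart_map charts_at_iff tangent_of_in_tangent_space)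
    have "partial_deriv m (form_coord \<A> \<mu> \<phi> i) y = 0" if "y \<in> N" for i m y
    proof -
      have "partial_deriv m (form_coord \<A> \<mu> \<phi> i) y = partial_deriv m (\<lambda>_. 0) y"
        by (rule partial_deriv_cong_open[OF N(1) that form0])
      then show ?thesis by (simp add: partial_deriv_def)
    qed
    then have "vanishes_to_order (k + 2) (partial_deriv m (form_coord \<A> \<mu> \<phi> i))" for i m
      unfolding vanishes_to_order_def
      by (intro exI[of _ 1] conjI eventually_mono[OF eventually_nhds_in_open[OF N]]) auto
    then show ?thesis by (intro exI[of _ "k + 2"]) auto
  next
    let ?d = "magnetic_degree \<A> \<mu> \<phi>"
    assume "1 \<le> real ?d - real ?l / 2"
    \<comment> \<open>The inequality also forces \<open>?d \<ge> 1\<close>, so the subtraction is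
      not truncated.\<close>
    then have d: "2 * (?d - 1) \<ge> k + 2" using k by linarith
    have "vanishes_to_order (?d - 1) (partial_deriv m (form_coord \<A> \<mu> \<phi> i))" for i m
    proof -
      obtain b where b: "has_power_series (form_coord \<A> \<mu> \<phi> i) b 0"
        using real_analytic_onE[OF form_coord_analytic[OF c] dom] .
      have "b \<alpha> = 0" if "sum \<alpha> UNIV < ?d" for \<alpha>
      proof (rule hom_poly_zero_imp_coeffs[OF _ refl])
        show "hom_poly b (sum \<alpha> UNIV) h = 0" for h
          using not_less_Least[OF that[unfolded magnetic_degree_def]]
          unfolding taylor_term_eq[OF b, symmetric] by blast
      qed
      then show ?thesis
        by (intro power_series_vanishes_to_order[OF has_power_series_partial_deriv[OF b]]
            shift_coeff_vanishing[of ?d b])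
    qed
    with d show ?thesis by blast
  qed
  then obtain e where e: "2 * e \<ge> k + 2"
    and mag: "\<And>i m. vanishes_to_order e (partial_deriv m (form_coord \<A> \<mu> \<phi> i))" by blast
  show ?thesis
    by (rule totally_unstable_of_jets[OF c p \<open>p \<in> A\<close> p0 normal a below reg k mag e])
qed

end
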